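(* Let $\mathbb F$ be a field of characteristic other than $2$, with prime subfield $\mathbb F_0$, and let $\alpha,\beta\in\mathbb F$ be such that $0,1,\alpha,\beta$ are pairwise distinct and $\alpha\notin\{2\beta,4\beta\}$. Let $\mathcal M_r(2,\mathbb F)$ be a set of representatives of the isomorphism classes of $2$-generated primitive axial algebras of Monster type $(\alpha,\beta)$ over $\mathbb F$ (with marked pair of generating axes). Let $p_1,p_2,p_3,p_4\in\mathbb F_0(\alpha,\beta)[x,y,z,t]$ be the polynomials defined in the context, and let $\mathrm{Var}(\{p_1,p_2,p_3,p_4\})\subseteq\mathbb A^4_{\mathbb F}=\mathbb F^4$ be the set of their common zeros. Then there is a map $\xi\colon\mathcal M_r(2,\mathbb F)\to\mathbb A_{\mathbb F}^4$ such that: (1) $\operatorname{im}(\xi)\subseteq\mathrm{Var}(\{p_1,p_2,p_3,p_4\})$; (2) for every $P\in\operatorname{im}(\xi)$ there exists an element $V_P$ of $\mathcal M_r(2,\mathbb F)$ such that every element of $\xi^{-1}(P)$ is a quotient of $V_P$.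
   Context: **Axial algebras.** For a commutative, not necessarily associative $\mathbb F$-algebra $V$, $a\in V$ and $\lambda\in\mathbb F$, let $V_\lambda^a=\{v\in V : va=\lambda v\}$. The Monster fusion law $\mathcal M(\alpha,\beta)$ is the symmetric map $\star$ from $\{1,0,\alpha,\beta\}^2$ to the set of subsets of $\{1,0,\alpha,\beta\}$ given by $1\star1=\{1\}$, $1\star0=\emptyset$, $1\star\alpha=\{\alpha\}$, $1\star\beta=\{\beta\}$, $0\star0=\{0\}$, $0\star\alpha=\{\alpha\}$, $0\star\beta=\{\beta\}$, $\alpha\star\alpha=\{1,0\}$, $\alpha\star\beta=\{\beta\}$, $\beta\star\beta=\{1,0,\alpha\}$. A primitive axis of Monster type $(\alpha,\beta)$ in $V$ is a nonzero idempotent $a$ such that $V=V_1^a\oplus V_0^a\oplus V_\alpha^a\oplus V_\beta^a$, $V_\lambda^aV_\mu^a\subseteq\sum_{\nu\in\lambda\star\mu}V_\nu^a$ for all $\lambda,\mu$, and $V_1^a=\mathbb Fa$. A $2$-generated primitive axial algebra of Monster type $(\alpha,\beta)$ over $\mathbb F$ is a commutative non-associative $\mathbb F$-algebra generated by an ordered pair $(a_0,a_1)$ of such axes; isomorphisms and quotient maps are (bijective, respectively surjective) $\mathbb F$-algebra homomorphisms compatible with the marked ordered pairs of generating axes. **The polynomials $p_i$.** They arise by formally writing certain elements that vanish in every such algebra in terms of the eight vectors $a_{-2},\dots,a_2,s_{0,1},s_{0,2},s_{1,2}$; formally they are defined as follows. Let $k=\mathbb F_0(\alpha,\beta)\subseteq\mathbb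 F$, $\mathcal P=k[x,y,z,t]$ and let $\theta$ be the $k$-algebra automorphism of $\mathcal P$ swapping $x$ with $y$ and $z$ with $t$. (The variables $x,y,z,t$ stand for $\lambda_{a_0}(a_1),\lambda_{a_1}(a_0),\lambda_{a_0}(a_2),\lambda_{a_1}(a_{-1})$, where $\lambda_a(v)a$ is the component of $v$ in $V_1^a$.) Let $M$ be the free $\mathcal P$-module with basis $e_{-2},e_{-1},e_0,e_1,e_2,\sigma_1,\sigma_2,\sigma_2'$. Put $K=\beta(\alpha-\beta)^2(\alpha-4\beta)$ and $e_3=e_{-2}+K^{-1}c$, where $$c=A\,e_{-1}+B\,e_0-\theta(B)\,e_1-\theta(A)\,e_2+4\alpha(\alpha-2\beta+1)(x-y)\sigma_1-4\beta(\alpha-\beta)^2(\sigma_2-\sigma_2'),$$ $$A=(\alpha-\beta)\left[4\alpha\beta x-2(\alpha-1)(\alpha-4\beta)y+\beta(-\alpha^2-5\alpha\beta-\alpha+6\beta)\right],$$ $$B=4(-3\alpha^2+4\alpha\beta+\alpha-2\beta)x^2-4\alpha(\alpha-1)xy+(6\alpha^3+6\alpha^2\beta-2\alpha^2-16\alpha\beta^2-2\alpha\beta+8\beta^2)x+4\alpha\beta(\beta-1)y+2\alpha\beta(\alpha-\beta)z+\beta(\alpha-\beta)(-2\alpha^2-8\alpha\beta+\alpha+4\beta^2+2\beta).$$ *Symmetries.* Let $T_0\colon M\to M$ be $\mathcal P$-linear with $T_0(e_i)=e_{-i}$ for $-2\le i\le2$ and fixing $\sigma_1,\sigma_2,\sigma_2'$.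 Let $F\colon M\to M$ be the $\theta$-semilinear map with $F(e_i)=e_{1-i}$ for $-2\le i\le 2$, $F(\sigma_1)=\sigma_1$, $F(\sigma_2)=\sigma_2'$, $F(\sigma_2')=\sigma_2$. Let $T_1=FT_0F$ and $e_4=T_1(e_{-2})$. *Multiplication by $e_0$.* Let $L_0\colon M\to M$ be the $\mathcal P$-linear map with $L_0(e_0)=e_0$, $L_0(e_{\pm i})=\sigma_i+\beta(e_0+e_{\pm i})$ for $i=1,2$; $L_0(\sigma_i)=(\alpha-\beta)\sigma_i+[(1-\alpha)\lambda_i+\beta(\alpha-\beta-1)]e_0+\tfrac12\beta(\alpha-\beta)(e_i+e_{-i})$ for $i=1,2$, where $\lambda_1=x$, $\lambda_2=z$; and $$\begin{aligned}(\alpha-2\beta)L_0(\sigma_2')={}&\beta^2(\alpha-\beta)(e_{-2}+e_2)+\left[-2\alpha\beta x+2\beta(1-\alpha)y+\tfrac{\beta}{2}(4\alpha^2-2\alpha\beta-\alpha+4\beta^2-2\beta)\right](e_1+e_{-1})\\&+\tfrac1{\alpha-\beta}\Big[(6\alpha^2-8\alpha\beta-2\alpha+4\beta)x^2+(2\alpha^2-2\alpha)xy+2(-2\alpha^2-2\alpha\beta+\alpha)(\alpha-\beta)x\\&\quad-4\beta(\alpha-1)(\alpha-\beta)y-\alpha\beta(\alpha-\beta)z+(4\alpha^2\beta-2\alpha\beta+2\beta^3)(\alpha-\beta)\Big]e_0\\&+\left[-4\alpha x-4(\alpha-1)y+4\alpha^2-2\alpha\beta-\alpha+4\beta^2-2\beta\right]\sigma_1+2\beta(\alpha-\beta)\sigma_2.\end{aligned}$$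 *Projection.* Let $\Lambda\colon M\to\mathcal P$ be the $\mathcal P$-linear map with $\Lambda(e_0)=1$, $\Lambda(e_{\pm1})=x$, $\Lambda(e_{\pm2})=z$, $\Lambda(\sigma_1)=x-\beta-\beta x$, $\Lambda(\sigma_2)=z-\beta-\beta z$, $\Lambda(\sigma_2')=\frac{2(\alpha-1)}{\alpha-\beta}x^2-\frac{2(\alpha-1)}{\alpha-\beta}xy+(1-2\beta)x+\beta z-\beta$. *Further elements.* $s_{0,3}=L_0(e_3)-\beta(e_0+e_3)$, $s_{1,3}=F(s_{0,3})$, $s_{2,3}=T_1(s_{0,3})$, $s_{2,4}=T_1\big(L_0(e_4)-\beta(e_0+e_4)\big)$. *Product.* Define a commutative $\mathcal P$-bilinear product on $M$ as follows. First, $e_0m=L_0(m)$ for all $m\in M$. For $-2\le i,j\le2$: $e_ie_i=e_i$; for $i<j$, $e_ie_j=\beta(e_i+e_j)+\varsigma$, where $\varsigma=\sigma_1$ if $j-i=1$; $\varsigma=\sigma_2$ if $j-i=2$ and $i$ is even; $\varsigma=\sigma_2'$ if $j-i=2$ and $i$ is odd; $\varsigma=s_{2,3}$ if $(i,j)=(-1,2)$; $\varsigma=s_{1,3}$ if $(i,j)=(-2,1)$; $\varsigma=s_{2,4}$ if $(i,j)=(-2,2)$. For $m\in\{\sigma_1,\sigma_2,\sigma_2'\}$: $e_1m=FL_0F(m)$, $e_{-1}m=T_0(e_1m)$, $e_2m=T_1L_0(m)$, $e_{-2}m=T_0(e_2m)$. For $i,j\in\{1,2\}$ put $X_i=((1-\alpha)\lambda_i-\beta)e_0+\tfrac12(\alpha-\beta)(e_i+e_{-i})$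 and $Y_j=(\beta-\lambda_j)e_0+\tfrac12\beta(e_j+e_{-j})$, and for $(i,j)\in\{(1,1),(1,2),(2,2)\}$ set $$\sigma_i\sigma_j=-L_0\Big((X_i-\sigma_i)\big(\tfrac12(e_j+e_{-j})-\lambda_je_0\big)\Big)+X_iY_j+X_i\sigma_j-\sigma_iY_j .$$ Set $\sigma_1\sigma_2'=F(\sigma_1\sigma_2)$, $\sigma_2'\sigma_2'=F(\sigma_2\sigma_2)$, and let $\sigma_2\sigma_2'$ be the unique element for which $e_3e_3=e_3$ (in the expansion of $e_3e_3$ it has the invertible coefficient $-32/(\alpha-4\beta)^2$). *Definition.* $p_1=\Lambda(s_{2,3}-F(s_{2,3}))$, $p_2=\Lambda(e_4e_4-e_4)$, $p_3=\theta\big(\Lambda(F(s_{2,3}-F(s_{2,3})))\big)$, $p_4=\theta(p_2)$. *)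

theory Defs
  imports
    "HOL-Analysis.Cartesian_Space"
    "HOL-Library.Equipollence"
    "HOL-Library.Poly_Mapping"
    "HOL-Algebra.Algebraic_Closure_Type"
begin

unbundle no Formal_Power_Series.fps_syntax

section \<open>Axial algebras of Monster type\<close>

text \<open>
  An algebra is a module record over the field \<open>'f\<close>, together with its ordered pair of marked
  generators.  The record field \<^const>\<open>one\<close> inherited from the library is meaningless here: it
  is subject to no axiom, and homomorphisms ignore it.
\<close>

record ('f, 'v) marked_algebra = "('f, 'v) module" +
  gen0 :: 'v
  gen1 :: 'v

locale comm_nonassoc_algebra =
  module "ring_of_type_algebra :: 'f::field ring" V
  for V :: "('f::field, 'v, 'm) module_scheme" (structure) +
  assumes mult_closed:
      "\<lbrakk>u \<in> carrier V; v \<in> carrier V\<rbrakk> \<Longrightarrow> u \<otimes> v \<in> carrier V"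
    and mult_commute:
      "\<lbrakk>u \<in> carrier V; v \<in> carrier V\<rbrakk> \<Longrightarrow> u \<otimes> v = v \<otimes> u"
    and mult_add_left:
      "\<lbrakk>u \<in> carrier V; v \<in> carrier V; w \<in> carrier V\<rbrakk>
        \<Longrightarrow> (u \<oplus> v) \<otimes> w = (u \<otimes> w) \<oplus> (v \<otimes> w)"
    and mult_smult_left:
      "\<lbrakk>u \<in> carrier V; v \<in> carrier V\<rbrakk>
        \<Longrightarrow> (c \<odot> u) \<otimes> v = c \<odot> (u \<otimes> v)"

definition nonassoc_subalgebra :: "'v set \<Rightarrow> ('f::field, 'v, 'm) module_scheme \<Rightarrow> bool" where
  "nonassoc_subalgebra S V \<longleftrightarrow>
     submodule S (ring_of_type_algebra :: 'f ring) V \<and>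
     (\<forall>u\<in>S. \<forall>v\<in>S. u \<otimes>\<^bsub>V\<^esub> v \<in> S)"

definition eigenspace :: "('f::field, 'v, 'm) module_scheme \<Rightarrow> 'v \<Rightarrow> 'f \<Rightarrow> 'v set" where
  "eigenspace V a l = {v \<in> carrier V. v \<otimes>\<^bsub>V\<^esub> a = l \<odot>\<^bsub>V\<^esub> v}"

definition eigenspace_sum :: "('f::field, 'v, 'm) module_scheme \<Rightarrow> 'v \<Rightarrow> 'f set \<Rightarrow> 'v set" where
  "eigenspace_sum V a N =
     {(\<Oplus>\<^bsub>V\<^esub>n\<in>N. f n) | f. f \<in> (\<Pi> n\<in>N. eigenspace V a n)}"

text \<open>The following is meant for pairwise distinct \<open>1, 0, \<alpha>, \<beta>\<close>.\<close>

definition monster_law :: "'f::field \<Rightarrow> 'f \<Rightarrow> 'f \<Rightarrow> 'f \<Rightarrow> 'f set" where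
  "monster_law \<alpha> \<beta> l m =
     (if {l, m} = {1} then {1}
      else if {l, m} = {1, 0} then {}
      else if {l, m} = {1, \<alpha>} then {\<alpha>}
      else if {l, m} = {1, \<beta>} then {\<beta>}
      else if {l, m} = {0} then {0}
      else if {l, m} = {0, \<alpha>} then {\<alpha>}
      else if {l, m} = {0, \<beta>} then {\<beta>}
      else if {l, m} = {\<alpha>} then {1, 0}
      else if {l, m} = {\<alpha>, \<beta>} then {\<beta>}
      else if {l, m} = {\<beta>} then {1, 0, \<alpha>}
      else {})"

definition primitive_axis ::
    "'f::field \<Rightarrow> 'f \<Rightarrow> ('f, 'v, 'm) module_scheme \<Rightarrow> 'v \<Rightarrow> bool" where
  "primitive_axis \<alpha> \<beta> V a \<longleftrightarrow>
     a \<in> carrier V \<and> a \<noteq> \<zero>\<^bsub>V\<^esub> \<and> a \<otimes>\<^bsub>V\<^esub> a = a \<and>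
     (\<forall>v\<in>carrier V.
        \<exists>!f. f \<in> (\<Pi>\<^sub>E l\<in>{1, 0, \<alpha>, \<beta>}. eigenspace V a l) \<and>
             v = (\<Oplus>\<^bsub>V\<^esub>l\<in>{1, 0, \<alpha>, \<beta>}. f l)) \<and>
     (\<forall>l\<in>{1, 0, \<alpha>, \<beta>}. \<forall>m\<in>{1, 0, \<alpha>, \<beta>}.
        \<forall>u\<in>eigenspace V a l. \<forall>v\<in>eigenspace V a m.
          u \<otimes>\<^bsub>V\<^esub> v \<in> eigenspace_sum V a (monster_law \<alpha> \<beta> l m)) \<and>
     eigenspace V a 1 = range (\<lambda>c. c \<odot>\<^bsub>V\<^esub> a)"

definition monster_2gen :: "'f::field \<Rightarrow> 'f \<Rightarrow> ('f, 'v) marked_algebra \<Rightarrow> bool" where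
  "monster_2gen \<alpha> \<beta> V \<longleftrightarrow>
     comm_nonassoc_algebra V \<and>
     primitive_axis \<alpha> \<beta> V (gen0 V) \<and> primitive_axis \<alpha> \<beta> V (gen1 V) \<and>
     (\<forall>S. nonassoc_subalgebra S V \<and> gen0 V \<in> S \<and> gen1 V \<in> S \<longrightarrow> S = carrier V)"

definition marked_hom ::
    "('f::field, 'v) marked_algebra \<Rightarrow> ('f, 'w) marked_algebra \<Rightarrow> ('v \<Rightarrow> 'w) set" where
  "marked_hom V W =
     {f \<in> carrier V \<rightarrow> carrier W.
        (\<forall>u\<in>carrier V. \<forall>v\<in>carrier V. f (u \<oplus>\<^bsub>V\<^esub> v) = f u \<oplus>\<^bsub>W\<^esub> f v) \<and>
        (\<forall>c. \<forall>u\<in>carrier V. f (c \<odot>\<^bsub>V\<^esub> u) = c \<odot>\<^bsub>W\<^esub> f u) \<and>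
        (\<forall>u\<in>carrier V. \<forall>v\<in>carrier V. f (u \<otimes>\<^bsub>V\<^esub> v) = f u \<otimes>\<^bsub>W\<^esub> f v) \<and>
        f (gen0 V) = gen0 W \<and> f (gen1 V) = gen1 W}"

definition marked_iso ::
    "('f::field, 'v) marked_algebra \<Rightarrow> ('f, 'w) marked_algebra \<Rightarrow> bool" where
  "marked_iso V W \<longleftrightarrow> (\<exists>f\<in>marked_hom V W. bij_betw f (carrier V) (carrier W))"

definition is_quotient_of ::
    "('f::field, 'w) marked_algebra \<Rightarrow> ('f, 'v) marked_algebra \<Rightarrow> bool" where
  "is_quotient_of W V \<longleftrightarrow> (\<exists>f\<in>marked_hom V W. f ` carrier V = carrier W)"

text \<open>
  The isomorphism classes are taken among the algebras whose carrier is a set of elements of the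
  type \<open>'v\<close>.  A 2-generated algebra over \<open>'f\<close> has at most \<open>max |'f| \<aleph>\<^sub>0\<close> elements, so when
  \<open>'v\<close> is infinite and at least as large as \<open>'f\<close>, every such algebra, over any type, is isomorphic
  to one with carrier in \<open>'v\<close>, and no isomorphism class is lost.
\<close>

definition iso_class_representatives ::
    "'f::field \<Rightarrow> 'f \<Rightarrow> ('f, 'v) marked_algebra set \<Rightarrow> bool" where
  "iso_class_representatives \<alpha> \<beta> Mr \<longleftrightarrow>
     (\<forall>V\<in>Mr. monster_2gen \<alpha> \<beta> V) \<and>
     (\<forall>W :: ('f, 'v) marked_algebra. monster_2gen \<alpha> \<beta> W \<longrightarrow> (\<exists>!V. V \<in> Mr \<and> marked_iso W V))"


section \<open>Polynomials in four variables\<close>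

text \<open>
  The variables \<open>x, y, z, t\<close> are indexed by \<open>1, 2, 3, 4\<close>.  The coefficients are taken in \<open>'f\<close>;
  those of the polynomials below visibly lie in the subfield generated by \<open>\<alpha>\<close> and \<open>\<beta>\<close>.
\<close>

type_synonym 'f mpoly4 = "(4 \<Rightarrow>\<^sub>0 nat) \<Rightarrow>\<^sub>0 'f"

definition cst :: "'f::field \<Rightarrow> 'f mpoly4" where
  "cst c = Poly_Mapping.single 0 c"

definition pvar :: "4 \<Rightarrow> 'f::field mpoly4" where
  "pvar i = Poly_Mapping.single (Poly_Mapping.single i 1) 1"

definition eval4 :: "'f::field mpoly4 \<Rightarrow> 'f ^ 4 \<Rightarrow> 'f" where
  "eval4 p P = (\<Sum>m\<in>Poly_Mapping.keys p.
     Poly_Mapping.lookup p m * (\<Prod>i\<in>UNIV. (P $ i) ^ Poly_Mapping.lookup m i))"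

definition Var :: "'f::field mpoly4 set \<Rightarrow> ('f ^ 4) set" where
  "Var S = {P. \<forall>p\<in>S. eval4 p P = 0}"

definition swap_var :: "4 \<Rightarrow> 4" where
  "swap_var i = (if i = 1 then 2 else if i = 2 then 1 else if i = 3 then 4 else 3)"

text \<open>
  \<^const>\<open>Poly_Mapping.map_key\<close> is a guarded precomposition: it yields \<open>0\<close> unless the map is
  injective, as the involutions used here are.
\<close>

definition theta :: "'f::field mpoly4 \<Rightarrow> 'f mpoly4" where
  "theta = Poly_Mapping.map_key (Poly_Mapping.map_key swap_var)"

lemma swap_var_swap_var [simp]: "swap_var (swap_var i) = i"
  using exhaust_4[of i] by (auto simp: swap_var_def)

lemma inj_swap_var: "inj swap_var"
  by (metis injI swap_var_swap_var)

lemma map_key_swap_var_involution: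
  "Poly_Mapping.map_key swap_var (Poly_Mapping.map_key swap_var m) = m"
  by (simp add: map_key_compose[OF inj_swap_var inj_swap_var] o_def map_key_id)

lemma inj_map_key_swap_var: "inj (Poly_Mapping.map_key swap_var)"
  by (metis injI map_key_swap_var_involution)

lemma theta_monomial:
  "theta (Poly_Mapping.single m c) = Poly_Mapping.single (Poly_Mapping.map_key swap_var m) c"
  using map_key_single[OF inj_map_key_swap_var, of "Poly_Mapping.map_key swap_var m" c]
  by (simp add: theta_def map_key_swap_var_involution)

lemma theta_cst: "theta (cst c) = cst c"
  by (simp add: cst_def theta_monomial inj_swap_var)

lemma theta_pvar: "theta (pvar i) = pvar (swap_var i)"
  using map_key_single[OF inj_swap_var, of "swap_var i" "1 :: nat"]
  by (simp add: pvar_def theta_monomial)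


section \<open>The polynomials \<open>p\<^sub>1, p\<^sub>2, p\<^sub>3, p\<^sub>4\<close>\<close>

text \<open>\<open>Em2, Em1\<close> stand for \<open>e\<^sub>-\<^sub>2, e\<^sub>-\<^sub>1\<close>, and \<open>S2'\<close> for \<open>\<sigma>\<^sub>2'\<close>.\<close>

datatype bas = Em2 | Em1 | E0 | E1 | E2 | S1 | S2 | S2'

lemma UNIV_bas: "UNIV = {Em2, Em1, E0, E1, E2, S1, S2, S2'}"
  using bas.exhaust by blast

instance bas :: finite
  by standard (simp add: UNIV_bas)

type_synonym 'f fmod = "'f mpoly4 ^ bas"

definition lin_ext :: "(bas \<Rightarrow> 'f::field fmod) \<Rightarrow> 'f fmod \<Rightarrow> 'f fmod" where
  "lin_ext f m = (\<Sum>b\<in>UNIV. (m $ b) *s f b)"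

definition semilin_ext :: "(bas \<Rightarrow> 'f::field fmod) \<Rightarrow> 'f fmod \<Rightarrow> 'f fmod" where
  "semilin_ext f m = (\<Sum>b\<in>UNIV. theta (m $ b) *s f b)"

locale monster_polynomials =
  fixes \<alpha> \<beta> :: "'f::field"
begin

text \<open>\<open>e i\<close> is only meant for \<open>-2 \<le> i \<le> 2\<close>.\<close>

definition e :: "int \<Rightarrow> 'f fmod" where
  "e i = axis (if i = -2 then Em2 else if i = -1 then Em1 else if i = 0 then E0
               else if i = 1 then E1 else E2) 1"

definition sig1 :: "'f fmod" where "sig1 = axis S1 1"
definition sig2 :: "'f fmod" where "sig2 = axis S2 1"
definition sig2' :: "'f fmod" where "sig2' = axis S2' 1"

definition T0 :: "'f fmod \<Rightarrow> 'f fmod" where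
  "T0 = lin_ext (\<lambda>b. case b of
     Em2 \<Rightarrow> e 2 | Em1 \<Rightarrow> e 1 | E0 \<Rightarrow> e 0 | E1 \<Rightarrow> e (-1) | E2 \<Rightarrow> e (-2)
     | S1 \<Rightarrow> sig1 | S2 \<Rightarrow> sig2 | S2' \<Rightarrow> sig2')"

abbreviation a :: "'f mpoly4" where "a \<equiv> cst \<alpha>"
abbreviation b :: "'f mpoly4" where "b \<equiv> cst \<beta>"
abbreviation x :: "'f mpoly4" where "x \<equiv> pvar 1"
abbreviation y :: "'f mpoly4" where "y \<equiv> pvar 2"
abbreviation z :: "'f mpoly4" where "z \<equiv> pvar 3"
abbreviation half :: "'f mpoly4" where "half \<equiv> cst (1 / 2)"

definition K :: 'f where
  "K = \<beta> * (\<alpha> - \<beta>)^2 * (\<alpha> - 4 * \<beta>)"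

definition A :: "'f mpoly4" where
  "A = (a - b) * (4 * a * b * x - 2 * (a - 1) * (a - 4 * b) * y
         + b * (- (a^2) - 5 * a * b - a + 6 * b))"

definition B :: "'f mpoly4" where
  "B = 4 * (-3 * a^2 + 4 * a * b + a - 2 * b) * x^2
       - 4 * a * (a - 1) * x * y
       + (6 * a^3 + 6 * a^2 * b - 2 * a^2 - 16 * a * b^2 - 2 * a * b + 8 * b^2) * x
       + 4 * a * b * (b - 1) * y
       + 2 * a * b * (a - b) * z
       + b * (a - b) * (-2 * a^2 - 8 * a * b + a + 4 * b^2 + 2 * b)"

definition c :: "'f fmod" where
  "c = A *s e (-1) + B *s e 0 - theta B *s e 1 - theta A *s e 2
       + (4 * a * (a - 2 * b + 1) * (x - y)) *s sig1
       - (4 * b * (a - b)^2) *s (sig2 - sig2')"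

definition e3 :: "'f fmod" where
  "e3 = e (-2) + cst (inverse K) *s c"

definition F :: "'f fmod \<Rightarrow> 'f fmod" where
  "F = semilin_ext (\<lambda>b. case b of
     Em2 \<Rightarrow> e3 | Em1 \<Rightarrow> e 2 | E0 \<Rightarrow> e 1 | E1 \<Rightarrow> e 0 | E2 \<Rightarrow> e (-1)
     | S1 \<Rightarrow> sig1 | S2 \<Rightarrow> sig2' | S2' \<Rightarrow> sig2)"

definition T1 :: "'f fmod \<Rightarrow> 'f fmod" where
  "T1 m = F (T0 (F m))"

definition e4 :: "'f fmod" where
  "e4 = T1 (e (-2))"

text \<open>In \<open>sig i\<close> and \<open>lam i\<close> the index \<open>i\<close> is 1 or 2.\<close>

definition sig :: "int \<Rightarrow> 'f fmod" where
  "sig i = (if i = 1 then sig1 else sig2)"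

definition lam :: "int \<Rightarrow> 'f mpoly4" where
  "lam i = (if i = 1 then x else z)"

definition L0_sig :: "int \<Rightarrow> 'f fmod" where
  "L0_sig i = (a - b) *s sig i + ((1 - a) * lam i + b * (a - b - 1)) *s e 0
              + (half * b * (a - b)) *s (e i + e (-i))"

definition L0_sig2' :: "'f fmod" where
  "L0_sig2' = cst (inverse (\<alpha> - 2 * \<beta>)) *s (
     (b^2 * (a - b)) *s (e (-2) + e 2)
     + (-2 * a * b * x + 2 * b * (1 - a) * y
          + half * b * (4 * a^2 - 2 * a * b - a + 4 * b^2 - 2 * b)) *s (e 1 + e (-1))
     + (cst (inverse (\<alpha> - \<beta>)) *
          ((6 * a^2 - 8 * a * b - 2 * a + 4 * b) * x^2
           + (2 * a^2 - 2 * a) * x * y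
           + 2 * (-2 * a^2 - 2 * a * b + a) * (a - b) * x
           - 4 * b * (a - 1) * (a - b) * y
           - a * b * (a - b) * z
           + (4 * a^2 * b - 2 * a * b + 2 * b^3) * (a - b))) *s e 0
     + (-4 * a * x - 4 * (a - 1) * y + 4 * a^2 - 2 * a * b - a + 4 * b^2 - 2 * b) *s sig1
     + (2 * b * (a - b)) *s sig2)"

definition L0 :: "'f fmod \<Rightarrow> 'f fmod" where
  "L0 = lin_ext (\<lambda>i. case i of
     Em2 \<Rightarrow> sig2 + b *s (e 0 + e (-2))
     | Em1 \<Rightarrow> sig1 + b *s (e 0 + e (-1))
     | E0 \<Rightarrow> e 0
     | E1 \<Rightarrow> sig1 + b *s (e 0 + e 1)
     | E2 \<Rightarrow> sig2 + b *s (e 0 + e 2)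
     | S1 \<Rightarrow> L0_sig 1
     | S2 \<Rightarrow> L0_sig 2
     | S2' \<Rightarrow> L0_sig2')"

definition Lambda :: "'f fmod \<Rightarrow> 'f mpoly4" where
  "Lambda m = (\<Sum>i\<in>UNIV. m $ i * (case i of
     Em2 \<Rightarrow> z | Em1 \<Rightarrow> x | E0 \<Rightarrow> 1 | E1 \<Rightarrow> x | E2 \<Rightarrow> z
     | S1 \<Rightarrow> x - b - b * x
     | S2 \<Rightarrow> z - b - b * z
     | S2' \<Rightarrow> cst (2 * (\<alpha> - 1) / (\<alpha> - \<beta>)) * x^2
              - cst (2 * (\<alpha> - 1) / (\<alpha> - \<beta>)) * x * y
              + (1 - 2 * b) * x + b * z - b))"

definition s03 :: "'f fmod" where "s03 = L0 e3 - b *s (e 0 + e3)"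
definition s13 :: "'f fmod" where "s13 = F s03"
definition s23 :: "'f fmod" where "s23 = T1 s03"
definition s24 :: "'f fmod" where "s24 = T1 (L0 e4 - b *s (e 0 + e4))"

text \<open>
  The product is built up in stages.  \<open>ee_prod\<close> and \<open>es_prod\<close> give the products of basis
  vectors at least one of which is some \<open>e i\<close>.  The product \<open>mul S\<close> is the bilinear extension in
  which the products of two \<open>\<sigma>\<close>'s are read off from a table \<open>S\<close>; the definition of \<open>sig_prod\<close>
  never multiplies two \<open>\<sigma>\<close>'s, so the zero table used there is immaterial.
\<close>

definition ee_prod :: "int \<Rightarrow> int \<Rightarrow> 'f fmod" where
  "ee_prod k l =
     (if k = l then e k
      else let i = min k l; j = max k l in
        b *s (e i + e j) +
        (if j - i = 1 then sig1
         else if j - i = 2 then (if even i then sig2 else sig2')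
         else if (i, j) = (-1, 2) then s23
         else if (i, j) = (-2, 1) then s13
         else s24))"

definition es_prod :: "int \<Rightarrow> 'f fmod \<Rightarrow> 'f fmod" where
  "es_prod i m =
     (if i = 0 then L0 m
      else if i = 1 then F (L0 (F m))
      else if i = -1 then T0 (F (L0 (F m)))
      else if i = 2 then T1 (L0 m)
      else T0 (T1 (L0 m)))"

definition e_index :: "bas \<Rightarrow> int option" where
  "e_index i = (case i of
     Em2 \<Rightarrow> Some (-2) | Em1 \<Rightarrow> Some (-1) | E0 \<Rightarrow> Some 0 | E1 \<Rightarrow> Some 1 | E2 \<Rightarrow> Some 2
     | S1 \<Rightarrow> None | S2 \<Rightarrow> None | S2' \<Rightarrow> None)"

definition bas_prod :: "(bas \<Rightarrow> bas \<Rightarrow> 'f fmod) \<Rightarrow> bas \<Rightarrow> bas \<Rightarrow> 'f fmod" where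
  "bas_prod S i j = (case (e_index i, e_index j) of
     (Some k, Some l) \<Rightarrow> ee_prod k l
     | (Some k, None) \<Rightarrow> es_prod k (axis j 1)
     | (None, Some l) \<Rightarrow> es_prod l (axis i 1)
     | (None, None) \<Rightarrow> S i j)"

definition mul :: "(bas \<Rightarrow> bas \<Rightarrow> 'f fmod) \<Rightarrow> 'f fmod \<Rightarrow> 'f fmod \<Rightarrow> 'f fmod" where
  "mul S m n = (\<Sum>i\<in>UNIV. \<Sum>j\<in>UNIV. (m $ i * n $ j) *s bas_prod S i j)"

definition Xv :: "int \<Rightarrow> 'f fmod" where
  "Xv i = ((1 - a) * lam i - b) *s e 0 + (half * (a - b)) *s (e i + e (-i))"

definition Yv :: "int \<Rightarrow> 'f fmod" where
  "Yv j = (b - lam j) *s e 0 + (half * b) *s (e j + e (-j))"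

definition sig_prod :: "int \<Rightarrow> int \<Rightarrow> 'f fmod" where
  "sig_prod i j =
     (let M = mul (\<lambda>_ _. 0) in
      - L0 (M (Xv i - sig i) (half *s (e j + e (-j)) - lam j *s e 0))
      + M (Xv i) (Yv j) + M (Xv i) (sig j) - M (sig i) (Yv j))"

text \<open>The parameter \<open>w\<close> is the value of \<open>\<sigma>\<^sub>2 \<sigma>\<^sub>2'\<close>.\<close>

definition sig_table :: "'f fmod \<Rightarrow> bas \<Rightarrow> bas \<Rightarrow> 'f fmod" where
  "sig_table w i j =
     (if {i, j} = {S1} then sig_prod 1 1
      else if {i, j} = {S1, S2} then sig_prod 1 2
      else if {i, j} = {S2} then sig_prod 2 2
      else if {i, j} = {S1, S2'} then F (sig_prod 1 2)
      else if {i, j} = {S2'} then F (sig_prod 2 2)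
      else w)"

definition sig2_sig2' :: "'f fmod" where
  "sig2_sig2' = (THE w. mul (sig_table w) e3 e3 = e3)"

definition prod_M :: "'f fmod \<Rightarrow> 'f fmod \<Rightarrow> 'f fmod" where
  "prod_M = mul (sig_table sig2_sig2')"

definition p1 :: "'f mpoly4" where
  "p1 = Lambda (s23 - F s23)"

definition p2 :: "'f mpoly4" where
  "p2 = Lambda (prod_M e4 e4 - e4)"

definition p3 :: "'f mpoly4" where
  "p3 = theta (Lambda (F (s23 - F s23)))"

definition p4 :: "'f mpoly4" where
  "p4 = theta p2"

end

end

theory Submission
  imports Defs "HOL-Library.Function_Algebras"
begin

text \<open>
  Let \<open>V\<close> be generated by the axes \<open>a\<^sub>0, a\<^sub>1\<close>.  The fusion law is graded by the group of order 2
  with the \<open>\<beta>\<close>-eigenspace as odd part, so each axis \<open>a\<close> gives an involutive automorphism \<open>\<tau>\<^sub>a\<close>, and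
  reflecting the generators yields further axes \<open>a\<^sub>i\<close>.  Put \<open>\<sigma>\<^sub>a(v) = a v - \<beta> (a + v)\<close>; this vector
  is fixed by \<open>\<tau>\<^sub>a\<close>, and the \<open>0\<close>- and \<open>\<alpha>\<close>-components \<open>v\<^sub>0, v\<^sub>\<alpha>\<close> of \<open>v\<close> are linear combinations of
  \<open>a\<close>, \<open>v + \<tau>\<^sub>a(v)\<close> and \<open>\<sigma>\<^sub>a(v)\<close>.  The map \<open>\<xi>\<close> sends \<open>V\<close> to the four projections
  \<open>\<lambda>\<^sub>0(a\<^sub>1), \<lambda>\<^sub>1(a\<^sub>0), \<lambda>\<^sub>0(a\<^sub>2), \<lambda>\<^sub>1(a\<^sub>-\<^sub>1)\<close>.

  The formulas that define the formal module are identities in \<open>V\<close> at the point \<open>\<xi>(V)\<close>.  They all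
  come from expanding products of the components of \<open>a\<^sub>1\<close> with respect to \<open>a\<^sub>0\<close>:
  the product \<open>v\<^sub>0 (v\<^sub>0 + v\<^sub>\<alpha>)\<close> has no component along \<open>a\<^sub>0\<close>, which gives the projection of
  \<open>\<sigma>\<^sub>2'\<close> (\<open>lam0_s2'\<close>); multiplication by \<open>a\<^sub>0\<close> sends \<open>v\<^sub>0 v\<^sub>0 - v\<^sub>\<alpha> v\<^sub>\<alpha>\<close> to a multiple of
  \<open>a\<^sub>0\<close>, which gives \<open>a\<^sub>0 \<sigma>\<^sub>2'\<close> (\<open>mul_a0_s2'\<close>); and \<open>a\<^sub>0 (v\<^sub>0 v\<^sub>\<alpha>) = \<alpha> v\<^sub>0 v\<^sub>\<alpha>\<close> gives
  \<open>\<sigma>\<^sub>1 \<sigma>\<^sub>1\<close> (\<open>mul_s1_s1\<close>).  That last expression, unlike \<open>\<sigma>\<^sub>1 \<sigma>\<^sub>1\<close> itself, is not visibly symmetric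
  in the two axes; equating it with its mirror image expresses \<open>a\<^sub>3\<close> through the eight basic vectors
  (\<open>a3_eq\<close>).

  Hence the linear map \<open>ev\<close> that specialises the coefficients at \<open>\<xi>(V)\<close> and replaces each basis
  symbol by the vector it stands for turns the formal operations into the actual ones: \<open>T\<^sub>0\<close> into
  \<open>\<tau>\<^sub>0\<close>, \<open>L\<^sub>0\<close> into multiplication by \<open>a\<^sub>0\<close>, \<open>\<Lambda>\<close> into \<open>\<lambda>\<^sub>0\<close>, the formal product into the product of
  \<open>V\<close>, and \<open>F\<close> into the exchange of the two axes.  The elements whose projections
  are \<open>p\<^sub>1, \<dots>, p\<^sub>4\<close> go to zero, because \<open>a\<^sub>-\<^sub>1 a\<^sub>2\<close> is symmetric in the two axes and \<open>a\<^sub>4\<close> is an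
  idempotent; this is the first claim (\<open>point_in_Var\<close>).

  The image of \<open>ev\<close> is a subalgebra containing both generators, hence all of \<open>V\<close>.  So every algebra
  over a point \<open>P\<close> is a quotient of the formal module, with a product that depends only on \<open>P\<close>.  For
  the second claim, take the product of all algebras over \<open>P\<close> and, inside it, the image \<open>U\<close> of the
  formal module under the simultaneous evaluation \<open>\<Phi>\<close>.  Eigenvector decompositions and the fusion law
  are componentwise and given by polynomials in multiplication by the axis, so they
  pass to \<open>U\<close>.  Primitivity passes because \<open>\<lambda>\<^sub>0(ev m)\<close> is a function of \<open>m\<close> and \<open>P\<close> alone, the same in
  all components.  Thus \<open>U\<close> is itself an algebra of the required kind, and its coordinate projections
  show that every algebra over \<open>P\<close> is a quotient of it.  As \<open>U\<close> is spanned by eight vectors, it is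
  small enough to have a copy among the representatives.

  To compute without carrier sets, an algebra \<open>V\<close> is embedded into a vector space that fills a whole
  type, as a direct summand whose complement multiplies to zero (\<open>algebra_model\<close>); this does not
  disturb the axes.
\<close>

section \<open>Spectral projections in a commutative algebra\<close>

locale comm_bilinear_algebra = vector_space scale
  for scale :: "'f::field \<Rightarrow> 'w::ab_group_add \<Rightarrow> 'w" (infixr "\<cdot>" 75) +
  fixes mul :: "'w \<Rightarrow> 'w \<Rightarrow> 'w" (infixl "\<star>" 70)
  assumes mul_commute: "u \<star> v = v \<star> u"
    and mul_add_left: "(u + v) \<star> w = u \<star> w + v \<star> w"
    and mul_scale_left: "(c \<cdot> u) \<star> v = c \<cdot> (u \<star> v)"
begin

definition functional :: "('w \<Rightarrow> 'f) \<Rightarrow> bool" where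
  "functional \<phi> \<longleftrightarrow> (\<forall>u v. \<phi> (u + v) = \<phi> u + \<phi> v) \<and> (\<forall>c v. \<phi> (c \<cdot> v) = c * \<phi> v)"

lemma functional_add: "functional \<phi> \<Longrightarrow> \<phi> (u + v) = \<phi> u + \<phi> v"
  and functional_scale: "functional \<phi> \<Longrightarrow> \<phi> (c \<cdot> v) = c * \<phi> v"
  by (auto simp: functional_def)

lemma functional_zero: "functional \<phi> \<Longrightarrow> \<phi> 0 = 0"
  using functional_scale[of \<phi> 0 0] by simp

lemma functional_minus: "functional \<phi> \<Longrightarrow> \<phi> (- v) = - \<phi> v"
  using functional_scale[of \<phi> "-1" v] by simp

lemma functional_diff: "functional \<phi> \<Longrightarrow> \<phi> (u - v) = \<phi> u - \<phi> v"
  using functional_add[of \<phi> u "- v"] by (simp add: functional_minus)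

lemmas functional_simps =
  functional_add functional_scale functional_zero functional_minus functional_diff

text \<open>
  Linear functionals separate points.  An identity between linear combinations of vectors thus
  reduces to an identity of polynomials over the field.
\<close>

lemma vec_eqI:
  assumes "\<And>\<phi>. functional \<phi> \<Longrightarrow> \<phi> u = \<phi> v"
  shows "u = v"
proof (rule ccontr)
  assume "u \<noteq> v"
  then have ind: "independent {u - v}" by simp
  interpret vp: vector_space_pair scale "(*)"
    by unfold_locales (auto simp: algebra_simps)
  obtain g where g: "Vector_Spaces.linear scale (*) g" "g (u - v) = 1"
    using vp.linear_independent_extend[OF ind, of "\<lambda>_. 1"] by auto
  then have "functional g"
    by (auto simp: functional_def vp.linear_add vp.linear_scale)
  then have "g (u - v) = 0" using assms[of g] by (simp add: functional_diff)
  with g show False by simp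
qed

lemma mul_add_right: "u \<star> (v + w) = u \<star> v + u \<star> w"
  by (metis mul_add_left mul_commute)

lemma mul_scale_right: "u \<star> (c \<cdot> v) = c \<cdot> (u \<star> v)"
  by (metis mul_scale_left mul_commute)

lemma mul_zero_left [simp]: "0 \<star> v = 0"
  using mul_scale_left[of 0 0 v] by simp

lemma mul_zero_right [simp]: "v \<star> 0 = 0"
  using mul_zero_left mul_commute by metis

lemma mul_minus_left: "(- u) \<star> v = - (u \<star> v)"
  using mul_scale_left[of "-1" u v] by simp

lemma mul_minus_right: "u \<star> (- v) = - (u \<star> v)"
  by (metis mul_minus_left mul_commute)

lemma mul_diff_left: "(u - v) \<star> w = u \<star> w - v \<star> w"
  using mul_add_left[of u "- v" w] by (simp add: mul_minus_left)

lemma mul_diff_right: "u \<star> (v - w) = u \<star> v - u \<star> w"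
  by (metis mul_diff_left mul_commute)

lemmas mul_simps = mul_add_left mul_add_right mul_diff_left mul_diff_right
  mul_minus_left mul_minus_right mul_scale_left mul_scale_right

definition shift :: "'w \<Rightarrow> 'f \<Rightarrow> 'w \<Rightarrow> 'w" where
  "shift a l v = a \<star> v - l \<cdot> v"

lemma shift_add: "shift a l (u + v) = shift a l u + shift a l v"
  and shift_diff: "shift a l (u - v) = shift a l u - shift a l v"
  and shift_scale: "shift a l (c \<cdot> v) = c \<cdot> shift a l v"
  and shift_zero: "shift a l 0 = 0"
  and shift_minus: "shift a l (- v) = - shift a l v"
  by (simp_all add: shift_def mul_simps scale_right_distrib scale_right_diff_distrib
      scale_left_commute)

lemma shift_commute: "shift a l (shift a m v) = shift a m (shift a l v)"
  by (simp add: shift_def mul_simps scale_right_diff_distrib scale_left_commute algebra_simps)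

lemma shift_eigenvector: "a \<star> v = l \<cdot> v \<Longrightarrow> shift a m v = (l - m) \<cdot> v"
  by (simp add: shift_def scale_left_diff_distrib)

text \<open>
  If \<open>l, m, n, k\<close> are the eigenvalues of multiplication by \<open>a\<close>, this is the Lagrange interpolation
  formula for the projection onto the \<open>l\<close>-eigenspace.
\<close>

definition lagrange :: "'w \<Rightarrow> 'f \<Rightarrow> 'f \<Rightarrow> 'f \<Rightarrow> 'f \<Rightarrow> 'w \<Rightarrow> 'w" where
  "lagrange a l m n k v =
     inverse ((l - m) * (l - n) * (l - k)) \<cdot> shift a m (shift a n (shift a k v))"

end

locale monster_setting = comm_bilinear_algebra scale mul
  for scale :: "'f::field \<Rightarrow> 'w::ab_group_add \<Rightarrow> 'w" (infixr "\<cdot>" 75)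
    and mul :: "'w \<Rightarrow> 'w \<Rightarrow> 'w" (infixl "\<star>" 70) +
  fixes \<alpha> \<beta> :: 'f
  assumes two_nonzero: "(2 :: 'f) \<noteq> 0"
    and distinct_eigenvalues: "distinct [0, 1, \<alpha>, \<beta>]"
begin

lemma eigenvalue_neq [simp]:
  "\<alpha> \<noteq> 0" "\<beta> \<noteq> 0" "\<alpha> \<noteq> 1" "\<beta> \<noteq> 1" "\<alpha> \<noteq> \<beta>" "\<beta> \<noteq> \<alpha>" "1 \<noteq> \<alpha>" "1 \<noteq> \<beta>" "0 \<noteq> \<alpha>" "0 \<noteq> \<beta>"
  using distinct_eigenvalues by auto

abbreviation evals :: "'f set" where "evals \<equiv> {1, 0, \<alpha>, \<beta>}"

text \<open>
  Being a polynomial in multiplication by \<open>a\<close>, the projection preserves every subalgebra that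
  contains \<open>a\<close>, and it is computed componentwise in a product of algebras.
\<close>

definition proj :: "'w \<Rightarrow> 'f \<Rightarrow> 'w \<Rightarrow> 'w" where
  "proj a l = (if l = 1 then lagrange a 1 0 \<alpha> \<beta>
               else if l = 0 then lagrange a 0 1 \<alpha> \<beta>
               else if l = \<alpha> then lagrange a \<alpha> 1 0 \<beta>
               else lagrange a \<beta> 1 0 \<alpha>)"

lemma proj_add: "proj a l (u + v) = proj a l u + proj a l v"
  and proj_diff: "proj a l (u - v) = proj a l u - proj a l v"
  and proj_scale: "proj a l (c \<cdot> v) = c \<cdot> proj a l v"
  and proj_zero [simp]: "proj a l 0 = 0"
  by (simp_all add: proj_def lagrange_def shift_add shift_diff shift_scale shift_zero
      scale_right_distrib scale_right_diff_distrib mult.commute)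

lemma proj_eigenvector:
  assumes "a \<star> v = l \<cdot> v" "l \<in> evals" "m \<in> evals"
  shows "proj a m v = (if m = l then v else 0)"
proof -
  have same: "lagrange a l m n k v = v" if "l \<noteq> m" "l \<noteq> n" "l \<noteq> k" for m n k
  proof -
    have "inverse ((l - m) * (l - n) * (l - k)) * ((l - k) * (l - n) * (l - m)) = 1"
      using that by (simp add: divide_simps)
    then show ?thesis
      by (simp only: lagrange_def shift_eigenvector[OF assms(1)] shift_scale scale_scale scale_one)
  qed
  have other: "lagrange a i m n k v = 0" if "l \<in> {m, n, k}" for i m n k
    using that by (auto simp: lagrange_def shift_eigenvector[OF assms(1)] shift_scale shift_zero)
  show ?thesis
    using assms(2,3) same other by (auto simp: proj_def)
qed

lemma functional_lagrange:
  assumes "functional \<phi>"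
  shows "\<phi> (lagrange a l m n k v) = inverse ((l - m) * (l - n) * (l - k)) *
    (\<phi> (a \<star> (a \<star> (a \<star> v))) - (m + n + k) * \<phi> (a \<star> (a \<star> v))
      + (m * n + m * k + n * k) * \<phi> (a \<star> v) - m * n * k * \<phi> v)"
proof -
  have "\<phi> (shift a m (shift a n (shift a k v))) =
    \<phi> (a \<star> (a \<star> (a \<star> v))) - (m + n + k) * \<phi> (a \<star> (a \<star> v))
      + (m * n + m * k + n * k) * \<phi> (a \<star> v) - m * n * k * \<phi> v"
    by (simp add: shift_def mul_simps functional_simps[OF assms] algebra_simps)
  then show ?thesis by (simp only: lagrange_def functional_scale[OF assms])
qed

text \<open>
  Lagrange interpolation reproduces the constant polynomial 1.  Comparing coefficients, this says that
  the weights \<open>c\<^sub>l\<close> of the four nodes satisfy \<open>\<Sum> c\<^sub>l l\<^sup>i = 0\<close> for \<open>i < 3\<close> and \<open>\<Sum> c\<^sub>l l\<^sup>3 = 1\<close>.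
\<close>

lemma sum_proj: "proj a 1 v + proj a 0 v + proj a \<alpha> v + proj a \<beta> v = v"
proof (rule vec_eqI)
  fix \<phi> assume \<phi>: "functional \<phi>"
  define A B C where "A = 1 - \<alpha>" and "B = 1 - \<beta>" and "C = \<alpha> - \<beta>"
  have ABC: "A \<noteq> 0" "B \<noteq> 0" "C \<noteq> 0" by (auto simp: A_def B_def C_def)
  define c1 c0 ca cb where "c1 = inverse ((1 - 0) * (1 - \<alpha>) * (1 - \<beta>))"
    and "c0 = inverse ((0 - 1) * (0 - \<alpha>) * (0 - \<beta>))"
    and "ca = inverse ((\<alpha> - 1) * (\<alpha> - 0) * (\<alpha> - \<beta>))"
    and "cb = inverse ((\<beta> - 1) * (\<beta> - 0) * (\<beta> - \<alpha>))"
  have c: "c1 = inverse (A * B)" "c0 = - inverse (\<alpha> * \<beta>)"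
    "ca = - inverse (A * \<alpha> * C)" "cb = inverse (B * \<beta> * C)"
    unfolding inverse_minus_eq[symmetric] c1_def c0_def ca_def cb_def A_def B_def C_def
    by (rule arg_cong[of _ _ inverse], simp add: algebra_simps)+
  \<comment> \<open>a common denominator of the four weights\<close>
  define N where "N = A * B * \<alpha> * \<beta> * C"
  have N: "N \<noteq> 0" using ABC by (simp add: N_def)
  have Nc: "N * c1 = \<alpha> * \<beta> * C" "N * c0 = - (A * B * C)" "N * ca = - (B * \<beta>)" "N * cb = A * \<alpha>"
    using ABC unfolding N_def c by (simp_all add: field_simps)
  have "N * (c1 + c0 + ca + cb) = N * 0" "N * (c1 + ca * \<alpha> + cb * \<beta>) = N * 0"
    "N * (c1 + ca * \<alpha>^2 + cb * \<beta>^2) = N * 0" "N * (c1 + ca * \<alpha>^3 + cb * \<beta>^3) = N * 1"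
    unfolding distrib_left mult.assoc[symmetric] Nc unfolding N_def A_def B_def C_def
    by (simp_all add: algebra_simps power2_eq_square power3_eq_cube)
  then have k: "c1 + c0 + ca + cb = 0" "c1 + ca * \<alpha> + cb * \<beta> = 0"
    "c1 + ca * \<alpha>^2 + cb * \<beta>^2 = 0" "c1 + ca * \<alpha>^3 + cb * \<beta>^3 = 1"
    using N by (simp_all only: mult_cancel_left) auto
  have "proj a 1 = lagrange a 1 0 \<alpha> \<beta>" "proj a 0 = lagrange a 0 1 \<alpha> \<beta>"
    "proj a \<alpha> = lagrange a \<alpha> 1 0 \<beta>" "proj a \<beta> = lagrange a \<beta> 1 0 \<alpha>"
    by (simp_all add: proj_def)
  then have "\<phi> (proj a 1 v + proj a 0 v + proj a \<alpha> v + proj a \<beta> v)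
    = (c1 + c0 + ca + cb) * (\<phi> (a \<star> (a \<star> (a \<star> v))) - (1 + \<alpha> + \<beta>) * \<phi> (a \<star> (a \<star> v))
          + (\<alpha> + \<beta> + \<alpha> * \<beta>) * \<phi> (a \<star> v) - \<alpha> * \<beta> * \<phi> v)
      + (c1 + ca * \<alpha> + cb * \<beta>) * (\<phi> (a \<star> (a \<star> v)) - (1 + \<alpha> + \<beta>) * \<phi> (a \<star> v)
          + (\<alpha> + \<beta> + \<alpha> * \<beta>) * \<phi> v)
      + (c1 + ca * \<alpha>^2 + cb * \<beta>^2) * (\<phi> (a \<star> v) - (1 + \<alpha> + \<beta>) * \<phi> v)
      + (c1 + ca * \<alpha>^3 + cb * \<beta>^3) * \<phi> v"
    by (simp only: functional_add[OF \<phi>] functional_lagrange[OF \<phi>] c1_def[symmetric]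
        c0_def[symmetric] ca_def[symmetric] cb_def[symmetric])
       (simp add: algebra_simps power2_eq_square power3_eq_cube)
  then show "\<phi> (proj a 1 v + proj a 0 v + proj a \<alpha> v + proj a \<beta> v) = \<phi> v"
    by (simp only: k) simp
qed

text \<open>
  A primitive axis of Monster type, as far as vectors of \<open>U\<close> are concerned.  The eigenspace
  decomposition is stated through the annihilating polynomial and the fusion law through vanishing
  projections: both are equations, and therefore pass to products and to subalgebras.
\<close>

definition monster_axis_on :: "'w set \<Rightarrow> 'w \<Rightarrow> bool" where
  "monster_axis_on U a \<longleftrightarrow> a \<noteq> 0 \<and> a \<star> a = a \<and>
     (\<forall>v\<in>U. shift a 1 (shift a 0 (shift a \<alpha> (shift a \<beta> v))) = 0) \<and>
     (\<forall>l\<in>evals. \<forall>m\<in>evals. \<forall>u\<in>U. \<forall>v\<in>U. a \<star> u = l \<cdot> u \<longrightarrow> a \<star> v = m \<cdot> v \<longrightarrow>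
        (\<forall>n\<in>evals - monster_law \<alpha> \<beta> l m. proj a n (u \<star> v) = 0)) \<and>
     (\<forall>v\<in>U. a \<star> v = v \<longrightarrow> (\<exists>c. v = c \<cdot> a))"

abbreviation monster_axis :: "'w \<Rightarrow> bool" where
  "monster_axis \<equiv> monster_axis_on UNIV"

lemma mul_proj_on:
  assumes "monster_axis_on U a" "v \<in> U" "l \<in> evals"
  shows "a \<star> proj a l v = l \<cdot> proj a l v"
proof -
  have ann: "shift a 1 (shift a 0 (shift a \<alpha> (shift a \<beta> v))) = 0"
    using assms(1,2) unfolding monster_axis_on_def by blast
  consider "l = 1" | "l = 0" | "l = \<alpha>" | "l = \<beta>" using assms(3) by auto
  then have "shift a l (proj a l v) = 0"
  proof cases
    case 1 then show ?thesis by (simp add: proj_def lagrange_def shift_scale ann)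
  next
    case 2 then show ?thesis
      by (simp add: proj_def lagrange_def shift_scale shift_minus ann shift_commute[of a 0 1])
  next
    case 3 then show ?thesis
      by (simp add: proj_def lagrange_def shift_scale shift_commute[of a \<alpha> 1]
          shift_commute[of a \<alpha> 0] ann)
  next
    case 4
    have "shift a \<beta> (shift a 1 (shift a 0 (shift a \<alpha> v))) = 0"
      by (simp only: shift_commute[of a \<beta> 1] shift_commute[of a \<beta> 0] shift_commute[of a \<beta> \<alpha>] ann)
    with 4 show ?thesis by (simp add: proj_def lagrange_def shift_scale)
  qed
  then show ?thesis by (simp add: shift_def)
qed

lemma mul_proj: "monster_axis a \<Longrightarrow> l \<in> evals \<Longrightarrow> a \<star> proj a l v = l \<cdot> proj a l v"
  by (rule mul_proj_on[OF _ UNIV_I])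

section \<open>One axis: the fusion law and the Miyamoto involution\<close>

definition half :: 'f where "half = 1 / 2"

lemma two_half: "2 * half = 1"
  using two_nonzero by (simp add: half_def)

text \<open>
  The linear form written \<open>\<lambda>\<^sub>a\<close> in the definition of the polynomials.
\<close>

definition lam :: "'w \<Rightarrow> 'w \<Rightarrow> 'f" where
  "lam a v = (THE c. proj a 1 v = c \<cdot> a)"

text \<open>
  The Miyamoto involution: it negates the \<open>\<beta>\<close>-component.
\<close>

definition tau :: "'w \<Rightarrow> 'w \<Rightarrow> 'w" where
  "tau a v = v - 2 \<cdot> proj a \<beta> v"

text \<open>
  Subtracting \<open>\<beta> (a + v)\<close> from \<open>a v\<close> removes the \<open>\<beta>\<close>-component of \<open>a v\<close>, so that the remainder is
  fixed by the Miyamoto involution of \<open>a\<close>.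
\<close>

definition sigma :: "'w \<Rightarrow> 'w \<Rightarrow> 'w" where
  "sigma a v = a \<star> v - \<beta> \<cdot> (a + v)"

text \<open>
  These are \<open>\<alpha>\<close> times the \<open>0\<close>-component and \<open>\<alpha>\<close> times the \<open>\<alpha>\<close>-component of \<open>v\<close>
  (\<open>zero_part_eq\<close>, \<open>alpha_part_eq\<close>), expressed through \<open>a\<close>, \<open>v + \<tau>\<^sub>a(v)\<close> and \<open>\<sigma>\<^sub>a(v)\<close>.
\<close>

definition zero_part :: "'w \<Rightarrow> 'w \<Rightarrow> 'w" where
  "zero_part a v = ((1 - \<alpha>) * lam a v - \<beta>) \<cdot> a + (half * (\<alpha> - \<beta>)) \<cdot> (v + tau a v) - sigma a v"

definition alpha_part :: "'w \<Rightarrow> 'w \<Rightarrow> 'w" where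
  "alpha_part a v = (\<beta> - lam a v) \<cdot> a + (half * \<beta>) \<cdot> (v + tau a v) + sigma a v"

lemma sigma_commute: "sigma a v = sigma v a"
  by (simp add: sigma_def mul_commute add.commute)

lemma mul_eq_sigma: "a \<star> v = sigma a v + \<beta> \<cdot> (a + v)"
  by (simp add: sigma_def)

context
  fixes a assumes ax: "monster_axis a"
begin

lemma axis_idem: "a \<star> a = a" and axis_nonzero: "a \<noteq> 0"
  using ax by (auto simp: monster_axis_on_def)

lemma proj_proj:
  "l \<in> evals \<Longrightarrow> m \<in> evals \<Longrightarrow> proj a m (proj a l v) = (if m = l then proj a l v else 0)"
  using proj_eigenvector mul_proj[OF ax] by blast

lemma proj_self: "m \<in> evals \<Longrightarrow> proj a m a = (if m = 1 then a else 0)"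
  using proj_eigenvector[of a a 1 m] axis_idem by auto

lemma proj_1: "proj a 1 v = lam a v \<cdot> a"
proof -
  have "a \<star> proj a 1 v = proj a 1 v" using mul_proj[OF ax, of 1 v] by (metis insert_iff scale_one)
  then obtain c where "proj a 1 v = c \<cdot> a" using ax unfolding monster_axis_on_def by blast
  moreover have "d = c" if "c \<cdot> a = d \<cdot> a" for c d using that axis_nonzero by simp
  ultimately show ?thesis unfolding lam_def by (metis (mono_tags, lifting) theI)
qed

lemma lam_eqI: "proj a 1 v = c \<cdot> a \<Longrightarrow> lam a v = c"
  using proj_1[of v] axis_nonzero by (metis scale_cancel_right)

lemma functional_lam: "functional (lam a)"
  unfolding functional_def
proof (intro conjI allI)
  show "lam a (u + v) = lam a u + lam a v" for u v
    by (rule lam_eqI) (simp add: proj_add proj_1 scale_left_distrib)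
  show "lam a (c \<cdot> v) = c * lam a v" for c v
    by (rule lam_eqI) (simp add: proj_scale proj_1)
qed

lemma lam_self: "lam a a = 1"
  by (rule lam_eqI) (simp add: proj_self)

lemma decomposition: "v = lam a v \<cdot> a + proj a 0 v + proj a \<alpha> v + proj a \<beta> v"
  using sum_proj[of a v] by (simp add: proj_1)

lemma mul_decomposition: "a \<star> v = lam a v \<cdot> a + \<alpha> \<cdot> proj a \<alpha> v + \<beta> \<cdot> proj a \<beta> v"
  by (subst decomposition[of v])
     (simp add: mul_simps axis_idem mul_proj[OF ax])

lemma proj_mul: "m \<in> evals \<Longrightarrow> proj a m (a \<star> v) = m \<cdot> proj a m v"
  by (subst mul_decomposition) (auto simp: proj_add proj_scale proj_proj proj_self proj_1)

lemma lam_mul: "lam a (a \<star> v) = lam a v"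
  using proj_mul[of 1 v] proj_1[of v] by (intro lam_eqI) simp

lemma lam_eigenvector: "a \<star> v = l \<cdot> v \<Longrightarrow> l \<in> evals \<Longrightarrow> l \<noteq> 1 \<Longrightarrow> lam a v = 0"
  using proj_eigenvector[of a v l 1] by (intro lam_eqI) auto

lemma fusion:
  "a \<star> u = l \<cdot> u \<Longrightarrow> a \<star> v = m \<cdot> v \<Longrightarrow> l \<in> evals \<Longrightarrow> m \<in> evals \<Longrightarrow> n \<in> evals
    \<Longrightarrow> n \<notin> monster_law \<alpha> \<beta> l m \<Longrightarrow> proj a n (u \<star> v) = 0"
  using ax unfolding monster_axis_on_def by blast

lemma mul_zero_zero:
  assumes "a \<star> u = 0" "a \<star> v = 0"
  shows "a \<star> (u \<star> v) = 0"
proof -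
  have "proj a n (u \<star> v) = 0" if "n \<in> {1, \<alpha>, \<beta>}" for n
    using assms that by (intro fusion[of u 0 v 0]) (auto simp: monster_law_def doubleton_eq_iff)
  then show ?thesis using mul_decomposition[of "u \<star> v"] by (simp add: proj_1[symmetric])
qed

lemma mul_zero_alpha:
  assumes "a \<star> u = 0" "a \<star> v = \<alpha> \<cdot> v"
  shows "a \<star> (u \<star> v) = \<alpha> \<cdot> (u \<star> v)"
proof -
  have "proj a n (u \<star> v) = 0" if "n \<in> {1, 0, \<beta>}" for n
    using assms that by (intro fusion[of u 0 v \<alpha>]) (auto simp: monster_law_def doubleton_eq_iff)
  then have "u \<star> v = proj a \<alpha> (u \<star> v)"
    using decomposition[of "u \<star> v"] by (simp add: proj_1[symmetric])
  then show ?thesis by (metis insert_iff mul_proj[OF ax])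
qed

lemma mul_alpha_alpha:
  assumes "a \<star> u = \<alpha> \<cdot> u" "a \<star> v = \<alpha> \<cdot> v"
  shows "a \<star> (u \<star> v) = lam a (u \<star> v) \<cdot> a"
proof -
  have "proj a n (u \<star> v) = 0" if "n \<in> {\<alpha>, \<beta>}" for n
    using assms that by (intro fusion[of u \<alpha> v \<alpha>]) (auto simp: monster_law_def doubleton_eq_iff)
  then show ?thesis using mul_decomposition[of "u \<star> v"] by simp
qed

lemma even_part: "proj a \<beta> v = 0 \<Longrightarrow> v = proj a 1 v + proj a 0 v + proj a \<alpha> v"
  using sum_proj[of a v] by simp

lemma even_mul_even:
  assumes "proj a \<beta> u = 0" "proj a \<beta> v = 0"
  shows "proj a \<beta> (u \<star> v) = 0"
proof -
  have "proj a \<beta> (proj a l u \<star> proj a m v) = 0" if "l \<in> {1, 0, \<alpha>}" "m \<in> {1, 0, \<alpha>}" for l m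
    using that by (intro fusion[of _ l _ m] mul_proj[OF ax])
      (auto simp: monster_law_def doubleton_eq_iff)
  then show ?thesis
    by (subst even_part[OF assms(1)], subst even_part[OF assms(2)])
       (simp add: mul_add_left mul_add_right proj_add)
qed

lemma odd_mul_odd:
  assumes "a \<star> u = \<beta> \<cdot> u" "a \<star> v = \<beta> \<cdot> v"
  shows "proj a \<beta> (u \<star> v) = 0"
  by (intro fusion[of _ \<beta> _ \<beta>] assms) (auto simp: monster_law_def doubleton_eq_iff)

lemma even_mul_odd:
  assumes "proj a \<beta> u = 0" "a \<star> v = \<beta> \<cdot> v"
  shows "proj a \<beta> (u \<star> v) = u \<star> v"
proof -
  have "proj a n (proj a l u \<star> v) = 0" if "l \<in> {1, 0, \<alpha>}" "n \<in> {1, 0, \<alpha>}" for l n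
    using that by (intro fusion[of _ l _ \<beta>] mul_proj[OF ax] assms)
      (auto simp: monster_law_def doubleton_eq_iff)
  then have "proj a n (u \<star> v) = 0" if "n \<in> {1, 0, \<alpha>}" for n
    using that by (subst even_part[OF assms(1)]) (auto simp: mul_add_left proj_add)
  then show ?thesis using sum_proj[of a "u \<star> v"] by simp
qed

lemma tau_add: "tau a (u + v) = tau a u + tau a v"
  and tau_diff: "tau a (u - v) = tau a u - tau a v"
  and tau_scale: "tau a (c \<cdot> v) = c \<cdot> tau a v"
  by (simp_all add: tau_def proj_add proj_diff proj_scale scale_right_distrib
      scale_right_diff_distrib scale_left_commute algebra_simps)

lemma scale_2: "2 \<cdot> v = v + v"
  using scale_left_distrib[of 1 1 v] by simp

lemma proj_tau: "m \<in> evals \<Longrightarrow> proj a m (tau a v) = (if m = \<beta> then - proj a \<beta> v else proj a m v)"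
  by (auto simp: tau_def proj_diff proj_scale proj_proj proj_add scale_2)

lemma tau_tau: "tau a (tau a v) = v"
  by (simp add: tau_def[of a "tau a v"] proj_tau) (simp add: tau_def)

text \<open>
  The fusion law is graded, with the \<open>\<beta>\<close>-eigenspace as odd part; changing the sign of the odd part
  is therefore multiplicative.
\<close>

lemma tau_mul: "tau a (u \<star> v) = tau a u \<star> tau a v"
proof -
  define u0 u1 v0 v1 where "u0 = u - proj a \<beta> u" and "u1 = proj a \<beta> u"
    and "v0 = v - proj a \<beta> v" and "v1 = proj a \<beta> v"
  have even: "proj a \<beta> u0 = 0" "proj a \<beta> v0 = 0"
    by (simp_all add: u0_def v0_def proj_diff proj_proj)
  have odd: "a \<star> u1 = \<beta> \<cdot> u1" "a \<star> v1 = \<beta> \<cdot> v1"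
    by (simp_all add: u1_def v1_def mul_proj[OF ax])
  have uv: "u = u0 + u1" "v = v0 + v1" "tau a u = u0 - u1" "tau a v = v0 - v1"
    by (simp_all add: u0_def v0_def u1_def v1_def tau_def scale_2)
  have "proj a \<beta> (u \<star> v) = u0 \<star> v1 + v0 \<star> u1"
    using even_mul_even[OF even] odd_mul_odd[OF odd] even_mul_odd[OF even(1) odd(2)]
      even_mul_odd[OF even(2) odd(1)]
    by (simp add: uv(1,2) mul_simps proj_add mul_commute[of u1 v0])
  then show ?thesis
    unfolding tau_def[of a "u \<star> v"] uv(3,4)
    by (simp add: uv(1,2) mul_simps scale_2 mul_commute[of u1 v0] algebra_simps)
qed

lemma tau_self: "tau a a = a"
  by (simp add: tau_def proj_self)

lemma lam_tau: "lam a (tau a v) = lam a v"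
  using proj_tau[of 1 v] proj_1[of v] by (intro lam_eqI) simp

lemma tau_sigma: "tau a (sigma a v) = sigma a v"
proof -
  have "proj a \<beta> (sigma a v) = 0"
    by (simp add: sigma_def proj_diff proj_scale proj_add proj_mul proj_self)
  then show ?thesis by (simp add: tau_def)
qed

lemma sigma_tau: "sigma a (tau a v) = sigma a v"
  using tau_sigma[of v] by (simp add: sigma_def tau_diff tau_add tau_scale tau_mul tau_self)

lemma lam_sigma: "lam a (sigma a v) = lam a v - \<beta> - \<beta> * lam a v"
  by (simp add: sigma_def functional_simps[OF functional_lam] lam_mul lam_self algebra_simps)

text \<open>
  If \<open>v = \<lambda> a + v\<^sub>0 + v\<^sub>\<alpha> + v\<^sub>\<beta>\<close>, then \<open>v + \<tau>\<^sub>a(v) = 2 (\<lambda> a + v\<^sub>0 + v\<^sub>\<alpha>)\<close> and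
  \<open>\<sigma>\<^sub>a(v) = (\<lambda> - \<beta> - \<beta> \<lambda>) a - \<beta> v\<^sub>0 + (\<alpha> - \<beta>) v\<^sub>\<alpha>\<close>; solve for \<open>v\<^sub>0\<close> and \<open>v\<^sub>\<alpha>\<close>.
\<close>

lemma
  shows zero_part_eq: "zero_part a v = \<alpha> \<cdot> proj a 0 v" and alpha_part_eq: "alpha_part a v = \<alpha> \<cdot> proj a \<alpha> v"
proof -
  have d: "v = lam a v \<cdot> a + proj a 0 v + proj a \<alpha> v + proj a \<beta> v"
    "a \<star> v = lam a v \<cdot> a + \<alpha> \<cdot> proj a \<alpha> v + \<beta> \<cdot> proj a \<beta> v"
    by (fact decomposition mul_decomposition)+
  have "\<phi> (zero_part a v) = \<phi> (\<alpha> \<cdot> proj a 0 v)" "\<phi> (alpha_part a v) = \<phi> (\<alpha> \<cdot> proj a \<alpha> v)"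
    if \<phi>: "functional \<phi>" for \<phi>
  proof -
    have dd: "\<phi> v = lam a v * \<phi> a + \<phi> (proj a 0 v) + \<phi> (proj a \<alpha> v) + \<phi> (proj a \<beta> v)"
      "\<phi> (a \<star> v) = lam a v * \<phi> a + \<alpha> * \<phi> (proj a \<alpha> v) + \<beta> * \<phi> (proj a \<beta> v)"
      using arg_cong[OF d(1), of \<phi>] arg_cong[OF d(2), of \<phi>] by (simp_all only: functional_simps[OF \<phi>])
    show "\<phi> (zero_part a v) = \<phi> (\<alpha> \<cdot> proj a 0 v)"
      unfolding zero_part_def sigma_def tau_def functional_simps[OF \<phi>]
      using dd two_half by Groebner_Basis.algebra
    show "\<phi> (alpha_part a v) = \<phi> (\<alpha> \<cdot> proj a \<alpha> v)"
      unfolding alpha_part_def sigma_def tau_def functional_simps[OF \<phi>]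
      using dd two_half by Groebner_Basis.algebra
  qed
  then show "zero_part a v = \<alpha> \<cdot> proj a 0 v" "alpha_part a v = \<alpha> \<cdot> proj a \<alpha> v"
    by (blast intro: vec_eqI)+
qed

lemma mul_zero_part: "a \<star> zero_part a v = 0"
  and mul_alpha_part: "a \<star> alpha_part a v = \<alpha> \<cdot> alpha_part a v"
  by (simp_all add: zero_part_eq alpha_part_eq mul_scale_right mul_proj[OF ax])

text \<open>
  This is the equation \<open>a v\<^sub>0 = 0\<close>, with \<open>v\<^sub>0\<close> written through \<open>\<sigma>\<^sub>a(v)\<close>.
\<close>

lemma mul_sigma: "a \<star> sigma a v = (\<alpha> - \<beta>) \<cdot> sigma a v + ((1 - \<alpha>) * lam a v + \<beta> * (\<alpha> - \<beta> - 1)) \<cdot> a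
    + (half * \<beta> * (\<alpha> - \<beta>)) \<cdot> (v + tau a v)"
proof (rule vec_eqI)
  fix \<phi> assume \<phi>: "functional \<phi>"
  have "\<phi> (a \<star> zero_part a v) = 0" by (simp add: mul_zero_part functional_simps[OF \<phi>])
  then have "((1 - \<alpha>) * lam a v - \<beta>) * \<phi> a + (half * (\<alpha> - \<beta>)) * (2 * \<phi> (sigma a v) + 2 * \<beta> * \<phi> a + \<beta> * \<phi> v + \<beta> * \<phi> (tau a v))
     - \<phi> (a \<star> sigma a v) = 0"
    by (simp add: zero_part_def mul_simps axis_idem functional_simps[OF \<phi>] mul_eq_sigma[of a "tau a v"] sigma_tau
        mul_eq_sigma[of a v] algebra_simps)
  with two_half show "\<phi> (a \<star> sigma a v) = \<phi> ((\<alpha> - \<beta>) \<cdot> sigma a v + ((1 - \<alpha>) * lam a v + \<beta> * (\<alpha> - \<beta> - 1)) \<cdot> a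
    + (half * \<beta> * (\<alpha> - \<beta>)) \<cdot> (v + tau a v))"
    unfolding functional_simps[OF \<phi>] by Groebner_Basis.algebra
qed

end

text \<open>
  For the \<open>0\<close>- and \<open>\<alpha>\<close>-components of \<open>v\<close> and \<open>w\<close>, \<open>w\<^sub>0 + w\<^sub>\<alpha> = \<onehalf> (w + \<tau>\<^sub>a(w)) - \<lambda>\<^sub>a(w) a\<close>.  Since
  \<open>a (v\<^sub>0 w\<^sub>0) = 0\<close> and \<open>a (v\<^sub>0 w\<^sub>\<alpha>) = \<alpha> v\<^sub>0 w\<^sub>\<alpha>\<close>, multiplying \<open>v\<^sub>0 (w\<^sub>0 + w\<^sub>\<alpha>)\<close> by \<open>a\<close> isolates
  \<open>v\<^sub>0 w\<^sub>\<alpha>\<close>; and \<open>\<alpha>\<^sup>2 v\<^sub>0 w\<^sub>\<alpha>\<close> is \<open>- \<sigma>\<^sub>a(v) \<sigma>\<^sub>a(w)\<close> plus products in which at most one factor is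
  a \<open>\<sigma>\<close>.
\<close>

lemma mul_sigma_sigma:
  assumes ax: "monster_axis a"
  shows "sigma a v \<star> sigma a w =
     - (a \<star> (zero_part a v \<star> (half \<cdot> (w + tau a w) - lam a w \<cdot> a)))
     + (zero_part a v + sigma a v) \<star> (alpha_part a w - sigma a w) + (zero_part a v + sigma a v) \<star> sigma a w
     - sigma a v \<star> (alpha_part a w - sigma a w)"
proof -
  let ?h = "half \<cdot> (w + tau a w) - lam a w \<cdot> a"
  have h: "zero_part a w + alpha_part a w = \<alpha> \<cdot> ?h"
  proof (rule vec_eqI)
    fix \<phi> assume \<phi>: "functional \<phi>"
    show "\<phi> (zero_part a w + alpha_part a w) = \<phi> (\<alpha> \<cdot> ?h)"
      unfolding zero_part_def alpha_part_def functional_simps[OF \<phi>] by Groebner_Basis.algebra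
  qed
  have "\<alpha> \<cdot> (a \<star> (zero_part a v \<star> ?h)) = a \<star> (zero_part a v \<star> (zero_part a w + alpha_part a w))"
    unfolding h by (simp only: mul_scale_right)
  also have "\<dots> = \<alpha> \<cdot> (zero_part a v \<star> alpha_part a w)"
    by (simp add: mul_add_right mul_zero_zero mul_zero_alpha mul_zero_part mul_alpha_part ax)
  finally have "a \<star> (zero_part a v \<star> ?h) = zero_part a v \<star> alpha_part a w"
    unfolding scale_cancel_left by simp
  then show ?thesis by (simp add: mul_simps algebra_simps)
qed

end

section \<open>Relations between two axes\<close>

text \<open>
  Naming the combination of the given equations that yields the goal leaves an identity of
  polynomials to check.
\<close>

lemma linear_certificate:
  fixes goal :: "'a::comm_ring_1"
  assumes "p = p'" "q = q'" "r = r'" "s = s'"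
    and "goal = k * (p - p') + l * (q - q') + m * (r - r') + n * (s - s')"
  shows "goal = 0"
  using assms by simp

locale monster_pair = monster_setting scale mul \<alpha> \<beta>
  for scale :: "'f::field \<Rightarrow> 'w::ab_group_add \<Rightarrow> 'w" (infixr "\<cdot>" 75)
    and mul :: "'w \<Rightarrow> 'w \<Rightarrow> 'w" (infixl "\<star>" 70)
    and \<alpha> \<beta> :: 'f +
  fixes a0 a1 :: 'w
  assumes axis0: "monster_axis a0" and axis1: "monster_axis a1"
    and \<alpha>_neq: "\<alpha> \<noteq> 2 * \<beta>" "\<alpha> \<noteq> 4 * \<beta>"
begin

text \<open>
  Here \<open>am1, am2\<close> are \<open>a\<^sub>-\<^sub>1, a\<^sub>-\<^sub>2\<close>, and \<open>s1, s2, s2'\<close> are the vectors denoted by the basis symbols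
  \<open>S1, S2, S2'\<close>.
\<close>

definition "am1 = tau a0 a1"
definition "a2 = tau a1 a0"
definition "am2 = tau a0 a2"
definition "a3 = tau a1 am1"
definition "a4 = tau a1 am2"
definition "s1 = sigma a0 a1"
definition "s2 = sigma a0 a2"
definition "s2' = sigma a1 am1"
definition "x = lam a0 a1"
definition "y = lam a1 a0"
definition "z = lam a0 a2"
definition "t = lam a1 am1"

text \<open>
  Exchanging the two axes sends \<open>a\<^sub>i\<close> to \<open>a\<^bsub>1-i\<^esub>\<close>.  It is no automorphism, but every relation
  has a mirror image, obtained from the same lemma for the exchanged pair (\<open>flip_simps\<close>).
\<close>

lemma flip: "monster_pair scale mul \<alpha> \<beta> a1 a0"
  by unfold_locales (fact axis0 axis1 \<alpha>_neq)+


text \<open>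
  \<open>W\<close> is twice the sum of the \<open>0\<close>- and the \<open>\<alpha>\<close>-component of \<open>a\<^sub>1\<close> with respect to \<open>a\<^sub>0\<close>;
  \<open>Az\<close> and \<open>Bz\<close> are the coefficients of \<open>a\<^sub>0\<close> in \<open>zero_part a0 a1\<close> and \<open>alpha_part a0 a1\<close>.
\<close>

abbreviation "W \<equiv> a1 + am1 - (2 * x) \<cdot> a0"
abbreviation "Az \<equiv> (1 - \<alpha>) * x - \<beta>"
abbreviation "Bz \<equiv> \<beta> - x"

lemma mul_a0_p: "a0 \<star> (a1 + am1) = 2 \<cdot> s1 + (2 * \<beta>) \<cdot> a0 + \<beta> \<cdot> (a1 + am1)"
  and mul_a0_q: "a0 \<star> (a2 + am2) = 2 \<cdot> s2 + (2 * \<beta>) \<cdot> a0 + \<beta> \<cdot> (a2 + am2)"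
proof -
  have "a0 \<star> (v + tau a0 v) = 2 \<cdot> sigma a0 v + (2 * \<beta>) \<cdot> a0 + \<beta> \<cdot> (v + tau a0 v)" for v
  proof (rule vec_eqI)
    fix \<phi> assume \<phi>: "functional \<phi>"
    show "\<phi> (a0 \<star> (v + tau a0 v)) = \<phi> (2 \<cdot> sigma a0 v + (2 * \<beta>) \<cdot> a0 + \<beta> \<cdot> (v + tau a0 v))"
      unfolding mul_add_right mul_eq_sigma[of a0] sigma_tau[OF axis0] functional_simps[OF \<phi>]
      by Groebner_Basis.algebra
  qed
  from this[of a1] this[of a2]
  show "a0 \<star> (a1 + am1) = 2 \<cdot> s1 + (2 * \<beta>) \<cdot> a0 + \<beta> \<cdot> (a1 + am1)"
    "a0 \<star> (a2 + am2) = 2 \<cdot> s2 + (2 * \<beta>) \<cdot> a0 + \<beta> \<cdot> (a2 + am2)"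
    by (simp_all add: s1_def s2_def am1_def am2_def)
qed

lemma s1_flip: "s1 = sigma a1 a0"
  by (simp add: s1_def sigma_commute)

lemma mul_a0_s1: "a0 \<star> s1 = (\<alpha> - \<beta>) \<cdot> s1 + ((1 - \<alpha>) * x + \<beta> * (\<alpha> - \<beta> - 1)) \<cdot> a0
    + (half * \<beta> * (\<alpha> - \<beta>)) \<cdot> (a1 + am1)"
  using mul_sigma[OF axis0, of a1] by (simp add: s1_def x_def am1_def)

lemma mul_a0_s2: "a0 \<star> s2 = (\<alpha> - \<beta>) \<cdot> s2 + ((1 - \<alpha>) * z + \<beta> * (\<alpha> - \<beta> - 1)) \<cdot> a0
    + (half * \<beta> * (\<alpha> - \<beta>)) \<cdot> (a2 + am2)"
  using mul_sigma[OF axis0, of a2] by (simp add: s2_def z_def am2_def)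

lemma mul_a1_s1: "a1 \<star> s1 = (\<alpha> - \<beta>) \<cdot> s1 + ((1 - \<alpha>) * y + \<beta> * (\<alpha> - \<beta> - 1)) \<cdot> a1
    + (half * \<beta> * (\<alpha> - \<beta>)) \<cdot> (a0 + a2)"
  using mul_sigma[OF axis1, of a0] by (simp add: s1_flip y_def a2_def)

lemma tau0_simps: "tau a0 a0 = a0" "tau a0 a1 = am1" "tau a0 am1 = a1" "tau a0 a2 = am2"
  "tau a0 am2 = a2" "tau a0 s1 = s1" "tau a0 s2 = s2"
  by (simp_all add: tau_self tau_tau tau_sigma axis0 am1_def am2_def s1_def s2_def)

lemma mul_am1_s1: "am1 \<star> s1 = (\<alpha> - \<beta>) \<cdot> s1 + ((1 - \<alpha>) * y + \<beta> * (\<alpha> - \<beta> - 1)) \<cdot> am1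
    + (half * \<beta> * (\<alpha> - \<beta>)) \<cdot> (a0 + am2)"
  using arg_cong[OF mul_a1_s1, of "tau a0"]
  by (simp add: tau_mul tau_add tau_scale axis0 tau0_simps)

lemma mul_p_p: "(a1 + am1) \<star> (a1 + am1) = (1 + 2 * \<beta>) \<cdot> (a1 + am1) + 2 \<cdot> s2'"
proof (rule vec_eqI)
  fix \<phi> assume \<phi>: "functional \<phi>"
  have "am1 \<star> am1 = am1"
    using arg_cong[OF axis_idem[OF axis1], of "tau a0"] by (simp add: tau_mul axis0 tau0_simps)
  moreover have "a1 \<star> am1 = s2' + \<beta> \<cdot> (a1 + am1)" by (simp add: mul_eq_sigma[of a1 am1] s2'_def)
  ultimately show "\<phi> ((a1 + am1) \<star> (a1 + am1)) = \<phi> ((1 + 2 * \<beta>) \<cdot> (a1 + am1) + 2 \<cdot> s2')"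
    unfolding mul_add_left mul_add_right mul_commute[of am1 a1] axis_idem[OF axis1]
    by (simp add: functional_simps[OF \<phi>] algebra_simps)
qed

lemma functional_mul_p_s1:
  assumes "functional \<phi>"
  shows "2 * \<phi> ((a1 + am1) \<star> s1) = 4 * (\<alpha> - \<beta>) * \<phi> s1
     + 2 * ((1 - \<alpha>) * y + \<beta> * (\<alpha> - \<beta> - 1)) * \<phi> (a1 + am1)
     + \<beta> * (\<alpha> - \<beta>) * (2 * \<phi> a0 + \<phi> (a2 + am2))"
  unfolding mul_add_left mul_a1_s1 mul_am1_s1 functional_simps[OF assms]
  using two_half by Groebner_Basis.algebra

lemma functional_mul_a0_s1:
  assumes "functional \<phi>"
  shows "2 * \<phi> (a0 \<star> s1) = 2 * (\<alpha> - \<beta>) * \<phi> s1 + 2 * ((1 - \<alpha>) * x + \<beta> * (\<alpha> - \<beta> - 1)) * \<phi> a0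
    + \<beta> * (\<alpha> - \<beta>) * \<phi> (a1 + am1)"
  unfolding mul_a0_s1 functional_simps[OF assms] using two_half by Groebner_Basis.algebra

text \<open>
  The factor \<open>W\<close> has no \<open>\<sigma>\<^sub>1\<close>-term, so such products avoid \<open>\<sigma>\<^sub>1 \<sigma>\<^sub>1\<close> and lie in the span of the eight
  basic vectors.
\<close>

lemma W_mul:
  defines "n0 \<equiv> \<lambda>c d e. 4 * \<beta> * c + 2 * \<beta> * (\<alpha> - \<beta>) * e - 4 * x * c - 8 * \<beta> * x * d
      - 4 * x * e * ((1 - \<alpha>) * x + \<beta> * (\<alpha> - \<beta> - 1))"
    and "np \<equiv> \<lambda>c d e. 2 * \<beta> * c + 2 * (1 + 2 * \<beta>) * d + 2 * e * ((1 - \<alpha>) * y + \<beta> * (\<alpha> - \<beta> - 1))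
      - 4 * x * d * \<beta> - 2 * x * e * \<beta> * (\<alpha> - \<beta>)"
    and "ns \<equiv> \<lambda>c d e. 4 * c + 4 * (\<alpha> - \<beta>) * e - 8 * x * d - 4 * x * e * (\<alpha> - \<beta>)"
  shows "2 \<cdot> (W \<star> (c \<cdot> a0 + d \<cdot> (a1 + am1) + e \<cdot> s1)) =
    n0 c d e \<cdot> a0 + np c d e \<cdot> (a1 + am1) + ns c d e \<cdot> s1 + (\<beta> * (\<alpha> - \<beta>) * e) \<cdot> (a2 + am2) + (4 * d) \<cdot> s2'"
proof (rule vec_eqI)
  fix \<phi> assume \<phi>: "functional \<phi>"
  let ?p = "a1 + am1"
  have "(p - k \<cdot> a) \<star> (c \<cdot> a + d \<cdot> p + e \<cdot> s) = c \<cdot> (a \<star> p) + d \<cdot> (p \<star> p) + e \<cdot> (p \<star> s)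
      - (k * c) \<cdot> (a \<star> a) - (k * d) \<cdot> (a \<star> p) - (k * e) \<cdot> (a \<star> s)" for p k a s
    by (simp add: mul_simps scale_right_distrib mul_commute[of p a] algebra_simps)
  from this[of ?p "2 * x" a0 s1]
  have "W \<star> (c \<cdot> a0 + d \<cdot> ?p + e \<cdot> s1) = c \<cdot> (a0 \<star> ?p) + d \<cdot> (?p \<star> ?p) + e \<cdot> (?p \<star> s1)
      - (2 * x * c) \<cdot> a0 - (2 * x * d) \<cdot> (a0 \<star> ?p) - (2 * x * e) \<cdot> (a0 \<star> s1)"
    by (simp only: axis_idem[OF axis0])
  note eq = this
  have "\<phi> (2 \<cdot> (W \<star> (c \<cdot> a0 + d \<cdot> ?p + e \<cdot> s1))) = 2 * c * \<phi> (a0 \<star> ?p) + 2 * d * \<phi> (?p \<star> ?p)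
      + e * (2 * \<phi> (?p \<star> s1)) - 4 * x * c * \<phi> a0 - 4 * x * d * \<phi> (a0 \<star> ?p)
      - 2 * x * e * (2 * \<phi> (a0 \<star> s1))"
    by (simp only: eq functional_add[OF \<phi>] functional_diff[OF \<phi>] functional_scale[OF \<phi>])
       Groebner_Basis.algebra
  also have "\<dots> = \<phi> (n0 c d e \<cdot> a0 + np c d e \<cdot> ?p + ns c d e \<cdot> s1
      + (\<beta> * (\<alpha> - \<beta>) * e) \<cdot> (a2 + am2) + (4 * d) \<cdot> s2')"
    unfolding functional_mul_p_s1[OF \<phi>] functional_mul_a0_s1[OF \<phi>] mul_a0_p mul_p_p
      functional_simps[OF \<phi>] n0_def np_def ns_def
    by Groebner_Basis.algebra
  finally show "\<phi> (2 \<cdot> (W \<star> (c \<cdot> a0 + d \<cdot> ?p + e \<cdot> s1))) = \<dots>" .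
qed

lemma two_zero_part: "2 \<cdot> zero_part a0 a1 = (2 * Az) \<cdot> a0 + (\<alpha> - \<beta>) \<cdot> (a1 + am1) + (- 2) \<cdot> s1"
  and two_alpha_part: "2 \<cdot> alpha_part a0 a1 = (2 * Bz) \<cdot> a0 + \<beta> \<cdot> (a1 + am1) + 2 \<cdot> s1"
proof -
  have h: "2 * half * c = c" "2 * (half * c) = c" for c :: 'f
    using two_half by (simp_all add: mult.assoc[symmetric])
  show "2 \<cdot> zero_part a0 a1 = (2 * Az) \<cdot> a0 + (\<alpha> - \<beta>) \<cdot> (a1 + am1) + (- 2) \<cdot> s1"
    "2 \<cdot> alpha_part a0 a1 = (2 * Bz) \<cdot> a0 + \<beta> \<cdot> (a1 + am1) + 2 \<cdot> s1"
    by (simp_all add: zero_part_def alpha_part_def x_def[symmetric] am1_def[symmetric] s1_def[symmetric]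
        scale_right_distrib[of 2] scale_right_diff_distrib[of 2] h)
qed

lemma two_zero_part_add_alpha_part: "2 \<cdot> (zero_part a0 a1 + alpha_part a0 a1) = \<alpha> \<cdot> W"
proof (rule vec_eqI)
  fix \<phi> assume \<phi>: "functional \<phi>"
  show "\<phi> (2 \<cdot> (zero_part a0 a1 + alpha_part a0 a1)) = \<phi> (\<alpha> \<cdot> W)"
    unfolding scale_right_distrib[of 2] two_zero_part two_alpha_part functional_simps[OF \<phi>]
    by Groebner_Basis.algebra
qed

lemma lam0_simps: "lam a0 a0 = 1" "lam a0 a1 = x" "lam a0 am1 = x" "lam a0 a2 = z" "lam a0 am2 = z"
  "lam a0 s1 = x - \<beta> - \<beta> * x" "lam a0 s2 = z - \<beta> - \<beta> * z"
  by (simp_all add: lam_self lam_tau lam_sigma axis0 x_def z_def am1_def am2_def s1_def s2_def)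

text \<open>
  For \<open>v = a\<^sub>1\<close>, the products \<open>v\<^sub>0 v\<^sub>0\<close> and \<open>v\<^sub>0 v\<^sub>\<alpha>\<close> have no component along \<open>a\<^sub>0\<close>.  In their sum
  \<open>v\<^sub>0 (v\<^sub>0 + v\<^sub>\<alpha>)\<close>, a multiple of \<open>v\<^sub>0 W\<close>, the vector \<open>\<sigma>\<^sub>2'\<close> enters through \<open>a\<^sub>1 a\<^sub>-\<^sub>1\<close>.
\<close>

lemma lam0_s2': "(\<alpha> - \<beta>) * lam a0 s2' = 2 * (\<alpha> - 1) * x^2 - 2 * (\<alpha> - 1) * x * y
    + (\<alpha> - \<beta>) * ((1 - 2 * \<beta>) * x + \<beta> * z - \<beta>)"
proof -
  note \<phi> = functional_lam[OF axis0]
  have "\<alpha> \<cdot> (2 \<cdot> (W \<star> (2 \<cdot> zero_part a0 a1))) = 8 \<cdot> (zero_part a0 a1 \<star> zero_part a0 a1) + 8 \<cdot> (zero_part a0 a1 \<star> alpha_part a0 a1)"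
  proof -
    have "\<alpha> \<cdot> (2 \<cdot> (W \<star> (2 \<cdot> zero_part a0 a1))) = 2 \<cdot> ((\<alpha> \<cdot> W) \<star> (2 \<cdot> zero_part a0 a1))"
      by (simp only: mul_scale_left scale_left_commute)
    then show ?thesis
      unfolding two_zero_part_add_alpha_part[symmetric]
      by (simp add: mul_simps scale_right_distrib mul_commute)
  qed
  from arg_cong[OF this, of "lam a0"]
  have "\<alpha> * lam a0 (2 \<cdot> (W \<star> (2 \<cdot> zero_part a0 a1)))
      = 8 * lam a0 (zero_part a0 a1 \<star> zero_part a0 a1) + 8 * lam a0 (zero_part a0 a1 \<star> alpha_part a0 a1)"
    by (simp only: functional_add[OF \<phi>] functional_scale[OF \<phi>])
  moreover have "lam a0 (zero_part a0 a1 \<star> zero_part a0 a1) = 0"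
    by (rule lam_eigenvector[OF axis0, of _ 0]) (simp_all add: mul_zero_zero mul_zero_part axis0)
  moreover have "lam a0 (zero_part a0 a1 \<star> alpha_part a0 a1) = 0"
    by (rule lam_eigenvector[OF axis0, of _ \<alpha>]) (simp_all add: mul_zero_alpha mul_zero_part mul_alpha_part axis0)
  ultimately have "lam a0 (2 \<cdot> (W \<star> (2 \<cdot> zero_part a0 a1))) = 0"
    by simp
  then have eq: "0 = lam a0 (2 \<cdot> (W \<star> (2 \<cdot> zero_part a0 a1)))" by simp
  have "4 * ((\<alpha> - \<beta>) * lam a0 s2') = 4 * (2 * (\<alpha> - 1) * x^2 - 2 * (\<alpha> - 1) * x * y
    + (\<alpha> - \<beta>) * ((1 - 2 * \<beta>) * x + \<beta> * z - \<beta>))"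
    using eq unfolding two_zero_part W_mul functional_simps[OF \<phi>] lam0_simps
    by Groebner_Basis.algebra
  moreover have "(4::'f) \<noteq> 0" using two_nonzero by (metis mult_eq_0_iff mult_2 numeral_Bit0)
  ultimately show ?thesis by (simp only: mult_cancel_left) simp
qed


lemma four_nonzero: "(4::'f) \<noteq> 0"
  using two_nonzero by (metis mult_eq_0_iff mult_2 numeral_Bit0)

text \<open>
  For \<open>v = a\<^sub>1\<close>, the product \<open>v\<^sub>0 v\<^sub>0\<close> is killed by \<open>a\<^sub>0\<close>, and \<open>v\<^sub>\<alpha> v\<^sub>\<alpha>\<close> lies in the sum of the
  \<open>1\<close>- and the \<open>0\<close>-eigenspace.  So \<open>a\<^sub>0\<close> times the difference is \<open>\<lambda>\<^sub>0\<close> of the difference times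
  \<open>a\<^sub>0\<close>.  Since the difference is \<open>(v\<^sub>0 + v\<^sub>\<alpha>) (v\<^sub>0 - v\<^sub>\<alpha>)\<close>, a multiple of a product with \<open>W\<close>, it
  expands into basic vectors; among them only \<open>\<sigma>\<^sub>2'\<close>, with coefficient proportional to
  \<open>\<alpha> - 2 \<beta>\<close>, has an unknown product with \<open>a\<^sub>0\<close>.
\<close>

lemma mul_a0_s2':
  "(2 * (\<alpha> - 2 * \<beta>) * (\<alpha> - \<beta>)) \<cdot> (a0 \<star> s2') =
     (2 * \<beta>^2 * (\<alpha> - \<beta>)^2) \<cdot> (a2 + am2)
     + ((\<alpha> - \<beta>) * (-4 * \<alpha> * \<beta> * x + 4 * \<beta> * (1 - \<alpha>) * y
          + \<beta> * (4 * \<alpha>^2 - 2 * \<alpha> * \<beta> - \<alpha> + 4 * \<beta>^2 - 2 * \<beta>))) \<cdot> (a1 + am1)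
     + (2 * ((6 * \<alpha>^2 - 8 * \<alpha> * \<beta> - 2 * \<alpha> + 4 * \<beta>) * x^2 + (2 * \<alpha>^2 - 2 * \<alpha>) * x * y
          + 2 * (-2 * \<alpha>^2 - 2 * \<alpha> * \<beta> + \<alpha>) * (\<alpha> - \<beta>) * x - 4 * \<beta> * (\<alpha> - 1) * (\<alpha> - \<beta>) * y
          - \<alpha> * \<beta> * (\<alpha> - \<beta>) * z + (4 * \<alpha>^2 * \<beta> - 2 * \<alpha> * \<beta> + 2 * \<beta>^3) * (\<alpha> - \<beta>))) \<cdot> a0
     + (2 * (\<alpha> - \<beta>) * (-4 * \<alpha> * x - 4 * (\<alpha> - 1) * y + 4 * \<alpha>^2 - 2 * \<alpha> * \<beta> - \<alpha> + 4 * \<beta>^2 - 2 * \<beta>)) \<cdot> s1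
     + (4 * \<beta> * (\<alpha> - \<beta>)^2) \<cdot> s2" (is "?l \<cdot> _ = ?rhs")
proof (rule vec_eqI)
  fix \<phi> assume \<phi>: "functional \<phi>"
  note \<lambda> = functional_lam[OF axis0]
  let ?u = "zero_part a0 a1" and ?v = "alpha_part a0 a1"
  have "(\<alpha> \<cdot> W) \<star> (2 \<cdot> ?u - 2 \<cdot> ?v) = 4 \<cdot> (?u \<star> ?u) - 4 \<cdot> (?v \<star> ?v)"
    unfolding two_zero_part_add_alpha_part[symmetric]
    by (simp add: mul_simps scale_right_distrib scale_right_diff_distrib mul_commute algebra_simps)
  moreover have "a0 \<star> (4 \<cdot> (?u \<star> ?u) - 4 \<cdot> (?v \<star> ?v)) = lam a0 (4 \<cdot> (?u \<star> ?u) - 4 \<cdot> (?v \<star> ?v)) \<cdot> a0"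
  proof -
    have u: "a0 \<star> (?u \<star> ?u) = 0" by (simp add: mul_zero_zero mul_zero_part axis0)
    then have "lam a0 (?u \<star> ?u) = 0" by (intro lam_eigenvector[OF axis0, of _ 0]) simp_all
    with u show ?thesis
      by (simp add: mul_simps functional_simps[OF \<lambda>] mul_alpha_alpha[OF axis0 mul_alpha_part mul_alpha_part] axis0)
  qed
  ultimately have Q: "a0 \<star> ((\<alpha> \<cdot> W) \<star> (2 \<cdot> ?u - 2 \<cdot> ?v))
      = lam a0 ((\<alpha> \<cdot> W) \<star> (2 \<cdot> ?u - 2 \<cdot> ?v)) \<cdot> a0" by (simp only:)
  then have "\<alpha> \<cdot> (a0 \<star> (W \<star> (2 \<cdot> ?u - 2 \<cdot> ?v))) = \<alpha> \<cdot> (lam a0 (W \<star> (2 \<cdot> ?u - 2 \<cdot> ?v)) \<cdot> a0)"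
    by (simp only: mul_scale_left mul_scale_right functional_scale[OF \<lambda>] scale_scale)
  then have E0: "a0 \<star> (W \<star> (2 \<cdot> ?u - 2 \<cdot> ?v)) = lam a0 (W \<star> (2 \<cdot> ?u - 2 \<cdot> ?v)) \<cdot> a0"
    unfolding scale_cancel_left by simp
  have D: "2 \<cdot> ?u - 2 \<cdot> ?v = (2 * Az - 2 * Bz) \<cdot> a0 + (\<alpha> - 2 * \<beta>) \<cdot> (a1 + am1) + (- 4) \<cdot> s1"
  proof (rule vec_eqI)
    fix \<phi> assume \<phi>: "functional \<phi>"
    show "\<phi> (2 \<cdot> ?u - 2 \<cdot> ?v) = \<phi> ((2 * Az - 2 * Bz) \<cdot> a0 + (\<alpha> - 2 * \<beta>) \<cdot> (a1 + am1) + (- 4) \<cdot> s1)"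
      unfolding two_zero_part two_alpha_part functional_simps[OF \<phi>] by Groebner_Basis.algebra
  qed
  have "\<phi> (a0 \<star> (2 \<cdot> (W \<star> ((2 * Az - 2 * Bz) \<cdot> a0 + (\<alpha> - 2 * \<beta>) \<cdot> (a1 + am1) + (- 4) \<cdot> s1))))
     = lam a0 (2 \<cdot> (W \<star> ((2 * Az - 2 * Bz) \<cdot> a0 + (\<alpha> - 2 * \<beta>) \<cdot> (a1 + am1) + (- 4) \<cdot> s1))) * \<phi> a0"
    by (simp only: mul_scale_right functional_scale[OF \<phi>] functional_scale[OF \<lambda>] E0[unfolded D] mult.assoc)
  note E = this[unfolded W_mul functional_simps[OF \<lambda>] lam0_simps mul_add_right[of a0 _ "_ \<cdot> _"]
      mul_scale_right axis_idem[OF axis0] mul_a0_p mul_a0_q functional_simps[OF \<phi>]]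
  have S: "2 * \<phi> (a0 \<star> s1) = 2 * (\<alpha> - \<beta>) * \<phi> s1 + 2 * ((1 - \<alpha>) * x + \<beta> * (\<alpha> - \<beta> - 1)) * \<phi> a0
    + \<beta> * (\<alpha> - \<beta>) * (\<phi> a1 + \<phi> am1)"
    using functional_mul_a0_s1[OF \<phi>] by (simp only: functional_add[OF \<phi>])
  have "2 * (\<phi> (?l \<cdot> (a0 \<star> s2')) - \<phi> ?rhs) = 0"
    unfolding functional_simps[OF \<phi>]
    by (rule linear_certificate[OF E S lam0_s2' refl[of 0], of _ "\<alpha> - \<beta>"
        "(\<alpha> - \<beta>) * (- 4 * (Az - Bz) + 8 * (\<alpha> - \<beta>) + 4 * x * (\<alpha> - 2 * \<beta>) - 8 * x * (\<alpha> - \<beta>))"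
        "4 * (\<alpha> - 2 * \<beta>) * \<phi> a0" 0]) Groebner_Basis.algebra
  then show "\<phi> (?l \<cdot> (a0 \<star> s2')) = \<phi> ?rhs"
    using two_nonzero by simp
qed

text \<open>
  For \<open>v = a\<^sub>1\<close>, multiplying \<open>v\<^sub>0 W\<close> by \<open>a\<^sub>0\<close> yields \<open>2 \<alpha> v\<^sub>0 v\<^sub>\<alpha>\<close>; the left side expands by \<open>W_mul\<close>
  and the previous lemma, and on the right \<open>\<sigma>\<^sub>1 \<sigma>\<^sub>1\<close> appears.
\<close>

lemma mul_s1_s1:
  "(4 * (\<alpha> - 2 * \<beta>)) \<cdot> (s1 \<star> s1) =
     (\<beta> * (\<alpha> - \<beta>)^2 * (\<alpha> - 4 * \<beta>)) \<cdot> (a2 + am2)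
     + ((\<alpha> - \<beta>) * (4 * \<alpha> * \<beta> * x - 2 * (\<alpha> - 1) * (\<alpha> - 4 * \<beta>) * y
          + \<beta> * (- 10 * \<alpha> * \<beta> - \<alpha> + 4 * \<beta>^2 + 6 * \<beta>))) \<cdot> (a1 + am1)
     + ((- 12 * \<alpha>^2 + 16 * \<alpha> * \<beta> + 4 * \<alpha> - 8 * \<beta>) * x^2 - 4 * \<alpha> * (\<alpha> - 1) * x * y
          + (4 * \<alpha>^3 + 16 * \<alpha>^2 * \<beta> - 24 * \<alpha> * \<beta>^2 - 12 * \<alpha> * \<beta> + 16 * \<beta>^2) * x
          + 4 * \<alpha> * \<beta> * (\<alpha> - 1) * y + 2 * \<alpha> * \<beta> * (\<alpha> - \<beta>) * z
          + \<beta> * (- 2 * \<alpha>^3 - 16 * \<alpha>^2 * \<beta> + 26 * \<alpha> * \<beta>^2 + 8 * \<alpha> * \<beta> - 8 * \<beta>^3 - 8 * \<beta>^2)) \<cdot> a0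
     + (8 * \<alpha> * (\<alpha> - \<beta>) * x + 4 * \<alpha> * (\<alpha> - 1) * y
          - 24 * \<alpha>^2 * \<beta> + 40 * \<alpha> * \<beta>^2 + 4 * \<alpha> * \<beta> - 16 * \<beta>^3) \<cdot> s1
     - (2 * \<alpha> * \<beta> * (\<alpha> - \<beta>)) \<cdot> s2 + (2 * \<beta> * (\<alpha> - \<beta>) * (\<alpha> - 2 * \<beta>)) \<cdot> s2'"
  (is "?l \<cdot> _ = ?rhs")
proof (rule vec_eqI)
  fix \<phi> assume \<phi>: "functional \<phi>"
  let ?u = "zero_part a0 a1" and ?v = "alpha_part a0 a1" and ?p = "a1 + am1"
  have uv: "a0 \<star> (?u \<star> ?u) = 0" "a0 \<star> (?u \<star> ?v) = \<alpha> \<cdot> (?u \<star> ?v)"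
    by (simp_all add: mul_zero_zero mul_zero_alpha mul_zero_part mul_alpha_part axis0)
  have "\<alpha> \<cdot> (a0 \<star> (W \<star> (2 \<cdot> ?u))) = a0 \<star> ((2 \<cdot> (?u + ?v)) \<star> (2 \<cdot> ?u))"
    unfolding two_zero_part_add_alpha_part by (simp only: mul_scale_left mul_scale_right scale_scale mult.commute)
  also have "\<dots> = \<alpha> \<cdot> ((2 \<cdot> ?u) \<star> (2 \<cdot> ?v))"
    by (simp add: mul_simps scale_right_distrib uv mul_commute[of ?v ?u] mult.commute)
  finally have "a0 \<star> (W \<star> (2 \<cdot> ?u)) = (2 \<cdot> ?u) \<star> (2 \<cdot> ?v)"
    unfolding scale_cancel_left by simp
  then have "\<phi> (a0 \<star> (2 \<cdot> (W \<star> (2 \<cdot> ?u)))) = 2 * \<phi> ((2 \<cdot> ?u) \<star> (2 \<cdot> ?v))"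
    by (simp only: mul_scale_right[of a0 2] functional_scale[OF \<phi>])
  note E = this[unfolded two_zero_part two_alpha_part W_mul mul_add_right[of a0 _ "_ \<cdot> _"]
      mul_scale_right[of a0] axis_idem[OF axis0] mul_a0_p mul_a0_q functional_simps[OF \<phi>]]
  have "(c \<cdot> a0 + d \<cdot> p + (- 2) \<cdot> s1) \<star> (c' \<cdot> a0 + d' \<cdot> p + 2 \<cdot> s1) = (c * c') \<cdot> a0
     + (c * d' + d * c') \<cdot> (a0 \<star> p) + (d * d') \<cdot> (p \<star> p) + (2 * c - 2 * c') \<cdot> (a0 \<star> s1)
     + (2 * d - 2 * d') \<cdot> (p \<star> s1) - 4 \<cdot> (s1 \<star> s1)" for c d c' d' p
    by (rule vec_eqI, simp only: mul_add_left mul_add_right mul_scale_left mul_scale_right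
        axis_idem[OF axis0] mul_commute[of p a0] mul_commute[of s1 a0] mul_commute[of s1 p]
        functional_simps, Groebner_Basis.algebra)
  note U = arg_cong[OF this[of "2 * Az" "\<alpha> - \<beta>" ?p "2 * Bz" \<beta>], of \<phi>, unfolded mul_p_p mul_a0_p functional_simps[OF \<phi>]]
  have S: "2 * \<phi> (a0 \<star> s1) = 2 * (\<alpha> - \<beta>) * \<phi> s1 + 2 * ((1 - \<alpha>) * x + \<beta> * (\<alpha> - \<beta> - 1)) * \<phi> a0
    + \<beta> * (\<alpha> - \<beta>) * (\<phi> a1 + \<phi> am1)"
    using functional_mul_a0_s1[OF \<phi>] by (simp only: functional_add[OF \<phi>])
  have P: "2 * \<phi> (?p \<star> s1) = 4 * (\<alpha> - \<beta>) * \<phi> s1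
     + 2 * ((1 - \<alpha>) * y + \<beta> * (\<alpha> - \<beta> - 1)) * (\<phi> a1 + \<phi> am1)
     + \<beta> * (\<alpha> - \<beta>) * (2 * \<phi> a0 + (\<phi> a2 + \<phi> am2))"
    using functional_mul_p_s1[OF \<phi>] by (simp only: functional_add[OF \<phi>])
  note M = arg_cong[OF mul_a0_s2', of \<phi>, unfolded functional_simps[OF \<phi>]]
  have "2 * (\<phi> (?l \<cdot> (s1 \<star> s1)) - \<phi> ?rhs) = 0"
    unfolding functional_simps[OF \<phi>]
    by (rule linear_certificate[OF E[unfolded U] S P M, of _ "\<alpha> - 2 * \<beta>" "(\<alpha> - 2 * \<beta>) * (4 * (\<alpha> - \<beta>) - 4 * Bz)"
        "2 * (\<alpha> - 2 * \<beta>)^2" "- 2"]) Groebner_Basis.algebra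
  then show "\<phi> (?l \<cdot> (s1 \<star> s1)) = \<phi> ?rhs"
    using two_nonzero by simp
qed

lemma flip_simps:
  "monster_pair.am1 scale mul \<alpha> \<beta> a1 a0 = a2"
  "monster_pair.a2 scale mul \<alpha> \<beta> a1 a0 = am1"
  "monster_pair.am2 scale mul \<alpha> \<beta> a1 a0 = a3"
  "monster_pair.a3 scale mul \<alpha> \<beta> a1 a0 = am2"
  "monster_pair.s1 scale mul \<beta> a1 a0 = s1"
  "monster_pair.s2 scale mul \<alpha> \<beta> a1 a0 = s2'"
  "monster_pair.s2' scale mul \<alpha> \<beta> a1 a0 = s2"
  "monster_pair.x scale mul \<alpha> \<beta> a1 a0 = y"
  "monster_pair.y scale mul \<alpha> \<beta> a1 a0 = x"
  "monster_pair.z scale mul \<alpha> \<beta> a1 a0 = t"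
  "monster_pair.t scale mul \<alpha> \<beta> a1 a0 = z"
proof -
  interpret f: monster_pair scale mul \<alpha> \<beta> a1 a0 by (rule flip)
  show a: "f.am1 = a2" "f.a2 = am1" "f.am2 = a3" "f.a3 = am2"
    by (simp_all add: f.am1_def a2_def f.a2_def am1_def f.am2_def a3_def f.a3_def am2_def)
  show "f.s1 = s1" "f.s2 = s2'" "f.s2' = s2" "f.x = y" "f.y = x" "f.z = t" "f.t = z"
    by (simp_all add: a f.s1_def s1_flip f.s2_def s2'_def f.s2'_def s2_def f.x_def y_def f.y_def x_def
        f.z_def t_def f.t_def z_def)
qed

text \<open>
  The left side of \<open>mul_s1_s1\<close> is symmetric in the two axes; subtracting the mirror image of
  the right side gives a relation in which \<open>a\<^sub>-\<^sub>2\<close> occurs on one side only and \<open>a\<^sub>3\<close> on the other.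
\<close>

lemma a3_eq:
  fixes A B
  defines "A \<equiv> \<lambda>x y. (\<alpha> - \<beta>) * (4 * \<alpha> * \<beta> * x - 2 * (\<alpha> - 1) * (\<alpha> - 4 * \<beta>) * y
      + \<beta> * (- (\<alpha>^2) - 5 * \<alpha> * \<beta> - \<alpha> + 6 * \<beta>))"
    and "B \<equiv> \<lambda>x y z. 4 * (- 3 * \<alpha>^2 + 4 * \<alpha> * \<beta> + \<alpha> - 2 * \<beta>) * x^2 - 4 * \<alpha> * (\<alpha> - 1) * x * y
      + (6 * \<alpha>^3 + 6 * \<alpha>^2 * \<beta> - 2 * \<alpha>^2 - 16 * \<alpha> * \<beta>^2 - 2 * \<alpha> * \<beta> + 8 * \<beta>^2) * x
      + 4 * \<alpha> * \<beta> * (\<beta> - 1) * y + 2 * \<alpha> * \<beta> * (\<alpha> - \<beta>) * z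
      + \<beta> * (\<alpha> - \<beta>) * (- 2 * \<alpha>^2 - 8 * \<alpha> * \<beta> + \<alpha> + 4 * \<beta>^2 + 2 * \<beta>)"
  shows "(\<beta> * (\<alpha> - \<beta>)^2 * (\<alpha> - 4 * \<beta>)) \<cdot> (a3 - am2) =
    A x y \<cdot> am1 + B x y z \<cdot> a0 - B y x t \<cdot> a1 - A y x \<cdot> a2
    + (4 * \<alpha> * (\<alpha> - 2 * \<beta> + 1) * (x - y)) \<cdot> s1 - (4 * \<beta> * (\<alpha> - \<beta>)^2) \<cdot> (s2 - s2')"
  (is "?l \<cdot> _ = ?rhs")
proof (rule vec_eqI)
  fix \<phi> assume \<phi>: "functional \<phi>"
  note E1 = arg_cong[OF mul_s1_s1, of \<phi>, unfolded functional_simps[OF \<phi>]]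
  note E2 = arg_cong[OF monster_pair.mul_s1_s1[OF flip, unfolded flip_simps], of \<phi>,
      unfolded functional_simps[OF \<phi>]]
  show "\<phi> (?l \<cdot> (a3 - am2)) = \<phi> ?rhs"
    unfolding functional_simps[OF \<phi>] A_def B_def using E1 E2 by Groebner_Basis.algebra
qed

end

section \<open>Evaluation of polynomials\<close>

lemma poly_mapping_add_single_induct [case_names zero add]:
  fixes p :: "'k \<Rightarrow>\<^sub>0 'c::comm_monoid_add"
  assumes "P 0" and "\<And>p m c. P p \<Longrightarrow> P (p + Poly_Mapping.single m c)"
  shows "P p"
proof (induction p rule: update_induct)
  case const
  show ?case using assms(1) .
next
  case (update f k c)
  have "Poly_Mapping.update k c f = f + Poly_Mapping.single k c"
    using update.hyps(1)
    by (intro poly_mapping_eqI) (auto simp: lookup_add lookup_update lookup_single when_def in_keys_iff)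
  then show ?case using assms(2)[OF update.IH] by simp
qed

lemma eval4_superset:
  assumes "finite S" "Poly_Mapping.keys p \<subseteq> S"
  shows "eval4 p P = (\<Sum>m\<in>S. Poly_Mapping.lookup p m * (\<Prod>i\<in>UNIV. (P $ i) ^ Poly_Mapping.lookup m i))"
  unfolding eval4_def using assms
  by (intro sum.mono_neutral_left) (auto simp: in_keys_iff)

lemma eval4_zero [simp]: "eval4 0 P = 0"
  by (simp add: eval4_def)

lemma eval4_single: "eval4 (Poly_Mapping.single m c) P = c * (\<Prod>i\<in>UNIV. (P $ i) ^ Poly_Mapping.lookup m i)"
  by (subst eval4_superset[of "{m}"]) auto

lemma eval4_add: "eval4 (p + q) P = eval4 p P + eval4 q P"
proof -
  let ?S = "Poly_Mapping.keys p \<union> Poly_Mapping.keys q"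
  have "Poly_Mapping.keys (p + q) \<subseteq> ?S" by (rule keys_add)
  then show ?thesis
    by (subst (1 2 3) eval4_superset[of ?S]) (auto simp: lookup_add distrib_right sum.distrib)
qed

lemma eval4_mult: "eval4 (p * q) P = eval4 p P * eval4 q P"
proof (induction p rule: poly_mapping_add_single_induct)
  case (add p m c)
  have "eval4 (Poly_Mapping.single m c * q) P = eval4 (Poly_Mapping.single m c) P * eval4 q P"
  proof (induction q rule: poly_mapping_add_single_induct)
    case (add q n d)
    then show ?case
      by (simp add: distrib_left eval4_add mult_single eval4_single lookup_add power_add prod.distrib)
  qed simp
  with add show ?case by (simp add: distrib_right eval4_add)
qed simp

lemma eval4_cst: "eval4 (cst c) P = c"
  by (simp add: cst_def eval4_single)

lemma eval4_pvar: "eval4 (pvar i) P = P $ i"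
proof -
  have "(\<Prod>j\<in>UNIV. (P $ j) ^ Poly_Mapping.lookup (Poly_Mapping.single i (1::nat)) j)
      = (\<Prod>j\<in>UNIV. if j = i then P $ j else 1)"
    by (intro prod.cong) (auto simp: lookup_single when_def)
  then show ?thesis by (simp add: pvar_def eval4_single)
qed

lemma eval4_one: "eval4 1 P = 1"
  using eval4_cst[of 1 P] by (simp add: cst_def)

lemma eval4_numeral: "eval4 (numeral n) P = numeral n"
  using eval4_cst[of "numeral n" P] by (simp add: cst_def)

lemma eval4_minus: "eval4 (- p) P = - eval4 p P"
  using eval4_add[of p "- p" P] by (simp add: eq_neg_iff_add_eq_0 add.commute)

lemma eval4_diff: "eval4 (p - q) P = eval4 p P - eval4 q P"
  using eval4_add[of p "- q" P] by (simp add: eval4_minus)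

lemma eval4_power: "eval4 (p ^ n) P = eval4 p P ^ n"
  by (induction n) (simp_all add: eval4_one eval4_mult)

lemma eval4_sum: "eval4 (\<Sum>i\<in>S. f i) P = (\<Sum>i\<in>S. eval4 (f i) P)"
  by (induction S rule: infinite_finite_induct) (simp_all add: eval4_add)

lemmas eval4_simps = eval4_add eval4_diff eval4_minus eval4_mult eval4_power eval4_numeral eval4_one
  eval4_zero eval4_cst eval4_pvar

definition swap_point :: "'f ^ 4 \<Rightarrow> 'f ^ 4" where
  "swap_point P = (\<chi> i. P $ swap_var i)"

lemma eval4_theta: "eval4 (theta p) P = eval4 p (swap_point P)"
proof (induction p rule: poly_mapping_add_single_induct)
  case zero
  show ?case by (simp add: theta_def map_key_zero inj_map_key_swap_var)
next
  case (add p m c)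
  have "theta (p + Poly_Mapping.single m c) = theta p + theta (Poly_Mapping.single m c)"
    by (simp add: theta_def map_key_plus inj_map_key_swap_var)
  moreover have "(\<Prod>i\<in>UNIV. (P $ i) ^ Poly_Mapping.lookup (Poly_Mapping.map_key swap_var m) i)
      = (\<Prod>i\<in>UNIV. (P $ swap_var i) ^ Poly_Mapping.lookup m i)"
    by (rule prod.reindex_bij_witness[of _ swap_var swap_var])
       (simp_all add: map_key.rep_eq inj_swap_var)
  ultimately show ?case
    using add.IH by (simp add: eval4_add theta_monomial eval4_single swap_point_def)
qed

lemma cst_mult: "cst (c * d) = cst c * cst d"
  and cst_diff: "cst (c - d) = cst c - cst d"
  and cst_one: "cst 1 = 1"
  and cst_minus: "cst (- c) = - cst c"
  and cst_numeral: "cst (numeral n) = numeral n"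
  by (simp_all add: cst_def mult_single single_add single_diff single_uminus)

lemma cst_power: "cst (c ^ n) = cst c ^ n"
  by (induction n) (simp_all add: cst_one cst_mult)


section \<open>Evaluation of the formal module in an algebra\<close>

context monster_pair
begin

sublocale mp: monster_polynomials \<alpha> \<beta> .

definition point :: "'f ^ 4" where
  "point = (\<chi> i. if i = 1 then x else if i = 2 then y else if i = 3 then z else t)"

lemma point_simps: "point $ 1 = x" "point $ 2 = y" "point $ 3 = z" "point $ 4 = t"
  by (simp_all add: point_def)

definition bvec :: "bas \<Rightarrow> 'w" where
  "bvec i = (case i of Em2 \<Rightarrow> am2 | Em1 \<Rightarrow> am1 | E0 \<Rightarrow> a0 | E1 \<Rightarrow> a1 | E2 \<Rightarrow> a2
     | S1 \<Rightarrow> s1 | S2 \<Rightarrow> s2 | S2' \<Rightarrow> s2')"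

definition ev :: "'f fmod \<Rightarrow> 'w" where
  "ev m = (\<Sum>i\<in>UNIV. eval4 (m $ i) point \<cdot> bvec i)"

lemma ev_add: "ev (m + n) = ev m + ev n"
  by (simp add: ev_def eval4_add scale_left_distrib sum.distrib)

lemma ev_smult: "ev (p *s m) = eval4 p point \<cdot> ev m"
  by (simp add: ev_def eval4_mult scale_sum_right)

lemma ev_minus: "ev (- m) = - ev m"
  by (simp add: ev_def eval4_minus sum_negf)

lemma ev_diff: "ev (m - n) = ev m - ev n"
  using ev_add[of m "- n"] by (simp add: ev_minus)

lemma ev_zero: "ev 0 = 0"
  by (simp add: ev_def)

lemma ev_sum: "ev (\<Sum>i\<in>S. f i) = (\<Sum>i\<in>S. ev (f i))"
  by (induction S rule: infinite_finite_induct) (simp_all add: ev_add ev_zero)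

lemma ev_axis: "ev (axis i 1) = bvec i"
proof -
  have "ev (axis i 1) = (\<Sum>j\<in>UNIV. if j = i then bvec j else 0)"
    unfolding ev_def by (intro sum.cong) (auto simp: axis_def eval4_one)
  then show ?thesis by simp
qed

lemmas ev_simps = ev_add ev_smult ev_minus ev_diff ev_axis

lemma ev_e: "ev (mp.e 0) = a0" "ev (mp.e 1) = a1" "ev (mp.e 2) = a2" "ev (mp.e (-1)) = am1"
    "ev (mp.e (-2)) = am2"
  and ev_sig: "ev mp.sig1 = s1" "ev mp.sig2 = s2" "ev mp.sig2' = s2'"
  by (simp_all add: mp.e_def mp.sig1_def mp.sig2_def mp.sig2'_def ev_axis bvec_def)

lemma ev_lin_ext:
  assumes "\<And>i. ev (f i) = g (bvec i)"
    and "\<And>u v. g (u + v) = g u + g v" "\<And>c v. g (c \<cdot> v) = c \<cdot> g v"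
  shows "ev (lin_ext f m) = g (ev m)"
proof -
  have g0: "g 0 = 0" using assms(3)[of 0 0] by simp
  have "g (\<Sum>i\<in>S. h i) = (\<Sum>i\<in>S. g (h i))" for S :: "bas set" and h
    by (induction S rule: infinite_finite_induct) (simp_all add: assms(2) g0)
  then show ?thesis
    by (simp add: lin_ext_def ev_sum ev_smult assms(1,3)) (simp add: ev_def assms(3))
qed

lemma flip_point: "monster_pair.point scale mul \<alpha> \<beta> a1 a0 = swap_point point"
proof -
  interpret f: monster_pair scale mul \<alpha> \<beta> a1 a0 by (rule flip)
  show ?thesis
    unfolding vec_eq_iff forall_4
    by (simp add: f.point_simps point_simps swap_point_def swap_var_def flip_simps)
qed

lemma eval4_theta_flip: "eval4 (theta p) point = eval4 p (monster_pair.point scale mul \<alpha> \<beta> a1 a0)"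
  by (simp add: eval4_theta flip_point)

lemma K_nonzero: "mp.K \<noteq> 0"
  using \<alpha>_neq by (simp add: mp.K_def)

lemma ev_e3: "ev mp.e3 = a3"
proof -
  have "mp.K \<cdot> (a3 - am2) = ev mp.c"
    unfolding mp.K_def a3_eq mp.c_def mp.A_def mp.B_def
    by (simp add: ev_simps ev_e ev_sig eval4_simps eval4_theta_flip flip_simps
        point_simps monster_pair.point_simps[OF flip] swap_var_def)
  then have "ev mp.c = mp.K \<cdot> (a3 - am2)" by simp
  then show ?thesis using K_nonzero
    by (simp add: mp.e3_def ev_simps ev_e eval4_cst)
qed

lemma ev_T0: "ev (mp.T0 m) = tau a0 (ev m)"
  unfolding mp.T0_def
proof (rule ev_lin_ext)
  fix i
  have "tau a0 s2' = s2'"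
    by (simp add: s2'_def sigma_def tau_add tau_diff tau_scale tau_mul axis0 tau0_simps mul_commute add.commute)
  then show "ev (case i of Em2 \<Rightarrow> mp.e 2 | Em1 \<Rightarrow> mp.e 1 | E0 \<Rightarrow> mp.e 0 | E1 \<Rightarrow> mp.e (-1)
     | E2 \<Rightarrow> mp.e (-2) | S1 \<Rightarrow> mp.sig1 | S2 \<Rightarrow> mp.sig2 | S2' \<Rightarrow> mp.sig2') = tau a0 (bvec i)"
    by (cases i) (simp_all add: ev_e ev_sig bvec_def tau0_simps)
qed (simp_all add: tau_add tau_scale axis0)

text \<open>
  The semilinear map \<open>F\<close> is the exchange of the axes: \<open>\<theta>\<close> exchanges the coordinates of the
  point, and \<open>F\<close> sends each basis symbol to one for its mirror image, where \<open>a3_eq\<close>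
  accounts for the image of \<open>e\<^sub>-\<^sub>2\<close>.
\<close>

lemma ev_F: "ev (mp.F m) = monster_pair.ev scale mul \<alpha> \<beta> a1 a0 m"
proof -
  interpret f: monster_pair scale mul \<alpha> \<beta> a1 a0 by (rule flip)
  have "ev (case i of Em2 \<Rightarrow> mp.e3 | Em1 \<Rightarrow> mp.e 2 | E0 \<Rightarrow> mp.e 1 | E1 \<Rightarrow> mp.e 0 | E2 \<Rightarrow> mp.e (-1)
     | S1 \<Rightarrow> mp.sig1 | S2 \<Rightarrow> mp.sig2' | S2' \<Rightarrow> mp.sig2) = f.bvec i" for i
    by (cases i) (simp_all add: ev_e ev_e3 ev_sig f.bvec_def flip_simps)
  then show ?thesis
    by (simp add: mp.F_def semilin_ext_def ev_sum ev_smult eval4_theta_flip f.ev_def)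
qed

lemma ev_T1: "ev (mp.T1 m) = tau a1 (ev m)"
  by (simp add: mp.T1_def ev_F monster_pair.ev_T0[OF flip] monster_pair.ev_F[OF flip])

lemma ev_e4: "ev mp.e4 = a4"
  by (simp add: mp.e4_def ev_T1 ev_e a4_def)

lemma ev_L0: "ev (mp.L0 m) = a0 \<star> ev m"
  unfolding mp.L0_def
proof (rule ev_lin_ext)
  fix i
  have D: "\<alpha> - 2 * \<beta> \<noteq> 0" using \<alpha>_neq by simp
  define k where "k = 2 * (\<alpha> - 2 * \<beta>) * (\<alpha> - \<beta>)"
  have "\<alpha> - \<beta> \<noteq> 0" by simp
  then have k: "k \<noteq> 0" using D two_nonzero unfolding k_def by (simp only: mult_eq_0_iff) blast
  have half: "1 / 2 = half" by (simp add: half_def)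
  have a0: "a0 \<star> a1 = s1 + \<beta> \<cdot> (a0 + a1)" "a0 \<star> am1 = s1 + \<beta> \<cdot> (a0 + am1)"
    "a0 \<star> a2 = s2 + \<beta> \<cdot> (a0 + a2)" "a0 \<star> am2 = s2 + \<beta> \<cdot> (a0 + am2)"
    by (simp_all add: mul_eq_sigma[of a0] s1_def s2_def am1_def am2_def sigma_tau axis0)
  have s2': "ev mp.L0_sig2' = a0 \<star> s2'"
  proof -
    have "k \<cdot> ev mp.L0_sig2' = k \<cdot> (a0 \<star> s2')"
    proof (rule vec_eqI)
      fix \<phi> assume \<phi>: "functional \<phi>"
      define d h where "d = inverse (\<alpha> - 2 * \<beta>)" and "h = inverse (\<alpha> - \<beta>)"
      have dh: "d * (\<alpha> - 2 * \<beta>) = 1" "h * (\<alpha> - \<beta>) = 1" using D by (simp_all add: d_def h_def)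
      show "\<phi> (k \<cdot> ev mp.L0_sig2') = \<phi> (k \<cdot> (a0 \<star> s2'))"
        unfolding k_def mul_a0_s2' mp.L0_sig2'_def
        apply (simp only: ev_simps ev_e ev_sig eval4_simps point_simps half functional_simps[OF \<phi>]
            d_def[symmetric] h_def[symmetric])
        using dh two_half by Groebner_Basis.algebra
    qed
    then show ?thesis using k by simp
  qed
  show "ev (case i of Em2 \<Rightarrow> mp.sig2 + mp.b *s (mp.e 0 + mp.e (-2))
     | Em1 \<Rightarrow> mp.sig1 + mp.b *s (mp.e 0 + mp.e (-1)) | E0 \<Rightarrow> mp.e 0
     | E1 \<Rightarrow> mp.sig1 + mp.b *s (mp.e 0 + mp.e 1) | E2 \<Rightarrow> mp.sig2 + mp.b *s (mp.e 0 + mp.e 2)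
     | S1 \<Rightarrow> mp.L0_sig 1 | S2 \<Rightarrow> mp.L0_sig 2 | S2' \<Rightarrow> mp.L0_sig2') = a0 \<star> bvec i"
    by (cases i)
       (simp_all add: ev_simps ev_e ev_sig eval4_simps point_simps bvec_def s2' mul_a0_s1 mul_a0_s2
         mp.L0_sig_def mp.sig_def mp.lam_def half axis_idem axis0 a0)
qed (simp_all add: mul_simps)

lemma eval4_Lambda: "eval4 (mp.Lambda m) point = lam a0 (ev m)"
proof -
  note \<lambda> = functional_lam[OF axis0]
  have s2': "lam a0 s2' = 2 * (\<alpha> - 1) / (\<alpha> - \<beta>) * x^2 - 2 * (\<alpha> - 1) / (\<alpha> - \<beta>) * x * y
      + (1 - 2 * \<beta>) * x + \<beta> * z - \<beta>"
  proof -
    have "(\<alpha> - \<beta>) * lam a0 s2' = (\<alpha> - \<beta>) * (2 * (\<alpha> - 1) / (\<alpha> - \<beta>) * x^2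
      - 2 * (\<alpha> - 1) / (\<alpha> - \<beta>) * x * y + (1 - 2 * \<beta>) * x + \<beta> * z - \<beta>)"
      unfolding lam0_s2' by (simp add: right_diff_distrib distrib_left)
    then show ?thesis by (simp only: mult_cancel_left) simp
  qed
  have "lam a0 (\<Sum>i\<in>S. h i) = (\<Sum>i\<in>S. lam a0 (h i))" for S :: "bas set" and h
    by (induction S rule: infinite_finite_induct) (simp_all add: functional_simps[OF \<lambda>])
  then have "lam a0 (ev m) = (\<Sum>i\<in>UNIV. eval4 (m $ i) point * lam a0 (bvec i))"
    by (simp add: ev_def functional_scale[OF \<lambda>])
  moreover have "eval4 (case i of Em2 \<Rightarrow> mp.z | Em1 \<Rightarrow> mp.x | E0 \<Rightarrow> 1 | E1 \<Rightarrow> mp.x | E2 \<Rightarrow> mp.z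
     | S1 \<Rightarrow> mp.x - mp.b - mp.b * mp.x | S2 \<Rightarrow> mp.z - mp.b - mp.b * mp.z
     | S2' \<Rightarrow> cst (2 * (\<alpha> - 1) / (\<alpha> - \<beta>)) * mp.x^2 - cst (2 * (\<alpha> - 1) / (\<alpha> - \<beta>)) * mp.x * mp.y
              + (1 - 2 * mp.b) * mp.x + mp.b * mp.z - mp.b) point = lam a0 (bvec i)" for i
    by (cases i) (simp_all add: eval4_simps point_simps bvec_def lam0_simps s2')
  ultimately show ?thesis
    by (simp add: mp.Lambda_def eval4_sum eval4_mult)
qed

text \<open>
  As for the formal vectors, the index is meant to lie between \<open>-2\<close> and \<open>2\<close>.
\<close>

definition e_vec :: "int \<Rightarrow> 'w" where
  "e_vec k = (if k = -2 then am2 else if k = -1 then am1 else if k = 0 then a0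
              else if k = 1 then a1 else a2)"

lemma ev_e_vec: "ev (mp.e k) = e_vec k"
  by (simp add: mp.e_def e_vec_def ev_axis bvec_def)

lemma ev_s03: "ev mp.s03 = a0 \<star> a3 - \<beta> \<cdot> (a0 + a3)"
  by (simp add: mp.s03_def ev_simps ev_L0 ev_e3 ev_e eval4_cst)

lemma tau1_simps: "tau a1 a1 = a1" "tau a1 a0 = a2" "tau a1 a2 = a0" "tau a1 am1 = a3"
  "tau a1 a3 = am1" "tau a1 am2 = a4" "tau a1 a4 = am2" "tau a1 s1 = s1" "tau a1 s2' = s2'"
  by (simp_all add: tau_self tau_tau tau_sigma axis1 a2_def a3_def a4_def s1_flip s2'_def)

lemma tau_more: "tau a0 s2' = s2'" "tau a1 s2 = s2"
  by (simp_all add: s2'_def s2_def sigma_def tau_add tau_diff tau_scale tau_mul axis0 axis1 tau0_simps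
      tau1_simps mul_commute add.commute)

lemma ev_s13: "ev mp.s13 = a1 \<star> am2 - \<beta> \<cdot> (a1 + am2)"
  by (simp add: mp.s13_def ev_F monster_pair.ev_s03[OF flip] flip_simps)

lemma ev_s23: "ev mp.s23 = a2 \<star> am1 - \<beta> \<cdot> (a2 + am1)"
  by (simp add: mp.s23_def ev_T1 ev_s03 tau_add tau_diff tau_scale tau_mul axis1 tau1_simps)

lemma ev_s24: "ev mp.s24 = a2 \<star> am2 - \<beta> \<cdot> (a2 + am2)"
  by (simp add: mp.s24_def ev_T1 ev_simps ev_L0 ev_e4 ev_e eval4_cst tau_add tau_diff tau_scale
      tau_mul axis1 tau1_simps)

lemma e_idem: "am2 \<star> am2 = am2" "am1 \<star> am1 = am1" "a0 \<star> a0 = a0" "a1 \<star> a1 = a1" "a2 \<star> a2 = a2"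
  "a3 \<star> a3 = a3" "a4 \<star> a4 = a4"
proof -
  show 0: "a0 \<star> a0 = a0" "a1 \<star> a1 = a1" by (simp_all add: axis_idem axis0 axis1)
  show 2: "a2 \<star> a2 = a2" "am1 \<star> am1 = am1"
    using arg_cong[OF 0(1), of "tau a1"] arg_cong[OF 0(2), of "tau a0"]
    by (simp_all add: tau_mul axis0 axis1 tau0_simps tau1_simps)
  show 3: "am2 \<star> am2 = am2" "a3 \<star> a3 = a3"
    using arg_cong[OF 2(1), of "tau a0"] arg_cong[OF 2(2), of "tau a1"]
    by (simp_all add: tau_mul axis0 axis1 tau0_simps tau1_simps)
  show "a4 \<star> a4 = a4"
    using arg_cong[OF 3(1), of "tau a1"] by (simp add: tau_mul axis1 tau1_simps)
qed

lemma sigma_tau_pair: "monster_axis a \<Longrightarrow> tau a (sigma u v) = sigma (tau a u) (tau a v)"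
  by (simp add: sigma_def tau_add tau_diff tau_scale tau_mul)

lemma sigma_values: "sigma a0 a1 = s1" "sigma am1 a0 = s1" "sigma a1 a2 = s1" "sigma am2 am1 = s1"
  "sigma a0 a2 = s2" "sigma am2 a0 = s2" "sigma am1 a1 = s2'"
proof -
  show 1: "sigma a0 a1 = s1" and 2: "sigma a0 a2 = s2" by (simp_all add: s1_def s2_def)
  show "sigma am1 a1 = s2'" by (simp add: s2'_def sigma_commute)
  show 3: "sigma am1 a0 = s1" "sigma am2 a0 = s2"
    using arg_cong[OF 1, of "tau a0"] arg_cong[OF 2, of "tau a0"]
    by (simp_all add: sigma_tau_pair axis0 tau0_simps sigma_commute)
  show 4: "sigma a1 a2 = s1"
    using arg_cong[OF 1, of "tau a1"] by (simp add: sigma_tau_pair axis1 tau1_simps sigma_commute)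
  show "sigma am2 am1 = s1"
    using arg_cong[OF 4, of "tau a0"] by (simp add: sigma_tau_pair axis0 tau0_simps sigma_commute)
qed

lemma ev_ee_prod:
  assumes "k \<in> {-2..2}" "l \<in> {-2..2}"
  shows "ev (mp.ee_prod k l) = e_vec k \<star> e_vec l"
proof -
  have *: "ev (mp.ee_prod k l) = e_vec k \<star> e_vec l" if "k < l" "k \<in> {-2..2}" "l \<in> {-2..2}" for k l
  proof -
    have "k \<in> {-2,-1,0,1,2}" "l \<in> {-2,-1,0,1,2}" using that by auto
    then show ?thesis using that(1)
      apply (elim insertE emptyE)
      apply (simp_all add: mp.ee_prod_def Let_def ev_simps ev_e_vec ev_sig ev_s13 ev_s23 ev_s24 eval4_cst)
      apply (simp_all add: e_vec_def e_idem mul_eq_sigma sigma_values)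
      apply (simp_all add: sigma_def mul_commute add.commute)
      done
  qed
  consider "k < l" | "k = l" | "l < k" by linarith
  then show ?thesis
  proof cases
    case 1
    then show ?thesis using * assms by blast
  next
    case 2
    then show ?thesis by (simp add: mp.ee_prod_def ev_e_vec) (simp add: e_vec_def e_idem)
  next
    case 3
    then have "mp.ee_prod k l = mp.ee_prod l k" by (simp add: mp.ee_prod_def min.commute max.commute)
    then show ?thesis using *[of l k] 3 assms by (simp add: mul_commute)
  qed
qed

text \<open>
  The axes \<open>a\<^sub>-\<^sub>1, a\<^bsub>\<plusminus>2\<^esub>\<close> are images of \<open>a\<^sub>0, a\<^sub>1\<close> under the two involutions, which
  fix the vectors \<open>\<sigma>\<close>.
\<close>

lemma ev_es_prod:
  assumes "k \<in> {-2..2}" "tau a0 (ev m) = ev m" "tau a1 (ev m) = ev m"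
  shows "ev (mp.es_prod k m) = e_vec k \<star> ev m"
proof -
  have "k \<in> {-2,-1,0,1,2}" using assms(1) by auto
  then show ?thesis
    apply (elim insertE emptyE)
    apply (simp_all add: mp.es_prod_def ev_T1 ev_T0 ev_L0 ev_F monster_pair.ev_L0[OF flip]
        monster_pair.ev_F[OF flip] tau_mul axis0 axis1 tau0_simps tau1_simps assms e_vec_def)
    done
qed

lemma ev_bas_prod:
  assumes "mp.e_index i \<noteq> None \<or> mp.e_index j \<noteq> None"
  shows "ev (mp.bas_prod S i j) = bvec i \<star> bvec j"
proof -
  have e: "bvec i = e_vec k \<and> k \<in> {-2..2}" if "mp.e_index i = Some k" for i k
    using that by (cases i) (auto simp: mp.e_index_def bvec_def e_vec_def)
  have s: "tau a0 (bvec i) = bvec i \<and> tau a1 (bvec i) = bvec i" if "mp.e_index i = None" for i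
    using that by (cases i) (auto simp: mp.e_index_def bvec_def tau0_simps tau1_simps tau_more)
  show ?thesis
  proof (cases "mp.e_index i")
    case None
    then obtain l where "mp.e_index j = Some l" using assms by auto
    with None e[OF this] s[OF None] show ?thesis
      by (simp add: mp.bas_prod_def ev_es_prod ev_axis mul_commute)
  next
    case (Some k)
    show ?thesis
    proof (cases "mp.e_index j")
      case None
      with Some e[OF Some] s[OF None] show ?thesis by (simp add: mp.bas_prod_def ev_es_prod ev_axis)
    next
      case (Some l)
      with \<open>mp.e_index i = Some k\<close> e[OF Some] e[of i k] show ?thesis
        by (simp add: mp.bas_prod_def ev_ee_prod)
    qed
  qed
qed

lemma ev_mul_expand:
  "ev (mp.mul S m n) =
    (\<Sum>i\<in>UNIV. \<Sum>j\<in>UNIV. (eval4 (m $ i) point * eval4 (n $ j) point) \<cdot> ev (mp.bas_prod S i j))"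
  by (simp add: mp.mul_def ev_sum ev_smult eval4_mult)

lemma mul_ev_expand:
  "ev m \<star> ev n =
    (\<Sum>i\<in>UNIV. \<Sum>j\<in>UNIV. (eval4 (m $ i) point * eval4 (n $ j) point) \<cdot> (bvec i \<star> bvec j))"
proof -
  have L: "(\<Sum>i\<in>A. f i) \<star> v = (\<Sum>i\<in>A. f i \<star> v)" for A :: "bas set" and f v
    by (induction A rule: infinite_finite_induct) (simp_all add: mul_add_left)
  have R: "v \<star> (\<Sum>i\<in>A. f i) = (\<Sum>i\<in>A. v \<star> f i)" for A :: "bas set" and f v
    by (simp add: mul_commute[of v] L)
  show ?thesis
    unfolding ev_def unfolding L unfolding R by (simp add: mul_scale_left mul_scale_right mult.commute)
qed

lemma ev_mul:
  assumes "\<And>i j. m $ i = 0 \<or> n $ j = 0 \<or> ev (mp.bas_prod S i j) = bvec i \<star> bvec j"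
  shows "ev (mp.mul S m n) = ev m \<star> ev n"
proof -
  have "(eval4 (m $ i) point * eval4 (n $ j) point) \<cdot> ev (mp.bas_prod S i j)
      = (eval4 (m $ i) point * eval4 (n $ j) point) \<cdot> (bvec i \<star> bvec j)" for i j
    using assms[of i j] by auto
  then show ?thesis unfolding ev_mul_expand mul_ev_expand by (intro sum.cong refl)
qed

text \<open>
  A factor without \<open>\<sigma>\<close>-coordinates never consults the table of products of two \<open>\<sigma>\<close>'s.
\<close>

lemma ev_mul_left_e:
  assumes "m $ S1 = 0" "m $ S2 = 0" "m $ S2' = 0"
  shows "ev (mp.mul S m n) = ev m \<star> ev n" and "ev (mp.mul S n m) = ev n \<star> ev m"
proof -
  have "m $ i = 0 \<or> mp.e_index i \<noteq> None" for i
    using assms by (cases i) (auto simp: mp.e_index_def)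
  then show "ev (mp.mul S m n) = ev m \<star> ev n" "ev (mp.mul S n m) = ev n \<star> ev m"
    by (metis ev_mul ev_bas_prod)+
qed

lemma ev_sig_prod:
  assumes "i \<in> {1, 2}" "j \<in> {1, 2}"
  shows "ev (mp.sig_prod i j) = ev (mp.sig i) \<star> ev (mp.sig j)"
proof -
  define ai where "ai k = (if k = (1::int) then a1 else a2)" for k
  have half: "1 / 2 = half" by (simp add: half_def)
  have lam: "eval4 (mp.lam k) point = lam a0 (ai k)" if "k \<in> {1, 2}" for k
    using that by (auto simp: mp.lam_def ai_def eval4_pvar point_simps x_def z_def)
  have evs: "ev (mp.e k) = ai k \<and> ev (mp.e (-k)) = tau a0 (ai k) \<and> ev (mp.sig k) = sigma a0 (ai k)"
    if "k \<in> {1, 2}" for k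
    using that by (auto simp: ai_def mp.sig_def ev_e ev_sig tau0_simps s1_def s2_def)
  have X: "ev (mp.Xv k) = zero_part a0 (ai k) + sigma a0 (ai k)" if "k \<in> {1, 2}" for k
    using evs[OF that] lam[OF that]
    by (simp add: mp.Xv_def ev_simps ev_e eval4_simps zero_part_def half)
  have Y: "ev (mp.Yv k) = alpha_part a0 (ai k) - sigma a0 (ai k)" if "k \<in> {1, 2}" for k
    using evs[OF that] lam[OF that]
    by (simp add: mp.Yv_def ev_simps ev_e eval4_simps alpha_part_def half)
  define H where "H = mp.half *s (mp.e j + mp.e (-j)) - mp.lam j *s mp.e 0"
  have H: "ev H = half \<cdot> (ai j + tau a0 (ai j)) - lam a0 (ai j) \<cdot> a0"
    using evs[OF assms(2)] lam[OF assms(2)] by (simp add: H_def ev_simps ev_e eval4_simps half)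
  have z: "mp.e k $ S1 = 0" "mp.e k $ S2 = 0" "mp.e k $ S2' = 0" for k
    by (simp_all add: mp.e_def axis_def)
  have zX: "mp.Xv k $ S1 = 0" "mp.Xv k $ S2 = 0" "mp.Xv k $ S2' = 0"
    "mp.Yv k $ S1 = 0" "mp.Yv k $ S2 = 0" "mp.Yv k $ S2' = 0" for k
    by (simp_all add: mp.Xv_def mp.Yv_def z)
  have zH: "H $ S1 = 0" "H $ S2 = 0" "H $ S2' = 0" by (simp_all add: H_def z)
  show ?thesis
    unfolding mp.sig_prod_def Let_def H_def[symmetric]
    by (simp only: ev_simps ev_L0 ev_mul_left_e(2)[OF zH] ev_mul_left_e(1)[OF zX(1-3)]
        ev_mul_left_e(2)[OF zX(4-6)] H X[OF assms(1)] Y[OF assms(2)] evs[OF assms(1)] evs[OF assms(2)]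
        mul_sigma_sigma[OF axis0, of "ai i" "ai j"] add_diff_cancel_right')
qed

lemma ev_sig_table:
  "ev (mp.bas_prod (mp.sig_table w) i j) =
     (if i = S2 \<and> j = S2' \<or> i = S2' \<and> j = S2 then ev w else bvec i \<star> bvec j)"
proof (cases "mp.e_index i \<noteq> None \<or> mp.e_index j \<noteq> None")
  case True
  then show ?thesis by (auto simp: ev_bas_prod) (auto simp: mp.e_index_def)
next
  case False
  interpret f: monster_pair scale mul \<alpha> \<beta> a1 a0 by (rule flip)
  have p: "ev (mp.sig_prod 1 1) = s1 \<star> s1" "ev (mp.sig_prod 1 2) = s1 \<star> s2" "ev (mp.sig_prod 2 2) = s2 \<star> s2"
    by (simp_all add: ev_sig_prod mp.sig_def ev_sig)
  have q: "ev (mp.F (mp.sig_prod 1 2)) = s1 \<star> s2'" "ev (mp.F (mp.sig_prod 2 2)) = s2' \<star> s2'"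
    by (simp_all add: ev_F f.ev_sig_prod mp.sig_def f.ev_sig flip_simps)
  show ?thesis
    using False p q
    by (cases i; cases j)
       (simp_all add: mp.bas_prod_def mp.e_index_def mp.sig_table_def bvec_def mul_commute doubleton_eq_iff)
qed

lemma mul_sig_table:
  "mp.mul (mp.sig_table w) m n = mp.mul (mp.sig_table 0) m n + (m $ S2 * n $ S2' + m $ S2' * n $ S2) *s w"
proof -
  have b: "mp.bas_prod (mp.sig_table w) i j = mp.bas_prod (mp.sig_table 0) i j
     + (if i = S2 \<and> j = S2' \<or> i = S2' \<and> j = S2 then w else 0)" for i j
    by (cases i; cases j) (simp_all add: mp.bas_prod_def mp.e_index_def mp.sig_table_def doubleton_eq_iff)
  have "(\<Sum>i\<in>UNIV. \<Sum>j\<in>UNIV. (m $ i * n $ j) *s (if i = S2 \<and> j = S2' \<or> i = S2' \<and> j = S2 then w else 0))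
     = (m $ S2 * n $ S2' + m $ S2' * n $ S2) *s w"
    by (simp add: UNIV_bas vector_sadd_rdistrib)
  then show ?thesis
    unfolding mp.mul_def b vector_add_ldistrib sum.distrib by simp
qed

text \<open>
  The coefficient \<open>-32 / (\<alpha> - 4 \<beta>)\<^sup>2\<close> of \<open>\<sigma>\<^sub>2 \<sigma>\<^sub>2'\<close> in the expansion of \<open>e\<^sub>3 e\<^sub>3\<close>.
\<close>

definition "\<kappa> = - 2 * (inverse mp.K * (4 * \<beta> * (\<alpha> - \<beta>)^2))^2"

lemma \<kappa>_nonzero: "\<kappa> \<noteq> 0"
  using K_nonzero two_nonzero four_nonzero by (simp add: \<kappa>_def)

lemma e3_coefficient: "mp.e3 $ S2 * mp.e3 $ S2' + mp.e3 $ S2' * mp.e3 $ S2 = cst \<kappa>"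
proof -
  have "mp.e3 $ S2 = - cst (inverse mp.K * (4 * \<beta> * (\<alpha> - \<beta>)^2))"
    "mp.e3 $ S2' = cst (inverse mp.K * (4 * \<beta> * (\<alpha> - \<beta>)^2))"
    by (simp_all add: mp.e3_def mp.c_def mp.e_def mp.sig1_def mp.sig2_def mp.sig2'_def axis_def
        cst_mult cst_power cst_diff cst_numeral)
  then show ?thesis
    by (simp add: \<kappa>_def cst_mult cst_minus cst_numeral cst_power power2_eq_square)
qed

text \<open>
  The condition \<open>e\<^sub>3 e\<^sub>3 = e\<^sub>3\<close> is affine in the unknown product, with invertible coefficient \<open>\<kappa>\<close>.
\<close>

lemma sig2_sig2'_eq:
  "mp.sig2_sig2' = cst (inverse \<kappa>) *s (mp.e3 - mp.mul (mp.sig_table 0) mp.e3 mp.e3)"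
  unfolding mp.sig2_sig2'_def
proof (rule the_equality)
  have k: "cst (inverse \<kappa>) * cst \<kappa> = 1" "cst \<kappa> * cst (inverse \<kappa>) = 1"
    using \<kappa>_nonzero by (simp_all add: cst_mult[symmetric] cst_one)
  show "mp.mul (mp.sig_table (cst (inverse \<kappa>) *s (mp.e3 - mp.mul (mp.sig_table 0) mp.e3 mp.e3))) mp.e3 mp.e3 = mp.e3"
    by (subst mul_sig_table) (simp add: e3_coefficient k vector_smult_assoc)
  show "w = cst (inverse \<kappa>) *s (mp.e3 - mp.mul (mp.sig_table 0) mp.e3 mp.e3)"
    if "mp.mul (mp.sig_table w) mp.e3 mp.e3 = mp.e3" for w
  proof -
    have kw: "cst \<kappa> *s w = mp.e3 - mp.mul (mp.sig_table 0) mp.e3 mp.e3"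
      using that[unfolded mul_sig_table[of w] e3_coefficient] by (simp add: algebra_simps)
    have "w = (cst (inverse \<kappa>) * cst \<kappa>) *s w" by (simp add: k)
    then show ?thesis by (simp only: kw[symmetric] vector_smult_assoc)
  qed
qed

text \<open>
  The vector \<open>a\<^sub>3\<close> is idempotent, so the actual product solves the same affine equation.
\<close>

lemma ev_sig2_sig2': "ev mp.sig2_sig2' = s2 \<star> s2'"
proof -
  have "ev (mp.mul (mp.sig_table 0) m n)
      + eval4 (m $ S2 * n $ S2' + m $ S2' * n $ S2) point \<cdot> (s2 \<star> s2') = ev m \<star> ev n" for m n
    unfolding ev_mul_expand mul_ev_expand ev_sig_table
    by (simp add: UNIV_bas ev_zero eval4_simps scale_left_distrib bvec_def mul_commute[of s2' s2] add_ac)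
  from this[of mp.e3 mp.e3]
  have "ev (mp.mul (mp.sig_table 0) mp.e3 mp.e3) + \<kappa> \<cdot> (s2 \<star> s2') = a3"
    by (simp only: e3_coefficient eval4_cst ev_e3 e_idem)
  then have "ev (mp.e3 - mp.mul (mp.sig_table 0) mp.e3 mp.e3) = \<kappa> \<cdot> (s2 \<star> s2')"
    by (simp add: ev_simps ev_e3 algebra_simps)
  then show ?thesis
    using \<kappa>_nonzero by (simp add: sig2_sig2'_eq ev_smult eval4_cst)
qed

lemma ev_prod_M: "ev (mp.prod_M m n) = ev m \<star> ev n"
  unfolding mp.prod_M_def
  by (rule ev_mul) (auto simp: ev_sig_table ev_sig2_sig2' bvec_def mul_commute)

text \<open>
  Both terms evaluate to \<open>a\<^sub>-\<^sub>1 a\<^sub>2 - \<beta> (a\<^sub>-\<^sub>1 + a\<^sub>2)\<close>, and exchanging the axes exchanges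
  \<open>a\<^sub>-\<^sub>1\<close> with \<open>a\<^sub>2\<close>.
\<close>

lemma s23_symmetric: "ev (mp.s23 - mp.F mp.s23) = 0"
  by (simp add: ev_simps ev_s23 ev_F monster_pair.ev_s23[OF flip] flip_simps mul_commute add.commute)

lemma p1_vanishes: "eval4 mp.p1 point = 0"
  by (simp add: mp.p1_def eval4_Lambda s23_symmetric functional_zero functional_lam axis0)

lemma p2_vanishes: "eval4 mp.p2 point = 0"
  by (simp add: mp.p2_def eval4_Lambda ev_simps ev_prod_M ev_e4 e_idem functional_zero functional_lam axis0)

lemma point_in_Var: "point \<in> Var {mp.p1, mp.p2, mp.p3, mp.p4}"
proof -
  interpret f: monster_pair scale mul \<alpha> \<beta> a1 a0 by (rule flip)
  have "eval4 mp.p3 point = 0"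
    by (simp add: mp.p3_def eval4_theta_flip f.eval4_Lambda f.ev_F s23_symmetric functional_zero
        functional_lam axis1)
  moreover have "eval4 mp.p4 point = 0"
    by (simp add: mp.p4_def eval4_theta_flip f.p2_vanishes)
  ultimately show ?thesis by (simp add: Var_def p1_vanishes p2_vanishes)
qed

end

section \<open>Subalgebras as marked algebras\<close>

text \<open>
  A subalgebra \<open>U\<close> of a vector space that fills a type, transported along the injection \<open>g\<close> to
  a marked algebra with carrier \<open>g ` U\<close>.
\<close>

locale monster_subalgebra = monster_setting scale mul \<alpha> \<beta>
  for scale :: "'f::field \<Rightarrow> 'w::ab_group_add \<Rightarrow> 'w" (infixr "\<cdot>" 75)
    and mul :: "'w \<Rightarrow> 'w \<Rightarrow> 'w" (infixl "\<star>" 70)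
    and \<alpha> \<beta> :: 'f +
  fixes U :: "'w set" and g :: "'w \<Rightarrow> 'v" and a b :: 'w
  assumes U_zero: "0 \<in> U" and U_add: "u \<in> U \<Longrightarrow> v \<in> U \<Longrightarrow> u + v \<in> U"
    and U_scale: "u \<in> U \<Longrightarrow> c \<cdot> u \<in> U" and U_mul: "u \<in> U \<Longrightarrow> v \<in> U \<Longrightarrow> u \<star> v \<in> U"
    and inj_g: "inj_on g U" and a_in: "a \<in> U" and b_in: "b \<in> U"
begin

abbreviation "h \<equiv> inv_into U g"

definition image_algebra :: "('f, 'v) marked_algebra" where
  "image_algebra = \<lparr>carrier = g ` U, monoid.mult = (\<lambda>u v. g (h u \<star> h v)), one = g 0, zero = g 0,
        add = (\<lambda>u v. g (h u + h v)), module.smult = (\<lambda>c u. g (c \<cdot> h u)), gen0 = g a, gen1 = g b\<rparr>"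

lemma h_g: "u \<in> U \<Longrightarrow> h (g u) = u"
  by (rule inv_into_f_f[OF inj_g])

lemma image_algebra_simps:
  "carrier image_algebra = g ` U" "\<zero>\<^bsub>image_algebra\<^esub> = g 0" "gen0 image_algebra = g a" "gen1 image_algebra = g b"
  "u \<in> U \<Longrightarrow> v \<in> U \<Longrightarrow> g u \<otimes>\<^bsub>image_algebra\<^esub> g v = g (u \<star> v)"
  "u \<in> U \<Longrightarrow> v \<in> U \<Longrightarrow> g u \<oplus>\<^bsub>image_algebra\<^esub> g v = g (u + v)"
  "u \<in> U \<Longrightarrow> c \<odot>\<^bsub>image_algebra\<^esub> g u = g (c \<cdot> u)"
  by (simp_all add: image_algebra_def h_g)

lemma g_eq_iff: "u \<in> U \<Longrightarrow> v \<in> U \<Longrightarrow> g u = g v \<longleftrightarrow> u = v"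
  by (rule inj_on_eq_iff[OF inj_g])

lemma U_minus: "u \<in> U \<Longrightarrow> - u \<in> U"
  using U_scale[of u "-1"] by simp

lemma U_diff: "u \<in> U \<Longrightarrow> v \<in> U \<Longrightarrow> u - v \<in> U"
  using U_add[of u "- v"] U_minus by simp

lemma U_sum: "(\<And>i. i \<in> S \<Longrightarrow> f i \<in> U) \<Longrightarrow> (\<Sum>i\<in>S. f i) \<in> U"
  by (induction S rule: infinite_finite_induct) (auto simp: U_zero U_add)

lemma U_shift: "c \<in> U \<Longrightarrow> u \<in> U \<Longrightarrow> shift c l u \<in> U"
  by (simp add: shift_def U_diff U_mul U_scale)

lemma U_proj: "c \<in> U \<Longrightarrow> u \<in> U \<Longrightarrow> proj c l u \<in> U"
  by (simp add: proj_def lagrange_def U_shift U_scale U_minus)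

lemma comm_nonassoc_algebra_image_algebra: "comm_nonassoc_algebra image_algebra"
proof -
  interpret ab: abelian_group image_algebra
  proof (rule abelian_groupI)
    fix u assume "u \<in> carrier image_algebra"
    then obtain u' where "u = g u'" "u' \<in> U" by (auto simp: image_algebra_simps)
    then show "\<exists>v\<in>carrier image_algebra. v \<oplus>\<^bsub>image_algebra\<^esub> u = \<zero>\<^bsub>image_algebra\<^esub>"
      by (intro bexI[of _ "g (- u')"]) (auto simp: image_algebra_simps U_minus)
  qed (auto simp: image_algebra_simps U_add U_zero add_ac)
  interpret cr: cring "ring_of_type_algebra :: 'f ring" by (rule cring_from_type_algebra)
  show ?thesis
    by unfold_locales
       (auto simp: image_algebra_simps U_add U_scale U_mul ring_of_type_algebra_def scale_left_distrib
         scale_right_distrib mul_simps intro!: arg_cong[of _ _ g] mul_commute)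
qed

lemma finsum_image_algebra:
  assumes "finite N" "\<And>n. n \<in> N \<Longrightarrow> f n \<in> U"
  shows "(\<Oplus>\<^bsub>image_algebra\<^esub>n\<in>N. g (f n)) = g (\<Sum>n\<in>N. f n)"
proof -
  interpret comm_nonassoc_algebra image_algebra by (rule comm_nonassoc_algebra_image_algebra)
  show ?thesis using assms
  proof (induction N rule: finite_induct)
    case (insert n N)
    then have "(\<Oplus>\<^bsub>image_algebra\<^esub>n\<in>insert n N. g (f n)) = g (f n) \<oplus>\<^bsub>image_algebra\<^esub> (\<Oplus>\<^bsub>image_algebra\<^esub>n\<in>N. g (f n))"
      by (intro M.finsum_insert) (auto simp: image_algebra_simps)
    with insert show ?case by (simp add: image_algebra_simps U_sum)
  qed (simp add: image_algebra_simps)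
qed

lemma eigenspace_image_algebra:
  assumes "c \<in> U"
  shows "eigenspace image_algebra (g c) l = g ` {v \<in> U. c \<star> v = l \<cdot> v}"
  using assms by (auto simp: eigenspace_def image_algebra_simps g_eq_iff U_mul U_scale mul_commute[of _ c])

lemma monster_law_subset: "monster_law \<alpha> \<beta> l m \<subseteq> evals"
  by (auto simp: monster_law_def split: if_splits)

text \<open>
  The components of a vector are its spectral projections.  They lie in \<open>U\<close> and are the only
  eigenvectors with the given sum, since a projection applied to that sum returns its summand.
\<close>

lemma primitive_axis_image_algebra:
  assumes ax: "monster_axis_on U c" and c: "c \<in> U"
  shows "primitive_axis \<alpha> \<beta> image_algebra (g c)"
  unfolding primitive_axis_def
proof (intro conjI ballI)
  show "g c \<in> carrier image_algebra" "g c \<noteq> \<zero>\<^bsub>image_algebra\<^esub>" "g c \<otimes>\<^bsub>image_algebra\<^esub> g c = g c"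
    using c ax by (auto simp: image_algebra_simps g_eq_iff U_zero monster_axis_on_def)
  show "eigenspace image_algebra (g c) 1 = range (\<lambda>k. k \<odot>\<^bsub>image_algebra\<^esub> g c)"
  proof -
    have "{v \<in> U. c \<star> v = 1 \<cdot> v} = range (\<lambda>k. k \<cdot> c)"
    proof (intro equalityI subsetI)
      fix v assume "v \<in> {v \<in> U. c \<star> v = 1 \<cdot> v}"
      then have "v \<in> U" "c \<star> v = v" by simp_all
      then obtain k where "v = k \<cdot> c" using ax unfolding monster_axis_on_def by blast
      then show "v \<in> range (\<lambda>k. k \<cdot> c)" by blast
    next
      fix v assume "v \<in> range (\<lambda>k. k \<cdot> c)"
      moreover have "c \<star> c = c" using ax unfolding monster_axis_on_def by blast
      ultimately show "v \<in> {v \<in> U. c \<star> v = 1 \<cdot> v}"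
        using c by (auto simp: U_scale mul_scale_right)
    qed
    then show ?thesis using c by (simp add: eigenspace_image_algebra image_algebra_simps image_image)
  qed
  have eig: "g (proj c l v) \<in> eigenspace image_algebra (g c) l" if "v \<in> U" "l \<in> evals" for v l
    using mul_proj_on[OF ax that] that c by (simp add: eigenspace_image_algebra U_proj)
  fix w assume "w \<in> carrier image_algebra"
  then obtain v where v: "w = g v" "v \<in> U" by (auto simp: image_algebra_simps)
  show "\<exists>!f. f \<in> (\<Pi>\<^sub>E l\<in>evals. eigenspace image_algebra (g c) l) \<and> w = (\<Oplus>\<^bsub>image_algebra\<^esub>l\<in>evals. f l)"
  proof (rule ex1I)
    let ?f = "\<lambda>l\<in>evals. g (proj c l v)"
    have "(\<Oplus>\<^bsub>image_algebra\<^esub>l\<in>evals. ?f l) = (\<Oplus>\<^bsub>image_algebra\<^esub>l\<in>evals. g (proj c l v))"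
    proof -
      interpret comm_nonassoc_algebra image_algebra by (rule comm_nonassoc_algebra_image_algebra)
      show ?thesis using v c by (intro M.finsum_cong') (auto simp: image_algebra_simps U_proj)
    qed
    also have "\<dots> = g (\<Sum>l\<in>evals. proj c l v)"
      using v c by (intro finsum_image_algebra) (auto simp: U_proj)
    also have "(\<Sum>l\<in>evals. proj c l v) = v"
      using sum_proj[of c v] by (simp add: add_ac)
    finally show "?f \<in> (\<Pi>\<^sub>E l\<in>evals. eigenspace image_algebra (g c) l) \<and> w = (\<Oplus>\<^bsub>image_algebra\<^esub>l\<in>evals. ?f l)"
      using eig v by auto
    fix f assume f: "f \<in> (\<Pi>\<^sub>E l\<in>evals. eigenspace image_algebra (g c) l) \<and> w = (\<Oplus>\<^bsub>image_algebra\<^esub>l\<in>evals. f l)"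
    define f' where "f' l = h (f l)" for l
    have f': "f' l \<in> U" "c \<star> f' l = l \<cdot> f' l" "f l = g (f' l)" if "l \<in> evals" for l
    proof -
      have "f l \<in> g ` {v \<in> U. c \<star> v = l \<cdot> v}" using f that eigenspace_image_algebra[OF c, of l] by blast
      then show "f' l \<in> U" "c \<star> f' l = l \<cdot> f' l" "f l = g (f' l)" by (auto simp: f'_def h_g)
    qed
    have "w = (\<Oplus>\<^bsub>image_algebra\<^esub>l\<in>evals. g (f' l))"
    proof -
      interpret comm_nonassoc_algebra image_algebra by (rule comm_nonassoc_algebra_image_algebra)
      have "(\<Oplus>\<^bsub>image_algebra\<^esub>l\<in>evals. f l) = (\<Oplus>\<^bsub>image_algebra\<^esub>l\<in>evals. g (f' l))"
        using f' by (intro M.finsum_cong') (auto simp: image_algebra_simps simp del: insert_iff)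
      then show ?thesis using f by simp
    qed
    then have "g v = g (\<Sum>l\<in>evals. f' l)" using v f' by (simp add: finsum_image_algebra del: insert_iff)
    then have "v = (\<Sum>l\<in>evals. f' l)" using v f' by (subst (asm) g_eq_iff) (auto intro!: U_sum simp del: insert_iff)
    then have v_sum: "v = f' 1 + f' 0 + f' \<alpha> + f' \<beta>" by (simp add: add_ac)
    have "proj c m v = f' m" if m: "m \<in> evals" for m
    proof -
      have "proj c m (f' l) = (if m = l then f' l else 0)" if "l \<in> evals" for l
        using f'(2)[OF that] that m by (rule proj_eigenvector)
      then show ?thesis using m by (auto simp: v_sum proj_add)
    qed
    then show "f = ?f"
      using f f'(3) by (intro ext) (auto simp: PiE_def extensional_def simp del: insert_iff)
  qed
next
  fix l m w w'
  assume l: "l \<in> evals" and m: "m \<in> evals"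
    and w: "w \<in> eigenspace image_algebra (g c) l" and w': "w' \<in> eigenspace image_algebra (g c) m"
  obtain u v where u: "w = g u" "u \<in> U" "c \<star> u = l \<cdot> u" and v: "w' = g v" "v \<in> U" "c \<star> v = m \<cdot> v"
    using w w' by (auto simp: eigenspace_image_algebra c)
  let ?N = "monster_law \<alpha> \<beta> l m" and ?p = "\<lambda>n. proj c n (u \<star> v)"
  have uv: "u \<star> v \<in> U" using u v U_mul by blast
  have z: "?p n = 0" if "n \<in> evals - ?N" for n
    using ax l m u v that unfolding monster_axis_on_def by blast
  have fin: "finite ?N" by (rule finite_subset[OF monster_law_subset]) simp
  have "u \<star> v = (\<Sum>n\<in>evals. ?p n)" using sum_proj[of c "u \<star> v"] by (simp add: add_ac)
  also have "\<dots> = (\<Sum>n\<in>?N. ?p n)"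
    using z monster_law_subset by (intro sum.mono_neutral_right) auto
  finally have "w \<otimes>\<^bsub>image_algebra\<^esub> w' = (\<Oplus>\<^bsub>image_algebra\<^esub>n\<in>?N. g (?p n))"
    using u v uv c fin by (simp add: image_algebra_simps finsum_image_algebra U_proj)
  moreover have "g (?p n) \<in> eigenspace image_algebra (g c) n" if "n \<in> ?N" for n
    using mul_proj_on[OF ax uv, of n] subsetD[OF monster_law_subset that] uv c
    by (auto simp: eigenspace_image_algebra U_proj simp del: insert_iff)
  ultimately show "w \<otimes>\<^bsub>image_algebra\<^esub> w' \<in> eigenspace_sum image_algebra (g c) ?N"
    unfolding eigenspace_sum_def by blast
qed

lemma monster_2gen_image_algebra:
  assumes "monster_axis_on U a" "monster_axis_on U b"
    and gen: "\<And>T. T \<subseteq> U \<Longrightarrow> a \<in> T \<Longrightarrow> b \<in> T \<Longrightarrow> (\<And>u v. u \<in> T \<Longrightarrow> v \<in> T \<Longrightarrow> u + v \<in> T)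
      \<Longrightarrow> (\<And>c u. u \<in> T \<Longrightarrow> c \<cdot> u \<in> T) \<Longrightarrow> (\<And>u v. u \<in> T \<Longrightarrow> v \<in> T \<Longrightarrow> u \<star> v \<in> T) \<Longrightarrow> T = U"
  shows "monster_2gen \<alpha> \<beta> image_algebra"
  unfolding monster_2gen_def
proof (intro conjI allI impI)
  show "comm_nonassoc_algebra image_algebra" by (rule comm_nonassoc_algebra_image_algebra)
  show "primitive_axis \<alpha> \<beta> image_algebra (gen0 image_algebra)" "primitive_axis \<alpha> \<beta> image_algebra (gen1 image_algebra)"
    using primitive_axis_image_algebra assms(1,2) a_in b_in by (simp_all add: image_algebra_simps)
  fix S assume S: "nonassoc_subalgebra S image_algebra \<and> gen0 image_algebra \<in> S \<and> gen1 image_algebra \<in> S"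
  interpret comm_nonassoc_algebra image_algebra by (rule comm_nonassoc_algebra_image_algebra)
  have sub: "submodule S (ring_of_type_algebra :: 'f ring) image_algebra"
    and S_mul: "\<And>u v. u \<in> S \<Longrightarrow> v \<in> S \<Longrightarrow> u \<otimes>\<^bsub>image_algebra\<^esub> v \<in> S"
    using S by (auto simp: nonassoc_subalgebra_def)
  note E = submoduleE[OF sub]
  have "{u \<in> U. g u \<in> S} = U"
  proof (rule gen)
    fix u v c assume uv: "u \<in> {u \<in> U. g u \<in> S}"
    then show "c \<cdot> u \<in> {u \<in> U. g u \<in> S}"
      using E(4)[of c "g u"] by (simp add: ring_of_type_algebra_def image_algebra_simps U_scale)
    assume v: "v \<in> {u \<in> U. g u \<in> S}"
    from uv v show "u + v \<in> {u \<in> U. g u \<in> S}"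
      using E(5)[of "g u" "g v"] by (simp add: image_algebra_simps U_add)
    from uv v show "u \<star> v \<in> {u \<in> U. g u \<in> S}"
      using S_mul[of "g u" "g v"] by (simp add: image_algebra_simps U_mul)
  qed (use S a_in b_in in \<open>auto simp: image_algebra_simps\<close>)
  then have "carrier image_algebra \<subseteq> S" by (auto simp: image_algebra_simps)
  with E(1) show "S = carrier image_algebra" by blast
qed

end

section \<open>Marked algebras inside a vector space\<close>

definition fscale :: "'f::field \<Rightarrow> ('v \<Rightarrow>\<^sub>0 'f) \<Rightarrow> ('v \<Rightarrow>\<^sub>0 'f)" where
  "fscale c = Poly_Mapping.map ((*) c)"

lemma lookup_fscale: "Poly_Mapping.lookup (fscale c w) k = c * Poly_Mapping.lookup w k"
  by (simp add: fscale_def Poly_Mapping.map.rep_eq when_def)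

interpretation fscale: vector_space fscale
  by unfold_locales
     (auto intro!: poly_mapping_eqI simp: lookup_fscale lookup_add algebra_simps)

text \<open>
  Extend a basis of \<open>N\<close> to a basis of the space, and let \<open>p\<close> kill the former and fix the vectors
  added to it.
\<close>

lemma (in vector_space) ex_projection_with_kernel:
  assumes "subspace N"
  shows "\<exists>p. (\<forall>u v. p (u + v) = p u + p v) \<and> (\<forall>c v. p (scale c v) = scale c (p v)) \<and>
    (\<forall>v\<in>N. p v = 0) \<and> (\<forall>v. p v - v \<in> N)"
proof -
  interpret vp: vector_space_pair scale scale ..
  obtain B where B: "B \<subseteq> N" "independent B" "N \<subseteq> span B"
    using maximal_independent_subset[of N] by blast
  define C where "C = extend_basis B"
  have C: "B \<subseteq> C" "independent C" "span C = UNIV"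
    unfolding C_def using B(2) by (rule extend_basis_superset independent_extend_basis span_extend_basis)+
  define p where "p = vp.construct C (\<lambda>b. if b \<in> B then 0 else b)"
  have lin: "Vector_Spaces.linear scale scale p" unfolding p_def by (rule vp.linear_construct[OF C(2)])
  interpret p: Vector_Spaces.linear scale scale p by (rule lin)
  have basis: "p b = (if b \<in> B then 0 else b)" if "b \<in> C" for b
    unfolding p_def by (rule vp.construct_basis[OF C(2) that])
  show ?thesis
  proof (intro exI[of _ p] conjI allI ballI)
    show "p (u + v) = p u + p v" "p (scale c v) = scale c (p v)" for u v c
      by (fact p.add p.scale)+
    show "p v = 0" if "v \<in> N" for v
    proof -
      have "v \<in> span B" using B(3) that by blast
      then show ?thesis
      proof (induction rule: span_induct_alt)
        case (step c x y)
        moreover have "p x = 0" using basis[of x] step(1) C(1) by auto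
        ultimately show ?case by (simp add: p.add p.scale)
      qed (simp add: p.zero)
    qed
    show "p v - v \<in> N" for v
    proof -
      have "v \<in> span C" by (simp add: C(3))
      then show ?thesis
      proof (induction rule: span_induct_alt)
        case base
        show ?case using assms by (simp add: p.zero subspace_0)
      next
        case (step c x y)
        have "p x - x \<in> N"
          using basis[OF step(1)] B(1) assms by (auto simp: subspace_0 subspace_neg)
        then have "scale c (p x - x) + (p y - y) \<in> N"
          using step(2) assms by (blast intro: subspace_add subspace_scale)
        then show ?case by (simp add: p.add p.scale scale_right_diff_distrib algebra_simps)
      qed
    qed
  qed
qed

context comm_nonassoc_algebra
begin

lemma ring_of_type_simps: "carrier (ring_of_type_algebra :: 'f ring) = UNIV"
  "c \<otimes>\<^bsub>(ring_of_type_algebra :: 'f ring)\<^esub> d = c * d"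
  "c \<oplus>\<^bsub>(ring_of_type_algebra :: 'f ring)\<^esub> d = c + d"
  "\<one>\<^bsub>(ring_of_type_algebra :: 'f ring)\<^esub> = 1" "\<zero>\<^bsub>(ring_of_type_algebra :: 'f ring)\<^esub> = 0"
  by (simp_all add: ring_of_type_algebra_def)

lemma smult_closed': "v \<in> carrier V \<Longrightarrow> c \<odot> v \<in> carrier V"
  by (rule smult_closed) (simp_all add: ring_of_type_simps)

lemma smult_zero_left: "v \<in> carrier V \<Longrightarrow> 0 \<odot> v = \<zero>\<^bsub>V\<^esub>"
  using smult_l_null[of v] by (simp add: ring_of_type_simps)

lemma smult_add_left: "v \<in> carrier V \<Longrightarrow> (c + d) \<odot> v = c \<odot> v \<oplus>\<^bsub>V\<^esub> d \<odot> v"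
  using smult_l_distr[of c d v] by (simp add: ring_of_type_simps)

lemma smult_smult: "v \<in> carrier V \<Longrightarrow> (c * d) \<odot> v = c \<odot> (d \<odot> v)"
  using smult_assoc1[of c d v] by (simp add: ring_of_type_simps)

lemma smult_1: "v \<in> carrier V \<Longrightarrow> 1 \<odot> v = v"
  using smult_one[of v] by (simp add: ring_of_type_simps)

text \<open>
  The value of a formal linear combination of elements of the algebra.
\<close>

definition realize :: "('v \<Rightarrow>\<^sub>0 'f) \<Rightarrow> 'v" where
  "realize w = (\<Oplus>\<^bsub>V\<^esub>k\<in>Poly_Mapping.keys w \<inter> carrier V. Poly_Mapping.lookup w k \<odot> k)"

lemma realize_superset:
  assumes "finite S" "Poly_Mapping.keys w \<inter> carrier V \<subseteq> S" "S \<subseteq> carrier V"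
  shows "realize w = (\<Oplus>\<^bsub>V\<^esub>k\<in>S. Poly_Mapping.lookup w k \<odot> k)"
  unfolding realize_def using assms
  by (intro M.add.finprod_mono_neutral_cong_left)
     (auto simp: smult_closed' smult_zero_left in_keys_iff)

lemma realize_closed: "realize w \<in> carrier V"
  unfolding realize_def by (intro M.finsum_closed) (auto simp: smult_closed')

lemma realize_add: "realize (u + w) = realize u \<oplus>\<^bsub>V\<^esub> realize w"
proof -
  let ?S = "(Poly_Mapping.keys u \<union> Poly_Mapping.keys w) \<inter> carrier V"
  have "Poly_Mapping.keys (u + w) \<subseteq> Poly_Mapping.keys u \<union> Poly_Mapping.keys w" by (rule keys_add)
  then have "realize (u + w) = (\<Oplus>\<^bsub>V\<^esub>k\<in>?S. Poly_Mapping.lookup (u + w) k \<odot> k)"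
    by (intro realize_superset) auto
  also have "\<dots> = (\<Oplus>\<^bsub>V\<^esub>k\<in>?S. Poly_Mapping.lookup u k \<odot> k \<oplus>\<^bsub>V\<^esub> Poly_Mapping.lookup w k \<odot> k)"
    by (intro M.finsum_cong') (auto simp: lookup_add smult_add_left smult_closed')
  also have "\<dots> = (\<Oplus>\<^bsub>V\<^esub>k\<in>?S. Poly_Mapping.lookup u k \<odot> k) \<oplus>\<^bsub>V\<^esub> (\<Oplus>\<^bsub>V\<^esub>k\<in>?S. Poly_Mapping.lookup w k \<odot> k)"
    by (intro M.finsum_addf) (auto simp: smult_closed')
  also have "(\<Oplus>\<^bsub>V\<^esub>k\<in>?S. Poly_Mapping.lookup u k \<odot> k) = realize u"
    by (intro realize_superset[symmetric]) auto
  also have "(\<Oplus>\<^bsub>V\<^esub>k\<in>?S. Poly_Mapping.lookup w k \<odot> k) = realize w"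
    by (intro realize_superset[symmetric]) auto
  finally show ?thesis .
qed

lemma realize_fscale: "realize (fscale c w) = c \<odot> realize w"
proof -
  let ?S = "Poly_Mapping.keys w \<inter> carrier V"
  have "realize (fscale c w) = (\<Oplus>\<^bsub>V\<^esub>k\<in>?S. Poly_Mapping.lookup (fscale c w) k \<odot> k)"
    by (intro realize_superset) (auto simp: in_keys_iff lookup_fscale)
  also have "\<dots> = (\<Oplus>\<^bsub>V\<^esub>k\<in>?S. c \<odot> (Poly_Mapping.lookup w k \<odot> k))"
    by (intro M.finsum_cong') (auto simp: lookup_fscale smult_smult smult_closed')
  also have "\<dots> = c \<odot> (\<Oplus>\<^bsub>V\<^esub>k\<in>?S. Poly_Mapping.lookup w k \<odot> k)"
    by (intro finsum_smult_ldistr[symmetric]) (auto simp: smult_closed' ring_of_type_simps)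
  finally show ?thesis by (simp add: realize_def)
qed

lemma realize_single: "v \<in> carrier V \<Longrightarrow> realize (Poly_Mapping.single v 1) = v"
  by (subst realize_superset[of "{v}"]) (auto simp: smult_1)

text \<open>
  The algebra is a quotient of the space of formal linear combinations, and a
  projection along the kernel of the quotient map turns it into a subspace.
\<close>

lemma ex_linear_section:
  obtains r :: "('v \<Rightarrow>\<^sub>0 'f) \<Rightarrow> 'v" and j :: "'v \<Rightarrow> ('v \<Rightarrow>\<^sub>0 'f)"
  where "\<And>w. r w \<in> carrier V" "\<And>u w. r (u + w) = r u \<oplus>\<^bsub>V\<^esub> r w" "\<And>c w. r (fscale c w) = c \<odot> r w"
    "\<And>v. v \<in> carrier V \<Longrightarrow> r (j v) = v"
    "\<And>u v. u \<in> carrier V \<Longrightarrow> v \<in> carrier V \<Longrightarrow> j (u \<oplus>\<^bsub>V\<^esub> v) = j u + j v"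
    "\<And>c v. v \<in> carrier V \<Longrightarrow> j (c \<odot> v) = fscale c (j v)"
proof -
  let ?N = "{w. realize w = \<zero>\<^bsub>V\<^esub>}"
  have zero: "realize 0 = \<zero>\<^bsub>V\<^esub>" by (simp add: realize_def)
  have z: "c \<odot> \<zero>\<^bsub>V\<^esub> = \<zero>\<^bsub>V\<^esub>" for c
    using smult_r_null[of c] by (simp add: ring_of_type_simps)
  have "fscale.subspace ?N"
    by (auto simp: fscale.subspace_def zero realize_add realize_fscale z)
  from fscale.ex_projection_with_kernel[OF this]
  obtain p where p: "\<And>u v. p (u + v) = p u + p v" "\<And>c v. p (fscale c v) = fscale c (p v)"
    "\<And>v. v \<in> ?N \<Longrightarrow> p v = 0" "\<And>v. p v - v \<in> ?N"
    by (elim exE conjE) blast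
  have diff: "realize (u - w) = \<zero>\<^bsub>V\<^esub>" if "realize u = realize w" for u w
  proof -
    have "realize (u - w) \<oplus>\<^bsub>V\<^esub> realize w = realize w"
      using realize_add[of "u - w" w] that by simp
    then show ?thesis by (metis M.add.r_cancel_one' realize_closed)
  qed
  have p_cong: "p u = p w" if "realize u = realize w" for u w
    using p(3)[of "u - w"] diff[OF that] p(1)[of "u - w" w] by simp
  have rp: "realize (p w) = realize w" for w
    using p(4)[of w] realize_add[of "p w - w" w] realize_closed by simp
  define j where "j v = p (Poly_Mapping.single v 1)" for v
  show thesis
  proof (rule that[of realize j])
    fix u v c assume v: "v \<in> carrier V"
    show "realize (j v) = v" by (simp add: j_def rp realize_single v)
    show "j (c \<odot> v) = fscale c (j v)"
      unfolding j_def p(2)[symmetric]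
      by (rule p_cong) (simp add: realize_fscale realize_single v smult_closed')
    assume u: "u \<in> carrier V"
    show "j (u \<oplus>\<^bsub>V\<^esub> v) = j u + j v"
      unfolding j_def p(1)[symmetric]
      by (rule p_cong) (simp add: realize_add realize_single u v)
  qed (fact realize_closed realize_add realize_fscale)+
qed

end

text \<open>
  The embedding \<open>j\<close> has the linear retraction \<open>r\<close>.  The product \<open>wmul\<close> makes the whole space the
  direct sum of the algebra \<open>V\<close> and the kernel of \<open>r\<close>, whose products with all vectors are zero.
\<close>

locale algebra_model = comm_nonassoc_algebra V
  for V :: "('f::field, 'v, 'm) module_scheme" (structure) +
  fixes r :: "'w::ab_group_add \<Rightarrow> 'v" and j :: "'v \<Rightarrow> 'w" and scale :: "'f \<Rightarrow> 'w \<Rightarrow> 'w" and \<alpha> \<beta> :: 'f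
  assumes vector_space: "vector_space scale"
    and r_closed: "r w \<in> carrier V" and r_add: "r (w + w') = r w \<oplus>\<^bsub>V\<^esub> r w'"
    and r_scale: "r (scale c w) = c \<odot> r w" and r_j: "v \<in> carrier V \<Longrightarrow> r (j v) = v"
    and j_add: "u \<in> carrier V \<Longrightarrow> v \<in> carrier V \<Longrightarrow> j (u \<oplus>\<^bsub>V\<^esub> v) = j u + j v"
    and j_scale: "v \<in> carrier V \<Longrightarrow> j (c \<odot> v) = scale c (j v)"
    and two: "(2 :: 'f) \<noteq> 0" and dist: "distinct [0, 1, \<alpha>, \<beta>]"
begin

definition wmul :: "'w \<Rightarrow> 'w \<Rightarrow> 'w" where
  "wmul u w = j (r u \<otimes> r w)"

sublocale W: monster_setting scale wmul \<alpha> \<beta>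
proof -
  interpret vector_space scale by (rule vector_space)
  show "monster_setting scale wmul \<alpha> \<beta>"
  proof
    show "wmul u v = wmul v u" for u v
      by (simp add: wmul_def mult_commute r_closed)
    show "wmul (u + v) w = wmul u w + wmul v w" for u v w
      by (simp add: wmul_def r_add mult_add_left r_closed mult_closed j_add)
    show "wmul (scale c u) v = scale c (wmul u v)" for c u v
      by (simp add: wmul_def r_scale mult_smult_left r_closed mult_closed j_scale)
  qed (fact two dist)+
qed

lemma r_wmul: "r (wmul u w) = r u \<otimes> r w"
  by (simp add: wmul_def r_j mult_closed r_closed)

lemma wmul_j: "u \<in> carrier V \<Longrightarrow> v \<in> carrier V \<Longrightarrow> wmul (j u) (j v) = j (u \<otimes> v)"
  by (simp add: wmul_def r_j)

lemma j_zero: "j \<zero>\<^bsub>V\<^esub> = 0"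
  using j_scale[of "\<zero>\<^bsub>V\<^esub>" 0] by (simp add: smult_zero_left)

lemma j_inj: "u \<in> carrier V \<Longrightarrow> v \<in> carrier V \<Longrightarrow> j u = j v \<Longrightarrow> u = v"
  by (metis r_j)

lemma j_finsum:
  assumes "finite N" "\<And>n. n \<in> N \<Longrightarrow> f n \<in> carrier V"
  shows "j (\<Oplus>\<^bsub>V\<^esub>n\<in>N. f n) = (\<Sum>n\<in>N. j (f n))"
  using assms
proof (induction N rule: finite_induct)
  case (insert n N)
  then have "(\<Oplus>\<^bsub>V\<^esub>n\<in>insert n N. f n) = f n \<oplus>\<^bsub>V\<^esub> (\<Oplus>\<^bsub>V\<^esub>n\<in>N. f n)"
    by (intro M.finsum_insert) auto
  with insert show ?case by (simp add: j_add M.finsum_closed Pi_iff)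
qed (simp add: j_zero)

lemma mult_zero: "v \<in> carrier V \<Longrightarrow> v \<otimes> \<zero>\<^bsub>V\<^esub> = \<zero>\<^bsub>V\<^esub>"
  using mult_smult_left[of "\<zero>\<^bsub>V\<^esub>" v 0]
  by (simp add: smult_zero_left mult_commute[of v] mult_closed)

lemma eigenspace_j:
  assumes "a \<in> carrier V" "v \<in> eigenspace V a l"
  shows "v \<in> carrier V" "wmul (j a) (j v) = scale l (j v)"
proof -
  show v: "v \<in> carrier V" using assms by (simp add: eigenspace_def)
  have "a \<otimes> v = l \<odot> v" using assms mult_commute[OF assms(1) v] by (simp add: eigenspace_def)
  then show "wmul (j a) (j v) = scale l (j v)" using v assms(1) by (simp add: wmul_j j_scale)
qed

text \<open>
  The kernel of \<open>r\<close> consists of \<open>0\<close>-eigenvectors and multiplies everything to zero, which is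
  compatible with the fusion law and adds nothing to the \<open>1\<close>-eigenspace.
\<close>

lemma monster_axis_j:
  assumes ax: "primitive_axis \<alpha> \<beta> V a"
  shows "W.monster_axis (j a)"
proof -
  have a: "a \<in> carrier V" "a \<noteq> \<zero>\<^bsub>V\<^esub>" "a \<otimes> a = a" using ax by (auto simp: primitive_axis_def)
  have proj_sum: "W.proj (j a) m (\<Sum>n\<in>N. f n) = (\<Sum>n\<in>N. W.proj (j a) m (f n))" for N :: "'f set" and f m
    by (induction N rule: infinite_finite_induct) (simp_all add: W.proj_add)
  \<comment> \<open>the annihilating polynomial of the axis\<close>
  define sh where "sh w = W.shift (j a) 1 (W.shift (j a) 0 (W.shift (j a) \<alpha> (W.shift (j a) \<beta> w)))" for w
  have sh_add: "sh (u + w) = sh u + sh w" for u w by (simp add: sh_def W.shift_add)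
  have sh_0: "sh 0 = 0" by (simp add: sh_def W.shift_zero)
  have sh_sum: "sh (\<Sum>n\<in>N. f n) = (\<Sum>n\<in>N. sh (f n))" for N :: "'f set" and f
    by (induction N rule: infinite_finite_induct) (simp_all add: sh_add sh_0)
  have sh_eig: "sh w = 0" if "wmul (j a) w = scale l w" "l \<in> {1, 0, \<alpha>, \<beta>}" for l w
    using that(2) by (auto simp: sh_def W.shift_eigenvector[OF that(1)] W.shift_scale W.shift_zero W.shift_minus)
  have sh_zero: "sh w = 0" for w
  proof -
    obtain f where f: "f \<in> (\<Pi>\<^sub>E l\<in>{1, 0, \<alpha>, \<beta>}. eigenspace V a l)"
      "r w = (\<Oplus>\<^bsub>V\<^esub>l\<in>{1, 0, \<alpha>, \<beta>}. f l)"
      using ax r_closed[of w] unfolding primitive_axis_def by blast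
    have fe: "f l \<in> eigenspace V a l" if "l \<in> {1, 0, \<alpha>, \<beta>}" for l using f(1) that by blast
    have "j (r w) = (\<Sum>l\<in>{1, 0, \<alpha>, \<beta>}. j (f l))"
      unfolding f(2) using fe eigenspace_j(1)[OF a(1)] by (intro j_finsum) blast+
    then have "sh (j (r w)) = (\<Sum>l\<in>{1, 0, \<alpha>, \<beta>}. sh (j (f l)))" by (simp only: sh_sum)
    also have "\<dots> = 0" using fe eigenspace_j(2)[OF a(1)] sh_eig by (intro sum.neutral) blast
    finally have 1: "sh (j (r w)) = 0" .
    have "r (w - j (r w)) \<oplus>\<^bsub>V\<^esub> r w = r w"
      using r_add[of "w - j (r w)" "j (r w)"] by (simp add: r_j r_closed)
    then have "r (w - j (r w)) = \<zero>\<^bsub>V\<^esub>" by (metis M.add.r_cancel_one' r_closed)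
    then have "wmul (j a) (w - j (r w)) = scale 0 (w - j (r w))"
      by (simp add: wmul_def mult_zero r_closed j_zero)
    then have 2: "sh (w - j (r w)) = 0" by (rule sh_eig) simp
    show ?thesis using 1 2 sh_add[of "w - j (r w)" "j (r w)"] by simp
  qed
  have r_eig: "r u \<in> eigenspace V a l" if "wmul (j a) u = scale l u" for u l
  proof -
    have "a \<otimes> r u = l \<odot> r u"
      using arg_cong[OF that, of r] by (simp only: r_wmul r_scale r_j[OF a(1)])
    moreover have "r u \<otimes> a = a \<otimes> r u" by (rule mult_commute[OF r_closed a(1)])
    ultimately show ?thesis by (simp only: eigenspace_def mem_Collect_eq r_closed simp_thms)
  qed
  show ?thesis
    unfolding W.monster_axis_on_def
  proof (intro conjI ballI impI)
    show "j a \<noteq> 0" using a j_inj[of a "\<zero>\<^bsub>V\<^esub>"] j_zero by auto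
    show "wmul (j a) (j a) = j a" by (simp add: wmul_j a)
    show "W.shift (j a) 1 (W.shift (j a) 0 (W.shift (j a) \<alpha> (W.shift (j a) \<beta> v))) = 0" for v
      using sh_zero[of v] by (simp add: sh_def)
  next
    fix l m u v n
    assume lm: "l \<in> {1, 0, \<alpha>, \<beta>}" "m \<in> {1, 0, \<alpha>, \<beta>}"
      and eig: "wmul (j a) u = scale l u" "wmul (j a) v = scale m v"
      and n: "n \<in> {1, 0, \<alpha>, \<beta>} - monster_law \<alpha> \<beta> l m"
    have "r u \<otimes> r v \<in> eigenspace_sum V a (monster_law \<alpha> \<beta> l m)"
      using ax lm r_eig[OF eig(1)] r_eig[OF eig(2)] unfolding primitive_axis_def by blast
    then obtain f where f: "f \<in> (\<Pi> n\<in>monster_law \<alpha> \<beta> l m. eigenspace V a n)"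
      "r u \<otimes> r v = (\<Oplus>\<^bsub>V\<^esub>n\<in>monster_law \<alpha> \<beta> l m. f n)"
      unfolding eigenspace_sum_def by blast
    have sub: "monster_law \<alpha> \<beta> l m \<subseteq> {1, 0, \<alpha>, \<beta>}"
      by (auto simp: monster_law_def split: if_splits)
    then have fin: "finite (monster_law \<alpha> \<beta> l m)" by (rule finite_subset) simp
    have fe: "f k \<in> carrier V" "wmul (j a) (j (f k)) = scale k (j (f k))"
      if "k \<in> monster_law \<alpha> \<beta> l m" for k
      using f(1) that eigenspace_j[OF a(1)] by blast+
    have "wmul u v = (\<Sum>k\<in>monster_law \<alpha> \<beta> l m. j (f k))"
      unfolding wmul_def f(2) using fin fe(1) by (rule j_finsum)
    moreover have "W.proj (j a) n (j (f k)) = 0" if "k \<in> monster_law \<alpha> \<beta> l m" for k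
    proof -
      have "W.proj (j a) n (j (f k)) = (if n = k then j (f k) else 0)"
        using fe(2)[OF that] by (rule W.proj_eigenvector) (use sub that n in blast)+
      then show ?thesis using n that by auto
    qed
    ultimately show "W.proj (j a) n (wmul u v) = 0" by (simp add: proj_sum)
  next
    fix v assume v: "wmul (j a) v = v"
    then have "r v \<in> eigenspace V a 1" by (intro r_eig) simp
    then obtain c where c: "r v = c \<odot> a" using ax unfolding primitive_axis_def by blast
    have "v = j (a \<otimes> r v)" using v by (simp add: wmul_def r_j a)
    also have "a \<otimes> r v = r v"
      using \<open>r v \<in> eigenspace V a 1\<close> mult_commute[OF r_closed a(1), of v]
      by (simp add: eigenspace_def smult_1)
    finally have "v = scale c (j a)" using c a by (simp add: j_scale)
    then show "\<exists>c. v = scale c (j a)" by blast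
  qed
qed

end

section \<open>The universal algebra over a point\<close>

locale monster_family =
  fixes scale :: "'f::field \<Rightarrow> 'w::ab_group_add \<Rightarrow> 'w" and \<alpha> \<beta> :: 'f
    and mul :: "'i \<Rightarrow> 'w \<Rightarrow> 'w \<Rightarrow> 'w" and A0 A1 :: "'i \<Rightarrow> 'w" and P :: "'f ^ 4"
  assumes pair: "monster_pair scale (mul i) \<alpha> \<beta> (A0 i) (A1 i)"
    and point: "monster_pair.point scale (mul i) \<alpha> \<beta> (A0 i) (A1 i) = P"
begin

abbreviation "evi i \<equiv> monster_pair.ev scale (mul i) \<alpha> \<beta> (A0 i) (A1 i)"

definition pscale :: "'f \<Rightarrow> ('i \<Rightarrow> 'w) \<Rightarrow> ('i \<Rightarrow> 'w)" where
  "pscale c f = (\<lambda>i. scale c (f i))"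

definition pmul :: "('i \<Rightarrow> 'w) \<Rightarrow> ('i \<Rightarrow> 'w) \<Rightarrow> ('i \<Rightarrow> 'w)" where
  "pmul f g = (\<lambda>i. mul i (f i) (g i))"

lemma setting: "monster_setting scale (mul i) \<alpha> \<beta>"
  using pair[of i] by (rule monster_pair.axioms(1))

sublocale prod: monster_setting pscale pmul \<alpha> \<beta>
proof
  show "pscale c (u + v) = pscale c u + pscale c v" "pscale (c + d) u = pscale c u + pscale d u"
    "pscale c (pscale d u) = pscale (c * d) u" "pscale 1 u = u"
    "pmul u v = pmul v u" "pmul (u + v) w = pmul u w + pmul v w" "pmul (pscale c u) v = pscale c (pmul u v)"
    for c d u v w
  proof -
    interpret pr: monster_pair scale "mul i" \<alpha> \<beta> "A0 i" "A1 i" for i by (rule pair)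
    show "pscale c (u + v) = pscale c u + pscale c v" "pscale (c + d) u = pscale c u + pscale d u"
      "pscale c (pscale d u) = pscale (c * d) u" "pscale 1 u = u"
      "pmul u v = pmul v u" "pmul (u + v) w = pmul u w + pmul v w" "pmul (pscale c u) v = pscale c (pmul u v)"
      by (auto simp: pscale_def pmul_def fun_eq_iff pr.scale_right_distrib pr.scale_left_distrib
          pr.mul_add_left pr.mul_scale_left intro: pr.mul_commute)
  qed
  show "(2::'f) \<noteq> 0" "distinct [0, 1, \<alpha>, \<beta>]"
    using monster_setting.two_nonzero[OF setting] monster_setting.distinct_eigenvalues[OF setting] by auto
qed

lemma pscale_apply: "pscale c f i = scale c (f i)"
  and pmul_apply: "pmul f g i = mul i (f i) (g i)"
  by (simp_all add: pscale_def pmul_def)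

lemma shift_apply: "prod.shift f l g i = comm_bilinear_algebra.shift scale (mul i) (f i) l (g i)"
proof -
  interpret pr: monster_setting scale "mul i" \<alpha> \<beta> by (rule setting)
  show ?thesis by (simp add: prod.shift_def pr.shift_def pscale_apply pmul_apply)
qed

lemma proj_apply: "prod.proj f l g i = monster_setting.proj scale (mul i) \<alpha> \<beta> (f i) l (g i)"
proof -
  interpret pr: monster_setting scale "mul i" \<alpha> \<beta> by (rule setting)
  show ?thesis
    by (simp add: prod.proj_def pr.proj_def prod.lagrange_def pr.lagrange_def pscale_apply shift_apply)
qed

lemma tau_apply: "prod.tau f g i = monster_setting.tau scale (mul i) \<alpha> \<beta> (f i) (g i)"
proof -
  interpret pr: monster_setting scale "mul i" \<alpha> \<beta> by (rule setting)
  show ?thesis by (simp add: prod.tau_def pr.tau_def proj_apply pscale_apply)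
qed

lemma sigma_apply: "prod.sigma f g i = monster_setting.sigma scale (mul i) \<beta> (f i) (g i)"
proof -
  interpret pr: monster_setting scale "mul i" \<alpha> \<beta> by (rule setting)
  show ?thesis by (simp add: prod.sigma_def pr.sigma_def pmul_apply pscale_apply)
qed

text \<open>
  The simultaneous evaluation.  Its range is the universal algebra over \<open>P\<close>.
\<close>

definition \<Phi> :: "'f fmod \<Rightarrow> ('i \<Rightarrow> 'w)" where
  "\<Phi> m = (\<lambda>i. evi i m)"

lemma \<Phi>_add: "\<Phi> (m + n) = \<Phi> m + \<Phi> n"
  by (simp add: \<Phi>_def fun_eq_iff monster_pair.ev_add[OF pair])

lemma \<Phi>_smult: "\<Phi> (p *s m) = pscale (eval4 p P) (\<Phi> m)"
  by (simp add: \<Phi>_def fun_eq_iff monster_pair.ev_smult[OF pair] pscale_apply point)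

lemma \<Phi>_mul: "\<Phi> (monster_polynomials.prod_M \<alpha> \<beta> m n) = pmul (\<Phi> m) (\<Phi> n)"
  by (simp add: \<Phi>_def fun_eq_iff monster_pair.ev_prod_M[OF pair] pmul_apply)

lemma \<Phi>_zero: "\<Phi> 0 = 0"
  by (simp add: \<Phi>_def fun_eq_iff monster_pair.ev_zero[OF pair])

lemma \<Phi>_sum: "\<Phi> (\<Sum>i\<in>S. f i) = (\<Sum>i\<in>S. \<Phi> (f i))"
  by (induction S rule: infinite_finite_induct) (simp_all add: \<Phi>_add \<Phi>_zero)

lemma \<Phi>_e: "\<Phi> (monster_polynomials.e 0) = A0" "\<Phi> (monster_polynomials.e 1) = A1"
  by (simp_all add: \<Phi>_def fun_eq_iff monster_pair.ev_e[OF pair])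

text \<open>
  Everything but primitivity is componentwise.  In a \<open>1\<close>-eigenvector \<open>\<Phi> m\<close>, each component is
  a multiple of the axis there, and the hypothesis on \<open>\<lambda>\<close> says that the factor is the same in all
  components.
\<close>

lemma monster_axis_on_range:
  assumes ax: "\<And>i. monster_setting.monster_axis scale (mul i) \<alpha> \<beta> (A i)"
    and lam: "\<And>m. \<exists>c. \<forall>i. monster_setting.lam scale (mul i) \<alpha> \<beta> (A i) (evi i m) = c"
  shows "prod.monster_axis_on (range \<Phi>) A"
proof -
  interpret pr: monster_setting scale "mul i" \<alpha> \<beta> for i by (rule setting)
  show ?thesis
    unfolding prod.monster_axis_on_def
  proof (intro conjI ballI impI)
    show "A \<noteq> 0" using pr.axis_nonzero[OF ax] by (auto simp: fun_eq_iff)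
    show "pmul A A = A" by (simp add: fun_eq_iff pmul_apply pr.axis_idem[OF ax])
    show "prod.shift A 1 (prod.shift A 0 (prod.shift A \<alpha> (prod.shift A \<beta> v))) = 0" for v
    proof (rule ext)
      fix i
      have "pr.shift i (A i) 1 (pr.shift i (A i) 0 (pr.shift i (A i) \<alpha> (pr.shift i (A i) \<beta> (v i)))) = 0"
        using ax[of i] unfolding pr.monster_axis_on_def by blast
      then show "prod.shift A 1 (prod.shift A 0 (prod.shift A \<alpha> (prod.shift A \<beta> v))) i = 0 i"
        by (simp add: shift_apply)
    qed
  next
    fix l m u v n
    assume lm: "l \<in> {1, 0, \<alpha>, \<beta>}" "m \<in> {1, 0, \<alpha>, \<beta>}" "n \<in> {1, 0, \<alpha>, \<beta>} - monster_law \<alpha> \<beta> l m"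
      and uv: "pmul A u = pscale l u" "pmul A v = pscale m v"
    show "prod.proj A n (pmul u v) = 0"
    proof (rule ext)
      fix i
      have "pr.proj i (A i) n (mul i (u i) (v i)) = 0"
        using fun_cong[OF uv(1), of i] fun_cong[OF uv(2), of i] lm
        by (intro pr.fusion[OF ax, of i "u i" l "v i" m n]) (simp_all only: pmul_apply pscale_apply Diff_iff not_False_eq_True)
      then show "prod.proj A n (pmul u v) i = 0 i" by (simp add: proj_apply pmul_apply)
    qed
  next
    fix v assume "v \<in> range \<Phi>" and eig: "pmul A v = v"
    then obtain m where m: "v = \<Phi> m" by blast
    obtain c where c: "monster_setting.lam scale (mul i) \<alpha> \<beta> (A i) (evi i m) = c" for i
      using lam by blast
    have "v = pscale c A"
    proof (rule ext)
      fix i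
      have "mul i (A i) (v i) = scale 1 (v i)"
        using fun_cong[OF eig, of i] by (simp add: pmul_apply)
      then have "pr.proj i (A i) 1 (v i) = v i"
        using pr.proj_eigenvector[of i "A i" "v i" 1 1] by simp
      then show "v i = pscale c A i"
        using pr.proj_1[OF ax, of i "v i"] c[of i] by (simp add: m \<Phi>_def pscale_apply)
    qed
    then show "\<exists>c. v = pscale c A" by blast
  qed
qed

lemma axis_A0: "prod.monster_axis_on (range \<Phi>) A0"
  using monster_pair.axis0[OF pair]
proof (rule monster_axis_on_range)
  show "\<exists>c. \<forall>i. monster_setting.lam scale (mul i) \<alpha> \<beta> (A0 i) (evi i m) = c" for m
    by (metis monster_pair.eval4_Lambda[OF pair] point)
qed

lemma axis_A1: "prod.monster_axis_on (range \<Phi>) A1"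
  using monster_pair.axis1[OF pair]
proof (rule monster_axis_on_range)
  fix m
  have "monster_setting.lam scale (mul i) \<alpha> \<beta> (A1 i) (evi i m)
      = eval4 (monster_polynomials.Lambda \<alpha> \<beta> (monster_polynomials.F \<alpha> \<beta> m)) (swap_point P)" for i
  proof -
    interpret pr: monster_pair scale "mul i" \<alpha> \<beta> "A0 i" "A1 i" by (rule pair)
    interpret f: monster_pair scale "mul i" \<alpha> \<beta> "A1 i" "A0 i" by (rule pr.flip)
    show ?thesis
      using f.eval4_Lambda[of "pr.mp.F m"] by (simp add: f.ev_F pr.flip_point point)
  qed
  then show "\<exists>c. \<forall>i. monster_setting.lam scale (mul i) \<alpha> \<beta> (A1 i) (evi i m) = c" by blast
qed

text \<open>
  The images of the eight basis vectors are obtained from \<open>A\<^sub>0, A\<^sub>1\<close> by involutions and products,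
  and the involutions are polynomials in multiplications.
\<close>

lemma range_\<Phi>_generated:
  assumes T: "T \<subseteq> range \<Phi>" "A0 \<in> T" "A1 \<in> T"
    and add: "\<And>u v. u \<in> T \<Longrightarrow> v \<in> T \<Longrightarrow> u + v \<in> T"
    and scale: "\<And>c u. u \<in> T \<Longrightarrow> pscale c u \<in> T"
    and mul: "\<And>u v. u \<in> T \<Longrightarrow> v \<in> T \<Longrightarrow> pmul u v \<in> T"
  shows "T = range \<Phi>"
proof
  have zero: "0 \<in> T" using scale[OF T(2), of 0] by simp
  have minus: "- u \<in> T" if "u \<in> T" for u using scale[OF that, of "-1"] by simp
  have diff: "u - v \<in> T" if "u \<in> T" "v \<in> T" for u v
    using add[OF that(1) minus[OF that(2)]] by simp
  have shift: "prod.shift u l v \<in> T" if "u \<in> T" "v \<in> T" for u l v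
    using that by (simp add: prod.shift_def diff mul scale)
  have tau: "prod.tau u v \<in> T" if "u \<in> T" "v \<in> T" for u v
    using that by (simp add: prod.tau_def prod.proj_def prod.lagrange_def diff shift scale)
  have sigma: "prod.sigma u v \<in> T" if "u \<in> T" "v \<in> T" for u v
    using that by (simp add: prod.sigma_def diff mul scale add)
  have basis: "\<Phi> (axis b 1) \<in> T" for b
  proof -
    interpret pr: monster_pair scale "mul i" \<alpha> \<beta> "A0 i" "A1 i" for i by (rule pair)
    define am1 a2 where "am1 = prod.tau A0 A1" and "a2 = prod.tau A1 A0"
    have "am1 \<in> T" "a2 \<in> T" using T tau by (simp_all add: am1_def a2_def)
    then have "(case b of Em2 \<Rightarrow> prod.tau A0 a2 | Em1 \<Rightarrow> am1 | E0 \<Rightarrow> A0 | E1 \<Rightarrow> A1 | E2 \<Rightarrow> a2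
       | S1 \<Rightarrow> prod.sigma A0 A1 | S2 \<Rightarrow> prod.sigma A0 a2 | S2' \<Rightarrow> prod.sigma A1 am1) \<in> T"
      using T tau sigma by (cases b) simp_all
    also have "(case b of Em2 \<Rightarrow> prod.tau A0 a2 | Em1 \<Rightarrow> am1 | E0 \<Rightarrow> A0 | E1 \<Rightarrow> A1 | E2 \<Rightarrow> a2
       | S1 \<Rightarrow> prod.sigma A0 A1 | S2 \<Rightarrow> prod.sigma A0 a2 | S2' \<Rightarrow> prod.sigma A1 am1) = \<Phi> (axis b 1)"
      by (cases b) (simp_all add: fun_eq_iff \<Phi>_def pr.ev_axis pr.bvec_def am1_def a2_def tau_apply
          sigma_apply pr.am1_def pr.a2_def pr.am2_def pr.s1_def pr.s2_def pr.s2'_def)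
    finally show ?thesis .
  qed
  have sum: "(\<Sum>i\<in>S. f i) \<in> T" if "\<And>i. f i \<in> T" for S :: "bas set" and f
    by (induction S rule: infinite_finite_induct)
       (simp_all only: sum.infinite sum.empty sum.insert not_False_eq_True zero add that)
  have "\<Phi> m \<in> T" for m
  proof -
    have "m = (\<Sum>b\<in>UNIV. m $ b *s axis b 1)"
      by (simp add: vec_eq_iff axis_def if_distrib cong: if_cong)
    then have "\<Phi> m = (\<Sum>b\<in>UNIV. pscale (eval4 (m $ b) P) (\<Phi> (axis b 1)))"
      by (metis (no_types, lifting) \<Phi>_sum \<Phi>_smult sum.cong)
    then show ?thesis using basis by (simp add: sum scale)
  qed
  then show "range \<Phi> \<subseteq> T" by blast
qed (fact T(1))

text \<open>
  Only the eight values of the coefficients at \<open>P\<close> matter, which bounds the size of the range.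
\<close>

lemma \<Phi>_factor: "\<Phi> m = \<Phi> (\<chi> b. cst (eval4 (m $ b) P))"
proof -
  interpret pr: monster_pair scale "mul i" \<alpha> \<beta> "A0 i" "A1 i" for i by (rule pair)
  show ?thesis by (simp add: \<Phi>_def pr.ev_def point eval4_cst)
qed

lemma monster_subalgebra_range:
  assumes "inj_on g (range \<Phi>)"
  shows "monster_subalgebra pscale pmul \<alpha> \<beta> (range \<Phi>) g A0 A1"
proof
  show "0 \<in> range \<Phi>" by (metis \<Phi>_zero rangeI)
  show "A0 \<in> range \<Phi>" "A1 \<in> range \<Phi>" by (metis \<Phi>_e rangeI)+
  fix u v c assume "u \<in> range \<Phi>"
  then obtain m where m: "u = \<Phi> m" by blast
  show "pscale c u \<in> range \<Phi>"
    using \<Phi>_smult[of "cst c" m] by (metis m eval4_cst rangeI)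
  assume "v \<in> range \<Phi>"
  then obtain n where n: "v = \<Phi> n" by blast
  show "u + v \<in> range \<Phi>" "pmul u v \<in> range \<Phi>"
    by (metis m n \<Phi>_add \<Phi>_mul rangeI)+
qed (fact assms)

end

lemma lepoll_bas_fun:
  assumes inf: "infinite (UNIV :: 'v set)" and le: "(UNIV :: 'f set) \<lesssim> (UNIV :: 'v set)"
  shows "(UNIV :: (bas \<Rightarrow> 'f) set) \<lesssim> (UNIV :: 'v set)"
proof -
  obtain \<iota> :: "'f \<Rightarrow> 'v" where \<iota>: "inj \<iota>" using le by (auto simp: lepoll_def)
  have "(card_of ((UNIV :: 'v set) \<times> (UNIV :: 'v set)), card_of (UNIV :: 'v set)) \<in> ordIso"
    by (rule card_of_Times_same_infinite[OF inf])
  then obtain p :: "'v \<times> 'v \<Rightarrow> 'v" where "bij_betw p (UNIV \<times> UNIV) UNIV"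
    using card_of_ordIso by blast
  then have p: "inj p" by (simp add: bij_betw_def)
  let ?k = "\<lambda>c :: bas \<Rightarrow> 'f. p (p (p (\<iota> (c Em2), \<iota> (c Em1)), p (\<iota> (c E0), \<iota> (c E1))),
    p (p (\<iota> (c E2), \<iota> (c S1)), p (\<iota> (c S2), \<iota> (c S2'))))"
  have "inj ?k"
  proof (rule injI)
    fix c d assume "?k c = ?k d"
    then have "c b = d b" for b
      by (cases b) (simp_all add: inj_eq[OF p] inj_eq[OF \<iota>])
    then show "c = d" by blast
  qed
  then show ?thesis by (auto simp: lepoll_def)
qed

lemma is_quotient_of_iso:
  assumes R: "comm_nonassoc_algebra R" and iso: "marked_iso R W" and quot: "is_quotient_of V R"
    and gens: "gen0 R \<in> carrier R" "gen1 R \<in> carrier R"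
  shows "is_quotient_of V W"
proof -
  interpret comm_nonassoc_algebra R by (rule R)
  obtain \<phi> where \<phi>: "\<phi> \<in> marked_hom R W" "bij_betw \<phi> (carrier R) (carrier W)"
    using iso by (auto simp: marked_iso_def)
  obtain f where f: "f \<in> marked_hom R V" "f ` carrier R = carrier V"
    using quot by (auto simp: is_quotient_of_def)
  define \<psi> where "\<psi> = inv_into (carrier R) \<phi>"
  have \<psi>\<phi>: "\<psi> (\<phi> u) = u" if "u \<in> carrier R" for u
    using \<phi>(2) that by (simp add: \<psi>_def bij_betw_inv_into_left)
  have W: "carrier W = \<phi> ` carrier R" using \<phi>(2) by (simp add: bij_betw_def)
  note h = \<phi>(1)[unfolded marked_hom_def mem_Collect_eq]
  note k = f(1)[unfolded marked_hom_def mem_Collect_eq]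
  have "(\<lambda>w. f (\<psi> w)) \<in> marked_hom W V"
    unfolding marked_hom_def mem_Collect_eq
  proof (intro conjI ballI allI)
    show "(\<lambda>w. f (\<psi> w)) \<in> carrier W \<rightarrow> carrier V" using k by (auto simp: W \<psi>\<phi>)
    show "f (\<psi> (gen0 W)) = gen0 V" "f (\<psi> (gen1 W)) = gen1 V"
      using h k gens \<psi>\<phi>[of "gen0 R"] \<psi>\<phi>[of "gen1 R"] by auto
    fix u c assume "u \<in> carrier W"
    then obtain u' where u: "u' \<in> carrier R" "u = \<phi> u'" by (auto simp: W)
    have "c \<odot>\<^bsub>W\<^esub> u = \<phi> (c \<odot>\<^bsub>R\<^esub> u')" using h u by simp
    then show "f (\<psi> (c \<odot>\<^bsub>W\<^esub> u)) = c \<odot>\<^bsub>V\<^esub> f (\<psi> u)"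
      using k u by (simp add: \<psi>\<phi> smult_closed')
    fix v assume "v \<in> carrier W"
    then obtain v' where v: "v' \<in> carrier R" "v = \<phi> v'" by (auto simp: W)
    have "u \<oplus>\<^bsub>W\<^esub> v = \<phi> (u' \<oplus>\<^bsub>R\<^esub> v')" "u \<otimes>\<^bsub>W\<^esub> v = \<phi> (u' \<otimes>\<^bsub>R\<^esub> v')" using h u v by simp_all
    then show "f (\<psi> (u \<oplus>\<^bsub>W\<^esub> v)) = f (\<psi> u) \<oplus>\<^bsub>V\<^esub> f (\<psi> v)"
      "f (\<psi> (u \<otimes>\<^bsub>W\<^esub> v)) = f (\<psi> u) \<otimes>\<^bsub>V\<^esub> f (\<psi> v)"
      using k u v by (simp_all add: \<psi>\<phi> mult_closed)
  qed
  moreover have "(\<lambda>w. f (\<psi> w)) ` carrier W = carrier V"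
    using f(2) by (auto simp: W \<psi>\<phi> image_image)
  ultimately show ?thesis by (auto simp: is_quotient_of_def)
qed

context algebra_model
begin

text \<open>
  The vectors of \<open>V\<close> that \<open>ev\<close> reaches form a subalgebra containing both generators.
\<close>

lemma ex_ev_eq_j:
  assumes pair: "monster_pair scale wmul \<alpha> \<beta> (j a) (j b)" and ab: "a \<in> carrier V" "b \<in> carrier V"
    and gen: "\<And>S. nonassoc_subalgebra S V \<Longrightarrow> a \<in> S \<Longrightarrow> b \<in> S \<Longrightarrow> S = carrier V"
    and v: "v \<in> carrier V"
  shows "\<exists>m. j v = monster_pair.ev scale wmul \<alpha> \<beta> (j a) (j b) m"
proof -
  interpret pr: monster_pair scale wmul \<alpha> \<beta> "j a" "j b" by (rule pair)
  let ?S = "{v \<in> carrier V. j v \<in> range pr.ev}"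
  have add: "u \<oplus> v \<in> ?S" and smult: "c \<odot> u \<in> ?S" and mult: "u \<otimes> v \<in> ?S" if uv: "u \<in> ?S" "v \<in> ?S" for u v c
  proof -
    obtain m n where mn: "j u = pr.ev m" "j v = pr.ev n" using uv by blast
    have "j (u \<oplus> v) = pr.ev (m + n)" "j (c \<odot> u) = pr.ev (cst c *s m)" "j (u \<otimes> v) = pr.ev (pr.mp.prod_M m n)"
      using uv mn by (simp_all add: j_add j_scale wmul_j[symmetric] pr.ev_add pr.ev_smult pr.ev_prod_M eval4_cst)
    then show "u \<oplus> v \<in> ?S" "c \<odot> u \<in> ?S" "u \<otimes> v \<in> ?S"
      using uv by (auto simp: smult_closed' mult_closed)
  qed
  have "submodule ?S (ring_of_type_algebra :: 'f ring) V"
  proof (rule submoduleI)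
    show "\<zero> \<in> ?S" using pr.ev_zero by (auto simp: j_zero intro!: rev_image_eqI[of 0])
    show "\<ominus> u \<in> ?S" if "u \<in> ?S" for u
    proof -
      have "\<ominus> u = (- 1) \<odot> u"
        using smult_l_minus[of 1 u] that
        by (metis (no_types, lifting) M.minus_equality add.commute add.right_inverse mem_Collect_eq smult_1 smult_add_left smult_closed' smult_zero_left)
      then show ?thesis using smult[OF that that, of "-1"] by simp
    qed
  qed (use add smult in auto)
  then have "nonassoc_subalgebra ?S V" using mult by (auto simp: nonassoc_subalgebra_def)
  moreover have "a \<in> ?S" "b \<in> ?S"
    using ab pr.ev_e(1,2) rangeI[of pr.ev] by (metis (mono_tags, lifting) mem_Collect_eq)+
  ultimately have "?S = carrier V" by (rule gen)
  then show ?thesis using v by auto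
qed

end

lemma two_nonzero_if_CHAR_neq_2:
  assumes "CHAR('f::field) \<noteq> 2"
  shows "(2 :: 'f) \<noteq> 0"
proof
  assume "(2 :: 'f) = 0"
  then have "of_nat 2 = (0 :: 'f)" by simp
  then have "CHAR('f) dvd 2" by (simp only: of_nat_eq_0_iff_char_dvd)
  then have "CHAR('f) = 1 \<or> CHAR('f) = 2" using prime_nat_iff two_is_prime_nat by blast
  then show False using assms CHAR_not_1' by auto
qed

lemma ex_algebra_model:
  fixes V :: "('f::field, 'v) marked_algebra"
  assumes "(2 :: 'f) \<noteq> 0" "distinct [0, 1, \<alpha>, \<beta>]" "monster_2gen \<alpha> \<beta> V"
  shows "\<exists>r j. algebra_model V r j (fscale :: 'f \<Rightarrow> ('v \<Rightarrow>\<^sub>0 'f) \<Rightarrow> _) \<alpha> \<beta>"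
proof -
  interpret comm_nonassoc_algebra V using assms(3) by (simp add: monster_2gen_def)
  obtain r :: "('v \<Rightarrow>\<^sub>0 'f) \<Rightarrow> 'v" and j where rj: "\<And>w. r w \<in> carrier V"
    "\<And>u w. r (u + w) = r u \<oplus>\<^bsub>V\<^esub> r w" "\<And>c w. r (fscale c w) = c \<odot>\<^bsub>V\<^esub> r w"
    "\<And>v. v \<in> carrier V \<Longrightarrow> r (j v) = v"
    "\<And>u v. u \<in> carrier V \<Longrightarrow> v \<in> carrier V \<Longrightarrow> j (u \<oplus>\<^bsub>V\<^esub> v) = j u + j v"
    "\<And>c v. v \<in> carrier V \<Longrightarrow> j (c \<odot>\<^bsub>V\<^esub> v) = fscale c (j v)"
    by (rule ex_linear_section) blast
  have "algebra_model V r j fscale \<alpha> \<beta>"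
    by unfold_locales (use rj assms fscale.vector_space_axioms in auto)
  then show ?thesis by blast
qed

theorem theorem1p2:
  fixes \<alpha> \<beta> :: "'f::field"
    and Mr :: "('f, 'v) marked_algebra set"
  assumes "CHAR('f) \<noteq> 2"
    and "distinct [0, 1, \<alpha>, \<beta>]"
    and "\<alpha> \<notin> {2 * \<beta>, 4 * \<beta>}"
    and "infinite (UNIV :: 'v set)"
    and "(UNIV :: 'f set) \<lesssim> (UNIV :: 'v set)"
    and "iso_class_representatives \<alpha> \<beta> Mr"
  shows "\<exists>\<xi> :: ('f, 'v) marked_algebra \<Rightarrow> 'f ^ 4.
    \<xi> ` Mr \<subseteq> Var {monster_polynomials.p1 \<alpha> \<beta>, monster_polynomials.p2 \<alpha> \<beta>,
                   monster_polynomials.p3 \<alpha> \<beta>, monster_polynomials.p4 \<alpha> \<beta>} \<and>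
    (\<forall>P\<in>\<xi> ` Mr. \<exists>V\<^sub>P\<in>Mr. \<forall>V\<in>Mr. \<xi> V = P \<longrightarrow> is_quotient_of V V\<^sub>P)"
proof -
  have two: "(2 :: 'f) \<noteq> 0" using assms(1) by (rule two_nonzero_if_CHAR_neq_2)
  have gen: "monster_2gen \<alpha> \<beta> V" if "V \<in> Mr" for V
    using assms(6) that by (simp add: iso_class_representatives_def)
  have "\<forall>V\<in>Mr. \<exists>r j. algebra_model V r j (fscale :: 'f \<Rightarrow> ('v \<Rightarrow>\<^sub>0 'f) \<Rightarrow> _) \<alpha> \<beta>"
    using ex_algebra_model[OF two assms(2) gen] by blast
  then obtain r j where model: "algebra_model V (r V) (j V) (fscale :: 'f \<Rightarrow> ('v \<Rightarrow>\<^sub>0 'f) \<Rightarrow> _) \<alpha> \<beta>"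
    if "V \<in> Mr" for V by metis
  define wm where "wm V = algebra_model.wmul V (r V) (j V)" for V
  define b0 b1 where "b0 V = j V (gen0 V)" and "b1 V = j V (gen1 V)" for V
  have pair: "monster_pair fscale (wm V) \<alpha> \<beta> (b0 V) (b1 V)" if "V \<in> Mr" for V
  proof -
    interpret M: algebra_model V "r V" "j V" fscale \<alpha> \<beta> by (rule model[OF that])
    have "primitive_axis \<alpha> \<beta> V (gen0 V)" "primitive_axis \<alpha> \<beta> V (gen1 V)"
      using gen[OF that] by (simp_all add: monster_2gen_def)
    then show ?thesis
      unfolding wm_def b0_def b1_def
      by unfold_locales (use M.monster_axis_j assms(3) in auto)
  qed
  define \<xi> where "\<xi> V = monster_pair.point fscale (wm V) \<alpha> \<beta> (b0 V) (b1 V)" for V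
  have "\<xi> ` Mr \<subseteq> Var {monster_polynomials.p1 \<alpha> \<beta>, monster_polynomials.p2 \<alpha> \<beta>,
                   monster_polynomials.p3 \<alpha> \<beta>, monster_polynomials.p4 \<alpha> \<beta>}"
    using monster_pair.point_in_Var[OF pair] by (auto simp: \<xi>_def)
  moreover have "\<exists>V\<^sub>P\<in>Mr. \<forall>V\<in>Mr. \<xi> V = P \<longrightarrow> is_quotient_of V V\<^sub>P" if P: "P \<in> \<xi> ` Mr" for P
  proof -
    obtain V0 where V0: "V0 \<in> Mr" "\<xi> V0 = P" using P by blast
    \<comment> \<open>algebras outside the fibre are replaced by one inside, so that the family may be indexed by a whole type\<close>
    define idx where "idx V = (if V \<in> Mr \<and> \<xi> V = P then V else V0)" for V
    have idx: "idx V \<in> Mr" "\<xi> (idx V) = P" for V using V0 by (auto simp: idx_def)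
    interpret F: monster_family fscale \<alpha> \<beta> "\<lambda>V. wm (idx V)" "\<lambda>V. b0 (idx V)" "\<lambda>V. b1 (idx V)" P
      using pair[OF idx(1)] idx(2)[unfolded \<xi>_def] by (rule monster_family.intro)
    have "F.\<Phi> m \<in> range (\<lambda>c. F.\<Phi> (\<chi> b. cst (c b)))" for m
      by (rule range_eqI[of _ _ "\<lambda>b. eval4 (m $ b) P"]) (rule F.\<Phi>_factor)
    then have "range F.\<Phi> = (\<lambda>c. F.\<Phi> (\<chi> b. cst (c b))) ` UNIV" by blast
    also have "\<dots> \<lesssim> (UNIV :: (bas \<Rightarrow> 'f) set)" by (rule image_lepoll)
    also have "\<dots> \<lesssim> (UNIV :: 'v set)" by (rule lepoll_bas_fun[OF assms(4,5)])
    finally obtain g :: "_ \<Rightarrow> 'v" where g: "inj_on g (range F.\<Phi>)" by (auto simp: lepoll_def)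
    interpret S: monster_subalgebra F.pscale F.pmul \<alpha> \<beta> "range F.\<Phi>" g "\<lambda>V. b0 (idx V)" "\<lambda>V. b1 (idx V)"
      by (rule F.monster_subalgebra_range[OF g])
    have "monster_2gen \<alpha> \<beta> S.image_algebra"
      by (rule S.monster_2gen_image_algebra[OF F.axis_A0 F.axis_A1 F.range_\<Phi>_generated])
    then obtain V\<^sub>P where VP: "V\<^sub>P \<in> Mr" "marked_iso S.image_algebra V\<^sub>P"
      using assms(6) unfolding iso_class_representatives_def by blast
    have "is_quotient_of V V\<^sub>P" if V: "V \<in> Mr" "\<xi> V = P" for V
    proof (rule is_quotient_of_iso[OF S.comm_nonassoc_algebra_image_algebra VP(2)])
      interpret M: algebra_model V "r V" "j V" fscale \<alpha> \<beta> by (rule model[OF V(1)])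
      have i: "idx V = V" using V by (simp add: idx_def)
      have gens: "gen0 V \<in> carrier V" "gen1 V \<in> carrier V"
        using gen[OF V(1)] by (simp_all add: monster_2gen_def primitive_axis_def)
      have r_gens: "r V (b0 V) = gen0 V" "r V (b1 V) = gen1 V"
        by (simp_all add: b0_def b1_def M.r_j gens)
      have r_wm: "r V (wm V u w) = r V u \<otimes>\<^bsub>V\<^esub> r V w" for u w
        by (simp add: wm_def M.r_wmul)
      \<comment> \<open>the coordinate projection from the universal algebra to its factor V\<close>
      define f where "f w = r V (S.h w V)" for w
      have f: "f (g u) = r V (u V)" if "u \<in> range F.\<Phi>" for u
        using that by (simp add: f_def S.h_g)
      show "gen0 S.image_algebra \<in> carrier S.image_algebra" "gen1 S.image_algebra \<in> carrier S.image_algebra"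
        using S.a_in S.b_in by (simp_all add: S.image_algebra_simps)
      have hom: "f \<in> marked_hom S.image_algebra V"
        unfolding marked_hom_def mem_Collect_eq
      proof (intro conjI ballI allI)
        show "f \<in> carrier S.image_algebra \<rightarrow> carrier V" by (auto simp: f_def M.r_closed)
        show "f (gen0 S.image_algebra) = gen0 V" "f (gen1 S.image_algebra) = gen1 V"
          by (simp_all only: S.image_algebra_simps(3,4) f[OF S.a_in] f[OF S.b_in] i r_gens)
        fix u c assume "u \<in> carrier S.image_algebra"
        then obtain u' where u: "u = g u'" "u' \<in> range F.\<Phi>" by (auto simp: S.image_algebra_simps)
        show "f (c \<odot>\<^bsub>S.image_algebra\<^esub> u) = c \<odot>\<^bsub>V\<^esub> f u"
          using u S.U_scale[OF u(2), of c] by (simp add: S.image_algebra_simps f F.pscale_apply M.r_scale)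
        fix v assume "v \<in> carrier S.image_algebra"
        then obtain v' where v: "v = g v'" "v' \<in> range F.\<Phi>" by (auto simp: S.image_algebra_simps)
        show "f (u \<oplus>\<^bsub>S.image_algebra\<^esub> v) = f u \<oplus>\<^bsub>V\<^esub> f v"
          using u v S.U_add[OF u(2) v(2)] by (simp add: S.image_algebra_simps f M.r_add)
        show "f (u \<otimes>\<^bsub>S.image_algebra\<^esub> v) = f u \<otimes>\<^bsub>V\<^esub> f v"
          using u v S.U_mul[OF u(2) v(2)]
          by (simp add: S.image_algebra_simps f F.pmul_apply i r_wm)
      qed
      have "f ` carrier S.image_algebra \<subseteq> carrier V" by (auto simp: f_def M.r_closed)
      moreover have "carrier V \<subseteq> f ` carrier S.image_algebra"
      proof
        fix v assume v: "v \<in> carrier V"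
        have "monster_pair fscale M.wmul \<alpha> \<beta> (j V (gen0 V)) (j V (gen1 V))"
          using pair[OF V(1)] by (simp add: wm_def b0_def b1_def)
        moreover have "S = carrier V" if "nonassoc_subalgebra S V" "gen0 V \<in> S" "gen1 V \<in> S" for S
          using gen[OF V(1)] that by (simp add: monster_2gen_def)
        ultimately obtain m where "j V v = monster_pair.ev fscale (wm V) \<alpha> \<beta> (b0 V) (b1 V) m"
          unfolding wm_def b0_def b1_def using M.ex_ev_eq_j[OF _ gens _ v] by blast
        then have "F.\<Phi> m V = j V v" by (simp only: F.\<Phi>_def i)
        then have "v = f (g (F.\<Phi> m))" using M.r_j[OF v] by (simp only: f[OF rangeI])
        then show "v \<in> f ` carrier S.image_algebra" by (simp add: S.image_algebra_simps)
      qed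
      ultimately have "f ` carrier S.image_algebra = carrier V" by (rule equalityI)
      then show "is_quotient_of V S.image_algebra"
        unfolding is_quotient_of_def using hom by (rule bexI)
    qed
    then show ?thesis using VP(1) by blast
  qed
  ultimately show ?thesis by blast
qed

end
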